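(* If $\boldsymbol{u}_h$ satisfies the semidiscrete problem $(\mathring{\mathcal{W}}_h)$ (defined in the context) and $C_{\mathrm{Nit}}$ is sufficiently large, then $$\frac{\partial}{\partial t}\,\frac12\|\boldsymbol{u}_h\|^2_{\mathbf{L}^2(\mathcal{T}_h)}=-\mathscr{A}_{\mathrm{stb}}(\boldsymbol{u}_h,\boldsymbol{u}_h)+(\boldsymbol{f},\boldsymbol{u}_h)\ \le\ (\boldsymbol{f},\boldsymbol{u}_h).$$
   Context: Conventions. $d\in\{2,3\}$. $(\cdot,\cdot)$ is the $L^2(\Omega)$ inner product of scalar, vector or tensor fields, $(\cdot,\cdot)_{\partial\Omega}$ and $(\cdot,\cdot)_e$ are the $L^2$ inner products on $\partial\Omega$ and on a facet $e$. $(\nabla\boldsymbol{a})_{ij}=\partial a_j/\partial x_i$, $\nabla^s\boldsymbol{a}=\frac12(\nabla\boldsymbol{a}+(\nabla\boldsymbol{a})^T)$, $\boldsymbol{C}:\boldsymbol{D}=C_{ij}D_{ij}$. $\mathbf{H}^1_{\boldsymbol{n}}(\Omega)=\{\boldsymbol{u}\in H^1(\Omega)^d : \boldsymbol{u}\cdot\boldsymbol{n}=0 \text{ on }\partial\Omega\}$ (trace sense). Time-dependence of function spaces is suppressed in the notation; $\boldsymbol{f}$ and $\boldsymbol{u}_h$ may depend on time $t\in(0,T]$, with $\boldsymbol{f}\in\mathbf{L}^2(\Omega)=L^2(\Omega)^d$. Mesh and spline spaces. $\hat\Omega\subset\mathbb{R}^d$ is a box with a tensor-product mesh $\hat{\mathcal{T}}_h$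 given by unique knots $\zeta_{i,1}<\dots<\zeta_{i,n_i}$ in each direction $i$. The physical domain is $\Omega=\mathcal{F}(\hat\Omega)$ for an invertible parametrization $\mathcal{F}$, as smooth as needed for the expressions below to be defined; $\mathcal{T}_h=\{\mathcal{F}(\hat K):\hat K\in\hat{\mathcal{T}}_h\}$ is quasi-uniform with mesh size $h$ (there is $C>0$ with $Ch\le \mathrm{diam}(K)\le h/C$ for all $K\in\mathcal{T}_h$), and $\|\cdot\|^2_{\mathbf{L}^2(\mathcal{T}_h)}=\sum_{K\in\mathcal{T}_h}\|\cdot\|^2_{\mathbf{L}^2(K)}$. $\mathcal{B}^{k_1,\dots,k_d}_{\boldsymbol{\alpha}_1,\dots,\boldsymbol{\alpha}_d}$ is the tensor product of the univariate spline spaces of piecewise polynomials of degree $k_i$ on the mesh $\{\zeta_{i,j}\}_j$ having $\alpha_{i,j}$ continuous derivatives at each interior knot $\zeta_{i,j}$, with $\boldsymbol{\alpha}_i=[-1,\alpha_{i,2},\dots,\alpha_{i,n_i-1},-1]$; $\boldsymbol{\alpha}_i-1$ denotes $[-1,\alpha_{i,2}-1,\dots,\alpha_{i,n_i-1}-1,-1]$. Fix integers $k'\ge1$ and $\alpha'\ge0$ and take $k_i=k'+1$ for all $i$ and $\alpha_{i,j}=\alpha'+1$ at all interior knots. With $\iota(\boldsymbol{v})=\det(D\mathcal{F})(D\mathcal{F})^{-1}(\boldsymbol{v}\circ\mathcal{F})$, the divergence-conforming B-spline velocity space $\boldsymbol{\mathcal{V}}_h$ is the set of $\boldsymbol{v}\in\mathbf{H}^1_{\boldsymbol{n}}(\Omega)$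 with $\iota(\boldsymbol{v})\in\mathcal{B}^{k_1,k_2-1,k_3-1}_{\boldsymbol{\alpha}_1,\boldsymbol{\alpha}_2-1,\boldsymbol{\alpha}_3-1}\times\mathcal{B}^{k_1-1,k_2,k_3-1}_{\boldsymbol{\alpha}_1-1,\boldsymbol{\alpha}_2,\boldsymbol{\alpha}_3-1}\times\mathcal{B}^{k_1-1,k_2-1,k_3}_{\boldsymbol{\alpha}_1-1,\boldsymbol{\alpha}_2-1,\boldsymbol{\alpha}_3}$ if $d=3$, and $\iota(\boldsymbol{v})\in\mathcal{B}^{k_1,k_2-1}_{\boldsymbol{\alpha}_1,\boldsymbol{\alpha}_2-1}\times\mathcal{B}^{k_1-1,k_2}_{\boldsymbol{\alpha}_1-1,\boldsymbol{\alpha}_2}$ if $d=2$. $\mathring{\boldsymbol{\mathcal{V}}}_h=\{\boldsymbol{v}_h\in\boldsymbol{\mathcal{V}}_h:\nabla\cdot\boldsymbol{v}_h=0\text{ in }\Omega\}$. Facets and jumps. $\mathcal{E}_0$ is the set of interior facets ($(d-1)$-dimensional intersections $e=\partial K_1\cap\partial K_2$ of distinct elements), with unit normal $\boldsymbol{n}$ pointing out of $K_1$; $[\![\phi]\!]=\phi^+-\phi^-$ is the difference of the limits of $\phi$ on $e$ from $K_1$ and $K_2$. On $\partial\Omega$, $\boldsymbol{n}$ is the outward unit normal. $\partial_{\boldsymbol{n}}=\boldsymbol{n}\cdot\nabla$ and $\partial_{\boldsymbol{n}}^{\alpha'+1}$ is its $(\alpha'+1)$-fold iterate. Forms (homogeneous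 Dirichlet data $\boldsymbol{u}_D=\boldsymbol{0}$). With viscosity $\nu>0$, a dimensionless Nitsche constant $C_{\mathrm{Nit}}>0$ and a dimensionless parameter $\gamma\ge0$, $$J_h(\boldsymbol{u},\boldsymbol{v})=\sum_{e\in\mathcal{E}_0}\big(\eta\,[\![\partial_{\boldsymbol{n}}^{\alpha'+1}\boldsymbol{u}]\!],[\![\partial_{\boldsymbol{n}}^{\alpha'+1}\boldsymbol{v}]\!]\big)_e,\qquad \eta=\gamma\min\{|\boldsymbol{u}|h/\nu,\,1\}\,h^{2\alpha'+2}\,|\boldsymbol{u}\cdot\boldsymbol{n}|$$ ($\eta$ is evaluated with the first argument of $J_h$), $$A_h(\boldsymbol{u},\boldsymbol{v})=(2\nu\nabla^s\boldsymbol{u},\nabla^s\boldsymbol{v})-(2\nu\boldsymbol{n}\cdot\nabla^s\boldsymbol{u},\boldsymbol{v})_{\partial\Omega}-(2\nu\boldsymbol{n}\cdot\nabla^s\boldsymbol{v},\boldsymbol{u})_{\partial\Omega}+\Big(2\nu\tfrac{C_{\mathrm{Nit}}}{h}\boldsymbol{u},\boldsymbol{v}\Big)_{\partial\Omega}+J_h(\boldsymbol{u},\boldsymbol{v}),$$ $$C(\boldsymbol{w};\boldsymbol{u},\boldsymbol{v})=-(\boldsymbol{w}\otimes\boldsymbol{u},\nabla\boldsymbol{v}),\qquad \mathscr{A}_{\mathrm{stb}}(\boldsymbol{u},\boldsymbol{v})=A_h(\boldsymbol{u},\boldsymbol{v})+C(\boldsymbol{u};\boldsymbol{u},\boldsymbol{v}),\qquad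 L_h(\boldsymbol{v})=(\boldsymbol{f},\boldsymbol{v}).$$ Semidiscrete problem $(\mathring{\mathcal{W}}_h)$: find $\boldsymbol{u}_h$ (a time-differentiable function of $t$ with values in $\mathring{\boldsymbol{\mathcal{V}}}_h$) such that, for all $\boldsymbol{v}_h\in\mathring{\boldsymbol{\mathcal{V}}}_h$ and all times, $\big(\tfrac{\partial\boldsymbol{u}_h}{\partial t},\boldsymbol{v}_h\big)+\mathscr{A}_{\mathrm{stb}}(\boldsymbol{u}_h,\boldsymbol{v}_h)=L_h(\boldsymbol{v}_h)$. "$C_{\mathrm{Nit}}$ sufficiently large" means: there is a threshold $C_0>0$ such that the assertion holds whenever $C_{\mathrm{Nit}}\ge C_0$. *)

theory Defs
  imports "HOL-Analysis.Analysis" "HOL-Computational_Algebra.Polynomial"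
begin

text \<open>\<open>(grad a x) $ i $ j\<close> is the derivative of component \<open>j\<close> in direction \<open>i\<close>, i.e. the transpose of
  the Jacobian matrix. The classical gradient is used throughout: the discrete fields below are
  continuous and smooth on each mesh element, so it is defined off a null set and agrees almost
  everywhere with the weak gradient.\<close>

definition jacobian :: "(real^'n \<Rightarrow> real^'n) \<Rightarrow> real^'n \<Rightarrow> real^'n^'n" where
  "jacobian a x = matrix (frechet_derivative a (at x))"

definition grad :: "(real^'n \<Rightarrow> real^'n) \<Rightarrow> real^'n \<Rightarrow> real^'n^'n" where
  "grad a x = transpose (jacobian a x)"

definition sym_grad :: "(real^'n \<Rightarrow> real^'n) \<Rightarrow> real^'n \<Rightarrow> real^'n^'n" where
  "sym_grad a x = (1/2) *\<^sub>R (grad a x + transpose (grad a x))"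

definition divg :: "(real^'n \<Rightarrow> real^'n) \<Rightarrow> real^'n \<Rightarrow> real" where
  "divg a x = trace (grad a x)"

definition tensor_prod :: "real^'n \<Rightarrow> real^'n \<Rightarrow> real^'n^'n" where
  "tensor_prod a b = (\<chi> i j. a $ i * b $ j)"

definition dir_deriv ::
  "'a::real_normed_vector \<Rightarrow> ('a \<Rightarrow> 'b::real_normed_vector) \<Rightarrow> 'a \<Rightarrow> 'b" where
  "dir_deriv n \<phi> x = frechet_derivative \<phi> (at x) n"

primrec Ck_on :: "nat \<Rightarrow> (real^'n) set \<Rightarrow> (real^'n \<Rightarrow> 'b::real_normed_vector) \<Rightarrow> bool" where
  "Ck_on 0 U \<phi> \<longleftrightarrow> continuous_on U \<phi>"
| "Ck_on (Suc k) U \<phi> \<longleftrightarrow>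
     (\<forall>x\<in>U. \<phi> differentiable (at x)) \<and> (\<forall>i. Ck_on k U (dir_deriv (axis i 1) \<phi>))"

definition smooth :: "(real^'n \<Rightarrow> 'b::real_normed_vector) \<Rightarrow> bool" where
  "smooth \<phi> \<longleftrightarrow> (\<forall>k. Ck_on k UNIV \<phi>)"

definition test_function :: "(real^'n) set \<Rightarrow> (real^'n \<Rightarrow> real) \<Rightarrow> bool" where
  "test_function \<Omega> \<phi> \<longleftrightarrow>
     smooth \<phi> \<and> compact (closure {x. \<phi> x \<noteq> 0}) \<and> closure {x. \<phi> x \<noteq> 0} \<subseteq> \<Omega>"

definition square_integrable :: "'a measure \<Rightarrow> ('a \<Rightarrow> 'b::euclidean_space) \<Rightarrow> bool" where
  "square_integrable M \<phi> \<longleftrightarrow>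
     \<phi> \<in> borel_measurable M \<and> integrable M (\<lambda>x. (norm (\<phi> x))\<^sup>2)"

definition L2_inner ::
  "(real^'n) set \<Rightarrow> (real^'n \<Rightarrow> 'b::euclidean_space) \<Rightarrow> (real^'n \<Rightarrow> 'b) \<Rightarrow> real" where
  "L2_inner S \<phi> \<psi> = (\<integral>x. \<phi> x \<bullet> \<psi> x \<partial>lebesgue_on S)"

definition weak_gradient ::
  "(real^'n) set \<Rightarrow> (real^'n \<Rightarrow> real^'n) \<Rightarrow> (real^'n \<Rightarrow> real^'n^'n) \<Rightarrow> bool" where
  "weak_gradient \<Omega> u G \<longleftrightarrow>
     (\<forall>\<phi> i j. test_function \<Omega> \<phi> \<longrightarrow>
        (\<integral>x. u x $ j * dir_deriv (axis i 1) \<phi> x \<partial>lebesgue_on \<Omega>)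
        = - (\<integral>x. G x $ i $ j * \<phi> x \<partial>lebesgue_on \<Omega>))"

definition H1 :: "(real^'n) set \<Rightarrow> (real^'n \<Rightarrow> real^'n) set" where
  "H1 \<Omega> = {u. square_integrable (lebesgue_on \<Omega>) u \<and>
             (\<exists>G. square_integrable (lebesgue_on \<Omega>) G \<and> weak_gradient \<Omega> u G)}"

text \<open>In direction \<open>i\<close> the unique knots are \<open>knot D i j\<close> for \<open>1 \<le> j \<le> nknots D i\<close>.\<close>

record ('n::finite) iga =
  knot :: "'n \<Rightarrow> nat \<Rightarrow> real"
  nknots :: "'n \<Rightarrow> nat"
  param :: "real^'n \<Rightarrow> real^'n"
  meshsize :: real

definition lower :: "('n::finite) iga \<Rightarrow> real^'n" where
  "lower D = (\<chi> i. knot D i 1)"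

definition upper :: "('n::finite) iga \<Rightarrow> real^'n" where
  "upper D = (\<chi> i. knot D i (nknots D i))"

definition Omega :: "('n::finite) iga \<Rightarrow> (real^'n) set" where
  "Omega D = param D ` box (lower D) (upper D)"

definition cells :: "('n::finite) iga \<Rightarrow> ('n \<Rightarrow> nat) set" where
  "cells D = {m. \<forall>i. 1 \<le> m i \<and> m i < nknots D i}"

definition cell_lower :: "('n::finite) iga \<Rightarrow> ('n \<Rightarrow> nat) \<Rightarrow> real^'n" where
  "cell_lower D m = (\<chi> i. knot D i (m i))"

definition cell_upper :: "('n::finite) iga \<Rightarrow> ('n \<Rightarrow> nat) \<Rightarrow> real^'n" where
  "cell_upper D m = (\<chi> i. knot D i (m i + 1))"

definition element :: "('n::finite) iga \<Rightarrow> ('n \<Rightarrow> nat) \<Rightarrow> (real^'n) set" where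
  "element D m = param D ` box (cell_lower D m) (cell_upper D m)"

definition mesh :: "('n::finite) iga \<Rightarrow> (real^'n) set set" where
  "mesh D = element D ` cells D"

definition quasi_uniform :: "('n::finite) iga \<Rightarrow> bool" where
  "quasi_uniform D \<longleftrightarrow>
     (\<exists>C>0. \<forall>K\<in>mesh D. C * meshsize D \<le> diameter K \<and> diameter K \<le> meshsize D / C)"

text \<open>Regularity \<open>q + 2\<close> of the parametrisation is what makes the element-wise derivatives of
  order \<open>q + 1\<close> of a Piola-transformed spline continuous up to the facets.\<close>

definition admissible :: "nat \<Rightarrow> ('n::finite) iga \<Rightarrow> bool" where
  "admissible q D \<longleftrightarrow>
     (\<forall>i. 2 \<le> nknots D i) \<and>
     (\<forall>i. \<forall>j\<in>{1..<nknots D i}. knot D i j < knot D i (j + 1)) \<and>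
     (\<exists>U. open U \<and> cbox (lower D) (upper D) \<subseteq> U \<and> Ck_on (q + 2) U (param D)) \<and>
     inj_on (param D) (cbox (lower D) (upper D)) \<and>
     (\<forall>x\<in>cbox (lower D) (upper D). det (jacobian (param D) x) \<noteq> 0) \<and>
     0 < meshsize D \<and> quasi_uniform D"

text \<open>The \<open>(d-1)\<close>-dimensional Lebesgue measure on the hyperplane \<open>x $ i = c\<close>. It is completed because
  the traces integrated below are only determined almost everywhere.\<close>

definition hyperplane_measure :: "'n::finite \<Rightarrow> real \<Rightarrow> (real^'n) measure" where
  "hyperplane_measure i c =
     completion (distr (PiM (UNIV - {i}) (\<lambda>_. lborel)) borel
       (\<lambda>y. \<chi> j. if j = i then c else y j))"

text \<open>Square root of the Gram determinant of the tangent vectors of \<open>F\<close> in the directions other than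
  \<open>i\<close>. Row and column \<open>i\<close> are those of the unit matrix, so that the determinant is the one of the
  remaining \<open>(d-1) \<times> (d-1)\<close> block.\<close>

definition area_element :: "(real^'n \<Rightarrow> real^'n) \<Rightarrow> 'n \<Rightarrow> real^'n \<Rightarrow> real" where
  "area_element F i x =
     sqrt (det (\<chi> j k. if j = i \<or> k = i then (if j = k then 1 else 0)
                       else column j (jacobian F x) \<bullet> column k (jacobian F x)))"

text \<open>Surface measure of \<open>param D ` Q\<close>, pulled back to the flat piece \<open>Q\<close> of the hyperplane
  \<open>x $ i = c\<close> in the parametric domain.\<close>

definition facet_measure :: "('n::finite) iga \<Rightarrow> 'n \<Rightarrow> real \<Rightarrow> (real^'n) set \<Rightarrow> (real^'n) measure" where
  "facet_measure D i c Q =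
     density (restrict_space (hyperplane_measure i c) Q)
             (\<lambda>x. ennreal (area_element (param D) i x))"

text \<open>Unit normal at \<open>param D x\<close> of the image of the hyperplane through \<open>x\<close> orthogonal to axis \<open>i\<close>:
  normals transform with the inverse transposed Jacobian. It points to the side of increasing
  parametric coordinate \<open>i\<close>, whatever the sign of the Jacobian determinant.\<close>

definition normal :: "('n::finite) iga \<Rightarrow> 'n \<Rightarrow> real^'n \<Rightarrow> real^'n" where
  "normal D i x = sgn (transpose (matrix_inv (jacobian (param D) x)) *v axis i 1)"

text \<open>The boundary of \<open>Omega D\<close> is the union of the images of the \<open>2 d\<close> faces of the parametric box;
  a face is given by its direction and side (\<open>True\<close>: upper end). Integrands depend on the point and
  on the outward unit normal.\<close>

definition face_coord :: "('n::finite) iga \<Rightarrow> 'n \<Rightarrow> bool \<Rightarrow> real" where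
  "face_coord D i s = (if s then upper D $ i else lower D $ i)"

definition face_measure :: "('n::finite) iga \<Rightarrow> 'n \<Rightarrow> bool \<Rightarrow> (real^'n) measure" where
  "face_measure D i s =
     facet_measure D i (face_coord D i s)
       {x \<in> cbox (lower D) (upper D). x $ i = face_coord D i s}"

definition outward_normal :: "('n::finite) iga \<Rightarrow> 'n \<Rightarrow> bool \<Rightarrow> real^'n \<Rightarrow> real^'n" where
  "outward_normal D i s x = (if s then normal D i x else - normal D i x)"

definition boundary_integral ::
  "('n::finite) iga \<Rightarrow> (real^'n \<Rightarrow> real^'n \<Rightarrow> real) \<Rightarrow> real" where
  "boundary_integral D g =
     (\<Sum>i\<in>UNIV. \<Sum>s\<in>UNIV. \<integral>x. g (param D x) (outward_normal D i s x) \<partial>face_measure D i s)"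

text \<open>The Sobolev trace: continuous extension of the restriction map from functions that are smooth
  up to the boundary.\<close>

definition has_trace ::
  "('n::finite) iga \<Rightarrow> (real^'n \<Rightarrow> real^'n) \<Rightarrow> (real^'n \<Rightarrow> real^'n) \<Rightarrow> bool" where
  "has_trace D u g \<longleftrightarrow>
     square_integrable (lebesgue_on (Omega D)) u \<and>
     (\<forall>i s. square_integrable (face_measure D i s) (\<lambda>x. g (param D x))) \<and>
     (\<exists>G w. square_integrable (lebesgue_on (Omega D)) G \<and> weak_gradient (Omega D) u G \<and>
        (\<forall>l::nat. smooth (w l)) \<and>
        (\<lambda>l. \<integral>x. (norm (w l x - u x))\<^sup>2 \<partial>lebesgue_on (Omega D)) \<longlonglongrightarrow> 0 \<and>
        (\<lambda>l. \<integral>x. (norm (grad (w l) x - G x))\<^sup>2 \<partial>lebesgue_on (Omega D)) \<longlonglongrightarrow> 0 \<and>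
        (\<lambda>l. boundary_integral D (\<lambda>x _. (norm (w l x - g x))\<^sup>2)) \<longlonglongrightarrow> 0)"

definition H1n :: "('n::finite) iga \<Rightarrow> (real^'n \<Rightarrow> real^'n) set" where
  "H1n D = {u \<in> H1 (Omega D).
     \<exists>g. has_trace D u g \<and>
       (\<forall>i s. AE x in face_measure D i s. g (param D x) \<bullet> outward_normal D i s x = 0)}"

text \<open>For fields that are continuous up to almost every point of a facet, the trace from a given side
  is the one-sided limit.\<close>

definition limit_from ::
  "'a::topological_space set \<Rightarrow> ('a \<Rightarrow> 'b::t2_space) \<Rightarrow> 'a \<Rightarrow> 'b" where
  "limit_from K \<phi> x = Lim (at x within K) \<phi>"

definition jump ::
  "'a::topological_space set \<Rightarrow> 'a set \<Rightarrow> ('a \<Rightarrow> 'b::real_normed_vector) \<Rightarrow> 'a \<Rightarrow> 'b" where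
  "jump K1 K2 \<phi> x = limit_from K1 \<phi> x - limit_from K2 \<phi> x"

text \<open>Only interior knots carry a continuity condition (regularity \<open>-1\<close> at the end knots means none).
  The pieces are taken right-continuous, which fixes a representative when \<open>\<alpha> j = -1\<close>.\<close>

definition spline_space ::
  "(nat \<Rightarrow> real) \<Rightarrow> nat \<Rightarrow> nat \<Rightarrow> (nat \<Rightarrow> int) \<Rightarrow> (real \<Rightarrow> real) set" where
  "spline_space \<zeta> N k \<alpha> =
     {s. \<exists>p :: nat \<Rightarrow> real poly.
        (\<forall>j\<in>{1..<N}. degree (p j) \<le> k \<and> (\<forall>x\<in>{\<zeta> j..<\<zeta> (j + 1)}. s x = poly (p j) x)) \<and>
        (\<forall>j\<in>{2..<N}. \<forall>m. int m \<le> \<alpha> j \<longrightarrow>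
           poly ((pderiv ^^ m) (p (j - 1))) (\<zeta> j) = poly ((pderiv ^^ m) (p j)) (\<zeta> j))}"

text \<open>The linear span of the products of univariate splines, compared on the open parametric box only
  (scalar factors are absorbed in the univariate splines).\<close>

definition tensor_spline_space ::
  "('n::finite) iga \<Rightarrow> ('n \<Rightarrow> nat) \<Rightarrow> ('n \<Rightarrow> nat \<Rightarrow> int) \<Rightarrow> (real^'n \<Rightarrow> real) set" where
  "tensor_spline_space D k \<alpha> =
     {g. \<exists>L s. (\<forall>l<(L::nat). \<forall>i. s l i \<in> spline_space (knot D i) (nknots D i) (k i) (\<alpha> i)) \<and>
        (\<forall>x\<in>box (lower D) (upper D). g x = (\<Sum>l<L. \<Prod>i\<in>UNIV. s l i (x $ i)))}"

definition piola :: "('n::finite) iga \<Rightarrow> (real^'n \<Rightarrow> real^'n) \<Rightarrow> real^'n \<Rightarrow> real^'n" where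
  "piola D v x =
     det (jacobian (param D) x) *\<^sub>R (matrix_inv (jacobian (param D) x) *v v (param D x))"

text \<open>With \<open>k + 1\<close> and \<open>q + 1\<close> the underlying degree and regularity, component \<open>j\<close> of the pulled back
  velocity has these in direction \<open>j\<close> and \<open>k\<close>, \<open>q\<close> in the other directions.\<close>

definition velocity_space :: "('n::finite) iga \<Rightarrow> nat \<Rightarrow> nat \<Rightarrow> (real^'n \<Rightarrow> real^'n) set" where
  "velocity_space D k q =
     {v \<in> H1n D. \<forall>j. (\<lambda>x. piola D v x $ j) \<in>
        tensor_spline_space D (\<lambda>i. if i = j then k + 1 else k)
                              (\<lambda>i _. if i = j then int q + 1 else int q)}"

definition div_free_space :: "('n::finite) iga \<Rightarrow> nat \<Rightarrow> nat \<Rightarrow> (real^'n \<Rightarrow> real^'n) set" where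
  "div_free_space D k q =
     {v \<in> velocity_space D k q. AE x in lebesgue_on (Omega D). divg v x = 0}"

text \<open>The pair \<open>(i, m)\<close> stands for the facet orthogonal (in the parametric domain) to axis \<open>i\<close> that is
  shared by the element below, with index \<open>m i - 1\<close> in direction \<open>i\<close>, and the element \<open>m\<close>. In a
  tensor-product mesh every interior facet arises exactly once in this way, and \<open>normal D i\<close>
  points out of the first of the two elements.\<close>

definition interior_facets :: "('n::finite) iga \<Rightarrow> ('n \<times> ('n \<Rightarrow> nat)) set" where
  "interior_facets D = {(i, m). m \<in> cells D \<and> 2 \<le> m i}"

definition interior_facet_measure ::
  "('n::finite) iga \<Rightarrow> 'n \<Rightarrow> ('n \<Rightarrow> nat) \<Rightarrow> (real^'n) measure" where
  "interior_facet_measure D i m =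
     facet_measure D i (knot D i (m i))
       {x \<in> cbox (cell_lower D m) (cell_upper D m). x $ i = knot D i (m i)}"

text \<open>At a point of a facet, the iterated normal derivative is the iterated directional derivative
  along the unit normal at that point.\<close>

definition normal_deriv_jump ::
  "('n::finite) iga \<Rightarrow> nat \<Rightarrow> 'n \<Rightarrow> ('n \<Rightarrow> nat) \<Rightarrow> (real^'n \<Rightarrow> real^'n) \<Rightarrow> real^'n \<Rightarrow> real^'n" where
  "normal_deriv_jump D r i m \<phi> x =
     jump (element D (m(i := m i - 1))) (element D m)
          ((dir_deriv (normal D i x) ^^ r) \<phi>) (param D x)"

definition stab_coeff ::
  "('n::finite) iga \<Rightarrow> nat \<Rightarrow> real \<Rightarrow> real \<Rightarrow> real^'n \<Rightarrow> real^'n \<Rightarrow> real" where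
  "stab_coeff D q \<nu> \<gamma> a n =
     \<gamma> * min (norm a * meshsize D / \<nu>) 1 * meshsize D ^ (2 * q + 2) * \<bar>a \<bullet> n\<bar>"

definition J_form :: "('n::finite) iga \<Rightarrow> nat \<Rightarrow> real \<Rightarrow> real \<Rightarrow>
    (real^'n \<Rightarrow> real^'n) \<Rightarrow> (real^'n \<Rightarrow> real^'n) \<Rightarrow> real" where
  "J_form D q \<nu> \<gamma> u v =
     (\<Sum>(i, m)\<in>interior_facets D.
        \<integral>x. stab_coeff D q \<nu> \<gamma> (u (param D x)) (normal D i x) *
            (normal_deriv_jump D (q + 1) i m u x \<bullet> normal_deriv_jump D (q + 1) i m v x)
          \<partial>interior_facet_measure D i m)"

definition A_form :: "('n::finite) iga \<Rightarrow> nat \<Rightarrow> real \<Rightarrow> real \<Rightarrow> real \<Rightarrow>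
    (real^'n \<Rightarrow> real^'n) \<Rightarrow> (real^'n \<Rightarrow> real^'n) \<Rightarrow> real" where
  "A_form D q \<nu> CNit \<gamma> u v =
     L2_inner (Omega D) (\<lambda>x. (2 * \<nu>) *\<^sub>R sym_grad u x) (sym_grad v)
     - boundary_integral D (\<lambda>x n. ((2 * \<nu>) *\<^sub>R (n v* limit_from (Omega D) (sym_grad u) x))
                                  \<bullet> limit_from (Omega D) v x)
     - boundary_integral D (\<lambda>x n. ((2 * \<nu>) *\<^sub>R (n v* limit_from (Omega D) (sym_grad v) x))
                                  \<bullet> limit_from (Omega D) u x)
     + boundary_integral D (\<lambda>x n. ((2 * \<nu> * (CNit / meshsize D)) *\<^sub>R limit_from (Omega D) u x)
                                  \<bullet> limit_from (Omega D) v x)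
     + J_form D q \<nu> \<gamma> u v"

definition C_form :: "('n::finite) iga \<Rightarrow>
    (real^'n \<Rightarrow> real^'n) \<Rightarrow> (real^'n \<Rightarrow> real^'n) \<Rightarrow> (real^'n \<Rightarrow> real^'n) \<Rightarrow> real" where
  "C_form D w u v = - L2_inner (Omega D) (\<lambda>x. tensor_prod (w x) (u x)) (grad v)"

definition A_stb :: "('n::finite) iga \<Rightarrow> nat \<Rightarrow> real \<Rightarrow> real \<Rightarrow> real \<Rightarrow>
    (real^'n \<Rightarrow> real^'n) \<Rightarrow> (real^'n \<Rightarrow> real^'n) \<Rightarrow> real" where
  "A_stb D q \<nu> CNit \<gamma> u v = A_form D q \<nu> CNit \<gamma> u v + C_form D u u v"

definition mesh_L2_norm_sq :: "('n::finite) iga \<Rightarrow> (real^'n \<Rightarrow> real^'n) \<Rightarrow> real" where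
  "mesh_L2_norm_sq D u = (\<Sum>K\<in>mesh D. L2_inner K u u)"

definition time_deriv :: "real \<Rightarrow> (real \<Rightarrow> real^'n \<Rightarrow> real^'n) \<Rightarrow> real \<Rightarrow> real^'n \<Rightarrow> real^'n" where
  "time_deriv T u t x = vector_derivative (\<lambda>s. u s x) (at t within {0<..T})"

text \<open>The spline space is finite dimensional, so differentiability in time can be stated pointwise in
  space: all notions of differentiability of a curve in the space coincide.\<close>

definition semidiscrete_solution ::
  "('n::finite) iga \<Rightarrow> nat \<Rightarrow> nat \<Rightarrow> real \<Rightarrow> real \<Rightarrow> real \<Rightarrow> real \<Rightarrow>
   (real \<Rightarrow> real^'n \<Rightarrow> real^'n) \<Rightarrow> (real \<Rightarrow> real^'n \<Rightarrow> real^'n) \<Rightarrow> bool" where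
  "semidiscrete_solution D k q \<nu> CNit \<gamma> T f u \<longleftrightarrow>
     (\<forall>t\<in>{0<..T}. u t \<in> div_free_space D k q \<and>
        (\<forall>x\<in>Omega D. (\<lambda>s. u s x) differentiable (at t within {0<..T})) \<and>
        (\<forall>v\<in>div_free_space D k q.
           L2_inner (Omega D) (time_deriv T u t) v + A_stb D q \<nu> CNit \<gamma> (u t) v
           = L2_inner (Omega D) (f t) v))"

end

theory Submission
  imports Defs
begin

text \<open>
  Testing the semidiscrete problem with the solution itself gives the identity, once the time
  derivative of the energy is recognised as the \<open>L2\<close> product of the velocity with its time derivative.
  The inequality then says that the stabilised form is nonnegative on the diagonal, and this has three
  parts. The jump penalty has a nonnegative integrand. The convective form vanishes. The viscous form
  with its Nitsche terms is coercive for a large enough penalty.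

  Everything is computed on the parametric box. There a discrete velocity is \<open>push U\<close>, the inverse Piola
  transform of a continuous piecewise polynomial field \<open>U\<close> (lemma \<open>velocity_field\<close>), so fields are
  continuously differentiable on each cell up to its boundary, and the only analysis across facets is the fundamental theorem of
  calculus along coordinate lines (\<open>integral_partial_derivative\<close>), which needs continuity but not
  differentiability at the finitely many knots.

  Convection: the Piola identity (\<open>divergence_push\<close>) makes \<open>U\<close> divergence free, so the integrand is the
  divergence of \<open>\<psi> U\<close> with \<open>\<psi>\<close> half the squared speed, and integration along lines leaves boundary values
  of \<open>U $ i\<close> on the faces orthogonal to axis \<open>i\<close>. The boundary condition is given only through
  Sobolev traces, that is, through smooth approximations; a trace inequality shows that the trace is the
  boundary value of the continuous representative, hence that these components vanish
  (\<open>normal_component_zero\<close>, \<open>convective_form_zero\<close>).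

  Coercivity: the consistency terms involve the strain on the boundary. On one cell the strains of
  discrete velocities form a finite-dimensional space of continuous fields, on which the maximum is
  bounded by the mean square (\<open>sup_norm_le_L2_norm\<close>, \<open>strain_bound\<close>). Young's inequality then splits the
  consistency terms between the dissipation and the penalty (\<open>A_form_nonneg\<close>). The threshold depends on the
  mesh and the degrees only.

  Time derivative: the solution is assumed to be differentiable in time pointwise in space. Finitely many point
  values determine a discrete velocity linearly (\<open>velocity_nodal_basis\<close>), so the energy is a quadratic
  polynomial in differentiable functions of time (\<open>energy_derivative\<close>). Both finite-dimensional
  arguments rest on the same fact about separating functionals (\<open>finite_dual_functionals\<close>).
\<close>

section \<open>Finitely many functionals determine a finite-dimensional space\<close>

text \<open>Linear functionals on coefficient vectors are represented by their values \<open>L q i\<close> on the unit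
  vectors. A member of the space is recovered, as far as all functionals in \<open>\<Lambda>\<close> can tell, from its
  values under finitely many of them, with dual vectors \<open>d k\<close> as fixed coefficients. When one more unit
  vector is admitted, either its residual is invisible to all functionals and nothing changes, or
  some functional sees it; that functional is added and the residual, normalised, is its dual vector.\<close>

lemma finite_dual_functionals:
  fixes L :: "'l \<Rightarrow> 'i \<Rightarrow> real"
  assumes "finite I"
  shows "\<exists>(M::nat) l d. (\<forall>k<M. l k \<in> \<Lambda>) \<and>
     (\<forall>q\<in>\<Lambda>. \<forall>a. (\<Sum>i\<in>I. a i * L q i) =
        (\<Sum>k<M. (\<Sum>i\<in>I. a i * L (l k) i) * (\<Sum>i\<in>I. d k i * L q i)))"
  using assms
proof (induction I rule: finite_induct)
  case empty
  show ?case by (rule exI[of _ 0]) auto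
next
  case (insert i0 I)
  obtain M :: nat and l d where l: "\<And>k. k < M \<Longrightarrow> l k \<in> \<Lambda>" and
    rep: "\<And>q a. q \<in> \<Lambda> \<Longrightarrow> (\<Sum>i\<in>I. a i * L q i) =
        (\<Sum>k<M. (\<Sum>i\<in>I. a i * L (l k) i) * (\<Sum>i\<in>I. d k i * L q i))"
    using insert.IH by blast
  define D where "D k q = (\<Sum>i\<in>I. d k i * L q i)" for k q
  define r where "r q = L q i0 - (\<Sum>k<M. L (l k) i0 * D k q)" for q
  define d0 where "d0 k = (\<lambda>i. if i = i0 then 0 else d k i)" for k
  have ins: "(\<Sum>i\<in>insert i0 I. a i * L q i) = a i0 * L q i0 + (\<Sum>i\<in>I. a i * L q i)" for a q
    using insert.hyps by simp
  have d0: "(\<Sum>i\<in>insert i0 I. d0 k i * L q i) = D k q" for k q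
  proof -
    have "(\<Sum>i\<in>I. d0 k i * L q i) = D k q"
      unfolding D_def d0_def using insert.hyps by (intro sum.cong) auto
    then show ?thesis unfolding ins by (simp add: d0_def)
  qed
  have key: "(\<Sum>i\<in>insert i0 I. a i * L q i) =
      (\<Sum>k<M. (\<Sum>i\<in>insert i0 I. a i * L (l k) i) * D k q) + a i0 * r q"
    if "q \<in> \<Lambda>" for a q
    unfolding ins r_def rep[OF that, of a, folded D_def]
    by (simp add: algebra_simps sum.distrib sum_distrib_left)
  show ?case
  proof (cases "\<forall>q\<in>\<Lambda>. r q = 0")
    case True
    then show ?thesis
      using key l by (intro exI[of _ M] exI[of _ l] exI[of _ d0]) (simp only: d0, simp)
  next
    case False
    then obtain m where m: "m \<in> \<Lambda>" "r m \<noteq> 0" by blast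
    \<comment> \<open>the residual of the new unit vector, normalised by the functional \<open>m\<close> that sees it\<close>
    define \<rho> where "\<rho> i = ((if i = i0 then 1 else 0) - (\<Sum>k<M. L (l k) i0 * d0 k i)) / r m" for i
    have rho: "(\<Sum>i\<in>insert i0 I. \<rho> i * L q i) = r q / r m" for q
    proof -
      have "(\<Sum>i\<in>insert i0 I. \<rho> i * L q i) =
        ((\<Sum>i\<in>insert i0 I. (if i = i0 then 1 else 0) * L q i)
          - (\<Sum>i\<in>insert i0 I. \<Sum>k<M. L (l k) i0 * (d0 k i * L q i))) / r m"
        unfolding \<rho>_def sum_divide_distrib sum_subtractf[symmetric]
        by (intro sum.cong refl) (simp add: algebra_simps sum_distrib_left sum_distrib_right divide_simps)
      also have "(\<Sum>i\<in>insert i0 I. \<Sum>k<M. L (l k) i0 * (d0 k i * L q i)) =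
          (\<Sum>k<M. L (l k) i0 * D k q)"
        by (subst sum.swap) (simp only: sum_distrib_left[symmetric] d0)
      also have "(\<Sum>i\<in>insert i0 I. (if i = i0 then 1 else 0) * L q i) = L q i0"
        using insert.hyps by (subst sum.mono_neutral_right[of _ "{i0}"]) auto
      finally show ?thesis unfolding r_def .
    qed
    define d' where "d' k = (if k < M then (\<lambda>i. d0 k i - D k m * \<rho> i) else \<rho>)" for k
    define l' where "l' k = (if k < M then l k else m)" for k
    have d': "(\<Sum>i\<in>insert i0 I. d' k i * L q i) =
        (if k < M then D k q - D k m * (r q / r m) else r q / r m)" for k q
    proof (cases "k < M")
      case True
      have "(\<Sum>i\<in>insert i0 I. d' k i * L q i) = (\<Sum>i\<in>insert i0 I. d0 k i * L q i)
         - D k m * (\<Sum>i\<in>insert i0 I. \<rho> i * L q i)"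
        unfolding sum_distrib_left sum_subtractf[symmetric] d'_def using True
        by (intro sum.cong) (auto simp: algebra_simps)
      then show ?thesis using True by (simp only: rho d0 if_True)
    next
      case False
      then show ?thesis by (simp only: d'_def rho if_False)
    qed
    have "(\<Sum>i\<in>insert i0 I. a i * L q i) =
        (\<Sum>k<Suc M. (\<Sum>i\<in>insert i0 I. a i * L (l' k) i) * (\<Sum>i\<in>insert i0 I. d' k i * L q i))"
      if q: "q \<in> \<Lambda>" for a q
    proof -
      define A where "A q = (\<Sum>i\<in>insert i0 I. a i * L q i)" for q
      have km: "A m = (\<Sum>k<M. A (l k) * D k m) + a i0 * r m"
        unfolding A_def by (rule key[OF m(1)])
      have kl: "A q = (\<Sum>k<M. A (l k) * D k q) + a i0 * r q"
        unfolding A_def by (rule key[OF q])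
      have "(\<Sum>k<Suc M. A (l' k) * (\<Sum>i\<in>insert i0 I. d' k i * L q i))
         = (\<Sum>k<M. A (l k) * (D k q - D k m * (r q / r m))) + A m * (r q / r m)"
        unfolding d' by (simp add: l'_def)
      also have "\<dots> = (\<Sum>k<M. A (l k) * D k q) + (A m - (\<Sum>k<M. A (l k) * D k m)) * (r q / r m)"
        by (simp add: algebra_simps sum_subtractf sum_distrib_left sum_distrib_right)
      also have "\<dots> = A q" unfolding kl km using m(2) by simp
      finally show ?thesis unfolding A_def by simp
    qed
    moreover have "\<forall>k<Suc M. l' k \<in> \<Lambda>" using l m(1) by (auto simp: l'_def)
    ultimately show ?thesis by blast
  qed
qed


section \<open>Slicing Lebesgue measure along a coordinate\<close>

definition slice_pt :: "'n::finite \<Rightarrow> ('n \<Rightarrow> real) \<Rightarrow> real \<Rightarrow> real^'n" where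
  "slice_pt i y t = (\<chi> j. if j = i then t else y j)"

abbreviation cross_section :: "'n::finite \<Rightarrow> ('n \<Rightarrow> real) measure" where
  "cross_section i \<equiv> PiM (UNIV - {i}) (\<lambda>_. lborel)"

interpretation lborel_family: product_sigma_finite "\<lambda>_::'n::finite. lborel :: real measure"
  by standard

lemma slice_pt_nth [simp]: "slice_pt i y t $ j = (if j = i then t else y j)"
  by (simp add: slice_pt_def)

lemma slice_in_box_iff:
  "slice_pt i y t \<in> box l u \<longleftrightarrow>
     (\<forall>j. j \<noteq> i \<longrightarrow> l $ j < y j \<and> y j < u $ j) \<and> l $ i < t \<and> t < u $ i"
  by (simp add: mem_box_cart) metis

lemma measurable_slice_pt_pair [measurable]:
  "(\<lambda>(y, t). slice_pt i y t) \<in> borel_measurable (cross_section i \<Otimes>\<^sub>M lborel)"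
proof -
  have "(\<lambda>p. slice_pt i (fst p) (snd p) $ j) \<in> borel_measurable (cross_section i \<Otimes>\<^sub>M lborel)" for j
    by (cases "j = i") auto
  then show ?thesis
    by (subst borel_measurable_euclidean_space)
       (auto simp: Basis_vec_def inner_axis case_prod_beta)
qed

lemma measurable_slice_pt [measurable]:
  "(\<lambda>y. slice_pt i y t) \<in> borel_measurable (cross_section i)"
proof -
  have "(\<lambda>y. slice_pt i y t $ j) \<in> borel_measurable (cross_section i)" for j
    by (cases "j = i") auto
  then show ?thesis
    by (subst borel_measurable_euclidean_space) (auto simp: Basis_vec_def inner_axis)
qed

text \<open>Both sides give every box the product of its edge lengths.\<close>

lemma lborel_eq_distr_slice:
  "(lborel :: (real^'n::finite) measure) =
     distr (cross_section i \<Otimes>\<^sub>M lborel) borel (\<lambda>(y, t). slice_pt i y t)"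
proof (rule lborel_eqI)
  fix l u :: "real^'n"
  assume lu: "\<And>b. b \<in> Basis \<Longrightarrow> l \<bullet> b \<le> u \<bullet> b"
  have lu': "l $ j \<le> u $ j" for j
    using lu[of "axis j 1"] by (auto simp: Basis_vec_def inner_axis)
  interpret P: sigma_finite_measure "cross_section i"
    by (rule lborel_family.sigma_finite) simp
  have "(\<lambda>(y, t). slice_pt i y t) -` box l u \<inter> space (cross_section i \<Otimes>\<^sub>M lborel)
      = (Pi\<^sub>E (UNIV - {i}) (\<lambda>j. {l $ j<..<u $ j})) \<times> {l $ i<..<u $ i}"
    unfolding space_pair_measure space_PiM
    by (intro set_eqI) (clarsimp simp: slice_in_box_iff PiE_iff, blast)
  then have "emeasure (distr (cross_section i \<Otimes>\<^sub>M lborel) borel (\<lambda>(y, t). slice_pt i y t)) (box l u)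
     = emeasure (cross_section i \<Otimes>\<^sub>M lborel)
          ((Pi\<^sub>E (UNIV - {i}) (\<lambda>j. {l $ j<..<u $ j})) \<times> {l $ i<..<u $ i})"
    by (subst emeasure_distr) auto
  also have "\<dots> = (\<Prod>j\<in>UNIV-{i}. ennreal (u $ j - l $ j)) * ennreal (u $ i - l $ i)"
    using lu' by (subst lborel.emeasure_pair_measure_Times)
      (auto simp: lborel_family.emeasure_PiM intro!: sets_PiM_I_finite)
  also have "\<dots> = (\<Prod>j\<in>UNIV. ennreal (u $ j - l $ j))"
    by (subst (2) prod.remove[of _ i]) (auto simp: mult.commute)
  also have "\<dots> = ennreal (\<Prod>j\<in>UNIV. (u $ j - l $ j))"
    using lu' by (subst prod_ennreal) auto
  also have "(\<Prod>j\<in>UNIV. (u $ j - l $ j)) = (\<Prod>b\<in>Basis. (u - l) \<bullet> b)"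
  proof -
    have B: "(Basis :: (real^'n) set) = range (\<lambda>j. axis j 1)" by (auto simp: Basis_vec_def)
    have "inj (\<lambda>j::'n. axis j (1::real))" by (auto simp: inj_def axis_eq_axis)
    from prod.reindex[OF this, of "\<lambda>b. (u - l) \<bullet> b"] show ?thesis
      unfolding B by (simp add: inner_axis)
  qed
  finally show "emeasure (distr (cross_section i \<Otimes>\<^sub>M lborel) borel (\<lambda>(y, t). slice_pt i y t)) (box l u)
     = ennreal (\<Prod>b\<in>Basis. (u - l) \<bullet> b)" .
qed simp

lemma integral_slice:
  fixes f :: "real^'n::finite \<Rightarrow> real"
  assumes f: "integrable lborel f"
  shows "integral\<^sup>L lborel f = (\<integral>y. (\<integral>t. f (slice_pt i y t) \<partial>lborel) \<partial>cross_section i)"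
proof -
  interpret P: sigma_finite_measure "cross_section i"
    by (rule lborel_family.sigma_finite) simp
  interpret pair_sigma_finite "cross_section i" lborel by standard
  note m = measurable_slice_pt_pair[of i]
  have fm: "f \<in> borel_measurable borel"
    using f by auto
  have "integrable (distr (cross_section i \<Otimes>\<^sub>M lborel) borel (\<lambda>(y, t). slice_pt i y t)) f"
    using f by (subst lborel_eq_distr_slice[symmetric])
  then have int: "integrable (cross_section i \<Otimes>\<^sub>M lborel) (\<lambda>p. f (case p of (y, t) \<Rightarrow> slice_pt i y t))"
    using m fm by (subst (asm) integrable_distr_eq) auto
  have "integral\<^sup>L lborel f = (\<integral>p. f (case p of (y, t) \<Rightarrow> slice_pt i y t) \<partial>(cross_section i \<Otimes>\<^sub>M lborel))"
    by (subst lborel_eq_distr_slice[of i], subst integral_distr) (use m fm in auto)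
  also have "\<dots> = (\<integral>y. (\<integral>t. f (slice_pt i y t) \<partial>lborel) \<partial>cross_section i)"
    using integral_fst'[OF int] by simp
  finally show ?thesis .
qed

lemma AE_cross_section_avoid:
  fixes Z :: "'n::finite \<Rightarrow> real set"
  assumes Z: "\<And>j. finite (Z j)"
  shows "AE y in cross_section i. \<forall>j. j \<noteq> i \<longrightarrow> y j \<notin> Z j"
proof -
  have "AE y in cross_section i. y j \<noteq> z" if j: "j \<noteq> i" for j z
  proof (rule AE_I)
    let ?N = "Pi\<^sub>E (UNIV - {i}) (\<lambda>k. if k = j then {z} else UNIV) :: ('n \<Rightarrow> real) set"
    show "{y \<in> space (cross_section i). \<not> y j \<noteq> z} \<subseteq> ?N"
      using j by (auto simp: space_PiM PiE_iff extensional_def split: if_splits)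
    show "?N \<in> sets (cross_section i)" by (intro sets_PiM_I_finite) auto
    have "emeasure (cross_section i) ?N
        = (\<Prod>k\<in>UNIV-{i}. emeasure lborel (if k = j then {z} else (UNIV::real set)))"
      by (intro lborel_family.emeasure_PiM) auto
    also have "\<dots> = 0"
      using j by (intro prod_zero) (auto intro!: bexI[of _ j])
    finally show "emeasure (cross_section i) ?N = 0" .
  qed
  then have "AE y in cross_section i. \<forall>j\<in>UNIV - {i}. \<forall>z\<in>Z j. y j \<noteq> z"
    using Z by (intro AE_finite_allI) auto
  then show ?thesis by eventually_elim auto
qed

text \<open>The face of the box \<open>cbox lo up\<close> orthogonal to axis \<open>i\<close>, in the coordinates of the cross section.\<close>

definition flat_face :: "real^'n::finite \<Rightarrow> real^'n \<Rightarrow> 'n \<Rightarrow> ('n \<Rightarrow> real) set" where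
  "flat_face lo up i = Pi\<^sub>E (UNIV - {i}) (\<lambda>j. {lo $ j..up $ j})"

lemma flat_face_sets [measurable, simp]: "flat_face lo up i \<in> sets (cross_section i)"
  unfolding flat_face_def by (intro sets_PiM_I_finite) auto

lemma emeasure_flat_face: "emeasure (cross_section i) (flat_face lo up i) < \<infinity>"
proof -
  have "emeasure (cross_section i) (flat_face lo up i)
     = (\<Prod>j\<in>UNIV-{i}. emeasure lborel {lo $ j..up $ j})"
    unfolding flat_face_def by (intro lborel_family.emeasure_PiM) auto
  also have "\<dots> < \<infinity>"
    by (simp add: ennreal_prod_eq_top less_top[symmetric] emeasure_lborel_Icc_eq)
  finally show ?thesis .
qed

lemma slice_in_cbox:
  "y \<in> flat_face lo up i \<Longrightarrow> t \<in> {lo $ i..up $ i} \<Longrightarrow> slice_pt i y t \<in> cbox lo up"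
  by (auto simp: flat_face_def mem_box_cart PiE_iff)

lemma open_box_minus_hyperplanes:
  fixes Z :: "'n::finite \<Rightarrow> real set"
  assumes "\<And>j. finite (Z j)"
  shows "open {x \<in> box lo up. \<forall>j. x $ j \<notin> Z j}"
proof -
  have "{x \<in> box lo up. \<forall>j. x $ j \<notin> Z j} = box lo up \<inter> (\<Inter>j. (\<lambda>x. x $ j) -` (- Z j))"
    by auto
  moreover have "open ((\<lambda>x::real^'n. x $ j) -` (- Z j))" for j
    using assms by (intro open_vimage continuous_intros) (auto intro: finite_imp_closed)
  ultimately show ?thesis by (auto intro!: open_INT)
qed

lemma integrable_bounded_on_box:
  fixes f :: "real^'n::finite \<Rightarrow> real"
  assumes "open S" "S \<subseteq> cbox lo up" "continuous_on S f" "\<And>x. x \<in> S \<Longrightarrow> \<bar>f x\<bar> \<le> C"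
  shows "set_integrable lborel S f"
proof -
  have "emeasure lborel S \<le> emeasure lborel (cbox lo up)"
    using assms by (intro emeasure_mono) auto
  also have "\<dots> < \<infinity>" by (rule emeasure_lborel_cbox_finite)
  finally have fin: "emeasure lborel S < \<infinity>" .
  show ?thesis unfolding set_integrable_def
  proof (rule integrableI_bounded_set[where A=S and B="C"])
    show "(\<lambda>x. indicator S x *\<^sub>R f x) \<in> borel_measurable lborel"
      using borel_measurable_continuous_on_indicator[OF _ assms(3)] assms(1) by auto
  qed (use assms fin in auto)
qed

text \<open>The fundamental theorem of calculus on almost every line parallel to a coordinate axis. The
  function need only be differentiable off finitely many hyperplanes, because a line meets those
  that are not parallel to it in finitely many points, and almost no line lies in one of the others.\<close>

lemma integral_partial_derivative:
  fixes h dh :: "real^'n::finite \<Rightarrow> real" and Z :: "'n \<Rightarrow> real set"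
  assumes lu: "\<And>j. lo $ j < up $ j"
    and Z: "\<And>j. finite (Z j)"
    and Om: "Om = {x \<in> box lo up. \<forall>j. x $ j \<notin> Z j}"
    and h: "continuous_on (cbox lo up) h"
    and dh: "continuous_on Om dh" "\<And>x. x \<in> Om \<Longrightarrow> \<bar>dh x\<bar> \<le> C"
    and der: "\<And>x. x \<in> Om \<Longrightarrow> ((\<lambda>t. h (x + t *\<^sub>R axis i 1)) has_real_derivative dh x) (at 0)"
  shows "(LINT x:Om|lborel. dh x) = (LINT y:flat_face lo up i|cross_section i.
            h (slice_pt i y (up $ i)) - h (slice_pt i y (lo $ i)))"
proof -
  let ?f = "\<lambda>x. indicator Om x *\<^sub>R dh x"
  have Om_open: "open Om" unfolding Om by (rule open_box_minus_hyperplanes[OF Z])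
  have Om_sub: "Om \<subseteq> cbox lo up" unfolding Om using box_subset_cbox by blast
  have int: "integrable lborel ?f"
    using integrable_bounded_on_box[OF Om_open Om_sub dh] unfolding set_integrable_def .
  have fm: "?f \<in> borel_measurable borel" using int by auto
  have *: "(\<integral>t. ?f (slice_pt i y t) \<partial>lborel) = indicator (flat_face lo up i) y *\<^sub>R
            (h (slice_pt i y (up $ i)) - h (slice_pt i y (lo $ i)))"
    if y: "\<forall>j. j \<noteq> i \<longrightarrow> y j \<notin> Z j \<union> {lo $ j, up $ j}" and sp: "y \<in> space (cross_section i)" for y
  proof (cases "y \<in> flat_face lo up i")
    case False
    then obtain j where j: "j \<noteq> i" "y j \<notin> {lo $ j..up $ j}"
      using sp by (auto simp: flat_face_def space_PiM PiE_iff)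
    then have "slice_pt i y t \<notin> Om" for t
      by (auto simp: Om mem_box_cart intro!: exI[of _ j])
    then show ?thesis using False by simp
  next
    case True
    have inO: "slice_pt i y t \<in> Om \<longleftrightarrow> t \<in> {lo $ i<..<up $ i} - Z i" for t
      using True y by (auto simp: flat_face_def PiE_iff Om mem_box_cart less_le split: if_splits)
    have shift: "slice_pt i y t + s *\<^sub>R axis i 1 = slice_pt i y (t + s)" for t s
      by (simp add: vec_eq_iff axis_def)
    have deriv: "((\<lambda>t. h (slice_pt i y t)) has_real_derivative dh (slice_pt i y t)) (at t)"
      if "t \<in> {lo $ i<..<up $ i} - Z i" for t
    proof -
      have "((\<lambda>s. h (slice_pt i y (t + s))) has_real_derivative dh (slice_pt i y t)) (at 0)"
        using der[of "slice_pt i y t"] that inO unfolding shift by blast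
      then show ?thesis using DERIV_at_within_shift[of "\<lambda>t. h (slice_pt i y t)" _ t 0 UNIV] 
        by (simp add: add.commute)
    qed
    have cts: "continuous_on {lo $ i..up $ i} (\<lambda>t. h (slice_pt i y t))"
    proof (rule continuous_on_compose2[OF h])
      show "continuous_on {lo $ i..up $ i} (slice_pt i y)"
      proof -
        have "continuous_on {lo $ i..up $ i} (\<lambda>t. if j = i then t else y j)" for j
          by (cases "j = i") auto
        then show ?thesis unfolding slice_pt_def by (rule continuous_on_vec_lambda)
      qed
    qed (use slice_in_cbox[OF True] in auto)
    have FTC: "((\<lambda>t. ?f (slice_pt i y t)) has_integral
           h (slice_pt i y (up $ i)) - h (slice_pt i y (lo $ i))) {lo $ i..up $ i}"
    proof (rule fundamental_theorem_of_calculus_interior_strong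
          [where f="\<lambda>t. h (slice_pt i y t)", OF Z[of i]])
      fix t assume t: "t \<in> {lo $ i<..<up $ i} - Z i"
      then have "?f (slice_pt i y t) = dh (slice_pt i y t)"
        using inO by simp
      then show "((\<lambda>t. h (slice_pt i y t)) has_vector_derivative ?f (slice_pt i y t)) (at t)"
        using deriv[OF t] by (simp only: has_real_derivative_iff_has_vector_derivative)
    qed (use lu[of i] cts in auto)
    have sm: "slice_pt i y \<in> borel_measurable borel"
      by (subst borel_measurable_euclidean_space) (auto simp: Basis_vec_def inner_axis)
    have "set_integrable lborel {lo $ i..up $ i} (\<lambda>t. ?f (slice_pt i y t))"
      unfolding set_integrable_def
    proof (rule integrableI_bounded_set[where A="{lo $ i..up $ i}" and B="\<bar>C\<bar>"])
      show "(\<lambda>t. indicator {lo $ i..up $ i} t *\<^sub>R ?f (slice_pt i y t)) \<in> borel_measurable lborel"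
        using measurable_compose[OF sm fm] by auto
      show "AE t in lborel. t \<in> {lo $ i..up $ i} \<longrightarrow> norm (indicator {lo $ i..up $ i} t *\<^sub>R ?f (slice_pt i y t)) \<le> \<bar>C\<bar>"
        using dh(2) by (intro always_eventually) (force simp: indicator_def)
    qed (auto simp: emeasure_lborel_Icc_eq)
    then have "(LINT t:{lo $ i..up $ i}|lborel. ?f (slice_pt i y t))
        = h (slice_pt i y (up $ i)) - h (slice_pt i y (lo $ i))"
      using FTC set_borel_integral_eq_integral(2) by (metis (no_types, lifting) integral_unique)
    moreover have "(LINT t:{lo $ i..up $ i}|lborel. ?f (slice_pt i y t))
        = (\<integral>t. ?f (slice_pt i y t) \<partial>lborel)"
      unfolding set_lebesgue_integral_def using inO
      by (intro Bochner_Integration.integral_cong) (auto simp: indicator_def)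
    ultimately show ?thesis using True by simp
  qed
  have sm: "(\<lambda>y. slice_pt i y t) \<in> cross_section i \<rightarrow>\<^sub>M borel" for t
    by (rule measurable_slice_pt)
  have "(LINT x:Om|lborel. dh x) = (\<integral>y. (\<integral>t. ?f (slice_pt i y t) \<partial>lborel) \<partial>cross_section i)"
    unfolding set_lebesgue_integral_def by (rule integral_slice[OF int])
  also have "\<dots> = (\<integral>y. indicator (flat_face lo up i) y *\<^sub>R
            (h (slice_pt i y (up $ i)) - h (slice_pt i y (lo $ i))) \<partial>cross_section i)"
  proof (rule integral_cong_AE)
    have "AE y in cross_section i. \<forall>j. j \<noteq> i \<longrightarrow> y j \<notin> Z j \<union> {lo $ j, up $ j}"
      using Z by (intro AE_cross_section_avoid) auto
    then show "AE y in cross_section i. (\<integral>t. ?f (slice_pt i y t) \<partial>lborel) =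
        indicator (flat_face lo up i) y *\<^sub>R
            (h (slice_pt i y (up $ i)) - h (slice_pt i y (lo $ i)))"
      using AE_space by eventually_elim (rule *)
    have hm: "(\<lambda>x. indicator (cbox lo up) x *\<^sub>R h x) \<in> borel_measurable borel"
      by (rule borel_measurable_continuous_on_indicator[OF _ h]) auto
    have "(\<lambda>y. indicator (flat_face lo up i) y *\<^sub>R
         (indicator (cbox lo up) (slice_pt i y (up $ i)) *\<^sub>R h (slice_pt i y (up $ i))
          - indicator (cbox lo up) (slice_pt i y (lo $ i)) *\<^sub>R h (slice_pt i y (lo $ i))))
         \<in> borel_measurable (cross_section i)"
    proof -
      have m0: "(\<lambda>y. indicator (flat_face lo up i) y :: real) \<in> borel_measurable (cross_section i)"
        by (intro borel_measurable_indicator) simp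
      show ?thesis
        by (intro borel_measurable_scaleR[OF m0] borel_measurable_diff measurable_compose[OF sm hm])
    qed
    also have "(\<lambda>y. indicator (flat_face lo up i) y *\<^sub>R
         (indicator (cbox lo up) (slice_pt i y (up $ i)) *\<^sub>R h (slice_pt i y (up $ i))
          - indicator (cbox lo up) (slice_pt i y (lo $ i)) *\<^sub>R h (slice_pt i y (lo $ i))))
        = (\<lambda>y. indicator (flat_face lo up i) y *\<^sub>R
            (h (slice_pt i y (up $ i)) - h (slice_pt i y (lo $ i))))"
      using slice_in_cbox[of _ lo up i] lu[THEN less_imp_le]
      by (auto simp: fun_eq_iff indicator_def)
    finally show "(\<lambda>y. indicator (flat_face lo up i) y *\<^sub>R
            (h (slice_pt i y (up $ i)) - h (slice_pt i y (lo $ i)))) \<in> borel_measurable (cross_section i)" .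
    show "(\<lambda>y. \<integral>t. ?f (slice_pt i y t) \<partial>lborel) \<in> borel_measurable (cross_section i)"
      using measurable_compose[OF measurable_slice_pt_pair fm]
      by (intro lborel.borel_measurable_lebesgue_integral) (simp add: case_prod_beta' )
  qed
  finally show ?thesis unfolding set_lebesgue_integral_def .
qed

section \<open>Change of variables\<close>

definition reindex_vec :: "('m \<Rightarrow> 'n) \<Rightarrow> real^'n::finite \<Rightarrow> real^'m::finite" where
  "reindex_vec \<pi> x = (\<chi> j. x $ \<pi> j)"

lemma reindex_vec_nth [simp]: "reindex_vec \<pi> x $ j = x $ \<pi> j"
  by (simp add: reindex_vec_def)

lemma linear_reindex_vec: "linear (reindex_vec \<pi>)"
  by (auto simp: linear_iff vec_eq_iff)

lemma continuous_reindex_vec: "continuous_on S (reindex_vec \<pi>)"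
  using linear_continuous_on[OF linear_conv_bounded_linear[THEN iffD1, OF linear_reindex_vec]] .

lemma measurable_reindex_vec [measurable]: "reindex_vec \<pi> \<in> borel_measurable borel"
  by (intro borel_measurable_continuous_onI continuous_reindex_vec)

lemma reindex_vec_inv:
  fixes \<pi> :: "'m::finite \<Rightarrow> 'n::finite"
  assumes "bij \<pi>"
  shows "reindex_vec \<pi> (reindex_vec (inv \<pi>) x) = x" "reindex_vec (inv \<pi>) (reindex_vec \<pi> z) = z"
  using assms by (auto simp: vec_eq_iff inv_f_f bij_is_inj bij_is_surj surj_f_inv_f)

text \<open>The change of variables theorem for well-ordered index types is carried over to any index type that
  is in bijection with one of them: renaming coordinates preserves Lebesgue measure, and it conjugates
  Jacobians by a bijection of the indices, which does not change determinants.\<close>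

lemma distr_lborel_reindex_vec:
  fixes \<pi> :: "'m::finite \<Rightarrow> 'n::finite"
  assumes \<pi>: "bij \<pi>"
  shows "lborel = distr lborel borel (reindex_vec \<pi> :: real^'n \<Rightarrow> real^'m)"
proof (rule lborel_eqI)
  fix l u :: "real^'m"
  assume lu: "\<And>b. b \<in> Basis \<Longrightarrow> l \<bullet> b \<le> u \<bullet> b"
  have lu': "l $ j \<le> u $ j" for j
    using lu[of "axis j 1"] by (auto simp: Basis_vec_def inner_axis)
  have vol: "emeasure lborel (box a b) = ennreal (\<Prod>j\<in>UNIV. b $ j - a $ j)"
      "(\<Prod>c\<in>Basis. (b - a) \<bullet> c) = (\<Prod>j\<in>UNIV. b $ j - a $ j)"
    if "\<And>j. a $ j \<le> b $ j" for a b :: "real^'k::finite"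
  proof -
    have B: "(Basis :: (real^'k) set) = range (\<lambda>j. axis j 1)" by (auto simp: Basis_vec_def)
    have "inj (\<lambda>j::'k. axis j (1::real))" by (auto simp: inj_def axis_eq_axis)
    from prod.reindex[OF this, of "\<lambda>c. (b - a) \<bullet> c"]
    show *: "(\<Prod>c\<in>Basis. (b - a) \<bullet> c) = (\<Prod>j\<in>UNIV. b $ j - a $ j)"
      unfolding B by (simp add: inner_axis)
    have "\<And>c. c \<in> Basis \<Longrightarrow> a \<bullet> c \<le> b \<bullet> c" using that unfolding B by (auto simp: inner_axis)
    then show "emeasure lborel (box a b) = ennreal (\<Prod>j\<in>UNIV. b $ j - a $ j)"
      by (simp add: emeasure_lborel_box_eq * [symmetric])
  qed
  have "reindex_vec \<pi> -` box l u = box (reindex_vec (inv \<pi>) l) (reindex_vec (inv \<pi>) u)"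
  proof -
    have "(\<forall>j. l $ j < x $ \<pi> j \<and> x $ \<pi> j < u $ j) \<longleftrightarrow>
        (\<forall>i. l $ inv \<pi> i < x $ i \<and> x $ i < u $ inv \<pi> i)" for x :: "real^'n"
      using \<pi> by (metis bij_inv_eq_iff)
    then show ?thesis by (auto simp: mem_box_cart)
  qed
  then have "emeasure (distr lborel borel (reindex_vec \<pi>)) (box l u)
      = ennreal (\<Prod>i\<in>UNIV. u $ inv \<pi> i - l $ inv \<pi> i)"
    using lu' by (subst emeasure_distr) (auto simp: vol)
  also have "(\<Prod>i\<in>UNIV. u $ inv \<pi> i - l $ inv \<pi> i) = (\<Prod>j\<in>UNIV. u $ j - l $ j)"
    by (rule prod.reindex_bij_betw) (use \<pi> in \<open>auto simp: bij_imp_bij_inv\<close>)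
  also have "\<dots> = (\<Prod>c\<in>Basis. (u - l) \<bullet> c)" using lu' by (simp add: vol)
  finally show "emeasure (distr lborel borel (reindex_vec \<pi>)) (box l u)
      = ennreal (\<Prod>c\<in>Basis. (u - l) \<bullet> c)" .
qed simp

lemma lebesgue_reindex_vec:
  fixes \<pi> :: "'m::finite \<Rightarrow> 'n::finite"
  assumes \<pi>: "bij \<pi>"
  shows "(reindex_vec \<pi> :: real^'n \<Rightarrow> real^'m) \<in> lebesgue \<rightarrow>\<^sub>M lebesgue" (is "?m")
    and "lebesgue = distr lebesgue lebesgue (reindex_vec \<pi> :: real^'n \<Rightarrow> real^'m)"
proof -
  let ?P = "reindex_vec \<pi> :: real^'n \<Rightarrow> real^'m"
  have PL: "?P \<in> lebesgue \<rightarrow>\<^sub>M lborel"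
    by (intro measurable_completion) simp
  have eq: "lborel = distr lebesgue lborel ?P"
    by (subst distr_completion) (use distr_lborel_reindex_vec[OF \<pi>] in \<open>auto cong: distr_cong\<close>)
  show ?m
    by (rule completion.measurable_completion2[OF PL]) (simp flip: eq)
  have "lebesgue = completion (distr lebesgue lborel ?P)"
    by (simp flip: eq)
  also have "\<dots> = distr lebesgue lebesgue ?P"
    by (rule completion.completion_distr_eq[OF PL]) (simp flip: eq)
  finally show "lebesgue = distr lebesgue lebesgue ?P" .
qed

lemma integrable_reindex_vec:
  fixes \<pi> :: "'m::finite \<Rightarrow> 'n::finite" and g :: "real^'m \<Rightarrow> real"
  assumes \<pi>: "bij \<pi>"
  shows "integrable lebesgue (\<lambda>x. g (reindex_vec \<pi> x)) \<longleftrightarrow> integrable lebesgue g" (is ?th1)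
    and "(\<integral>x. g (reindex_vec \<pi> x) \<partial>lebesgue) = integral\<^sup>L lebesgue g" (is ?th2)
proof -
  have *: "integrable lebesgue (\<lambda>x. h (reindex_vec \<rho> x))
      \<and> (\<integral>x. h (reindex_vec \<rho> x) \<partial>lebesgue) = integral\<^sup>L lebesgue h"
    if "integrable lebesgue h" "bij \<rho>"
    for h :: "real^'k \<Rightarrow> real" and \<rho> :: "'k::finite \<Rightarrow> 'l::finite"
  proof -
    note l = lebesgue_reindex_vec[OF that(2)]
    have "integrable (distr lebesgue lebesgue (reindex_vec \<rho> :: real^'l \<Rightarrow> real^'k)) h"
      using that(1) l(2) by simp
    then show ?thesis
      using integrable_distr[OF l(1)] integral_distr[OF l(1), of h] that(1)
      by (auto simp flip: l(2))
  qed
  have inv: "bij (inv \<pi>)" using \<pi> by (rule bij_imp_bij_inv)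
  show ?th1
  proof
    assume "integrable lebesgue (\<lambda>x. g (reindex_vec \<pi> x))"
    from *[OF this inv] show "integrable lebesgue g"
      by (simp add: reindex_vec_inv[OF \<pi>])
  qed (use *[OF _ \<pi>] in blast)
  then show ?th2
    using *[of g, OF _ \<pi>] by (cases "integrable lebesgue g") (auto simp: not_integrable_integral_eq)
qed

text \<open>Conjugation by a bijection maps permutations to permutations of the same sign, so it only reorders the
  Leibniz sum.\<close>

lemma det_reindex:
  fixes A :: "real^'n::finite^'n" and \<pi> :: "'m::finite \<Rightarrow> 'n"
  assumes \<pi>: "bij \<pi>"
  shows "det (\<chi> a b. A $ \<pi> a $ \<pi> b) = det A"
proof -
  have map: "map_permutation UNIV \<pi> p = (\<lambda>x. \<pi> (p (inv \<pi> x)))" for p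
    using \<pi> by (auto simp: map_permutation_def restrict_id_def fun_eq_iff bij_is_surj)
  have bb: "bij_betw (\<lambda>p x. \<pi> (p (inv \<pi> x))) {p. p permutes UNIV} {p. p permutes UNIV}"
    using bij_betw_permutations[of \<pi> UNIV UNIV] \<pi> by simp
  have "det A = (\<Sum>p\<in>{p. p permutes UNIV}. of_int (sign (\<lambda>x. \<pi> (p (inv \<pi> x)))) *
       (\<Prod>i\<in>UNIV. A $ i $ \<pi> (p (inv \<pi> i))))"
    unfolding det_def by (rule sum.reindex_bij_betw[OF bb, symmetric])
  also have "\<dots> = (\<Sum>p\<in>{p. p permutes UNIV}. of_int (sign p) * (\<Prod>j\<in>UNIV. A $ \<pi> j $ \<pi> (p j)))"
  proof (intro sum.cong refl arg_cong2[where f="(*)"])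
    fix p :: "'m \<Rightarrow> 'm" assume "p \<in> {p. p permutes UNIV}"
    then show "of_int (sign (\<lambda>x. \<pi> (p (inv \<pi> x)))) = (of_int (sign p) :: real)"
      using sign_map_permutation[of \<pi> UNIV p] \<pi> by (simp add: map bij_is_inj)
    show "(\<Prod>i\<in>UNIV. A $ i $ \<pi> (p (inv \<pi> i))) = (\<Prod>j\<in>UNIV. A $ \<pi> j $ \<pi> (p j))"
      using \<pi> by (subst prod.reindex_bij_betw[OF \<pi>, symmetric]) (simp add: inv_f_f bij_is_inj)
  qed
  finally show ?thesis by (simp add: det_def)
qed

lemma change_of_variables_wellorder:
  fixes f :: "real^'m::{finite,wellorder} \<Rightarrow> real" and g :: "real^'m::_ \<Rightarrow> real^'m::_"
  assumes S: "S \<in> sets lebesgue" and der: "\<And>x. x \<in> S \<Longrightarrow> (g has_derivative g' x) (at x within S)"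
    and inj: "inj_on g S"
  shows "set_integrable lebesgue S (\<lambda>x. \<bar>det (matrix (g' x))\<bar> * f (g x)) \<longleftrightarrow>
           set_integrable lebesgue (g ` S) f" (is "?I1 \<longleftrightarrow> ?I2")
    and "(LINT x:S|lebesgue. \<bar>det (matrix (g' x))\<bar> * f (g x)) = (LINT y:g ` S|lebesgue. f y)"
proof -
  have *: "?I1 \<and> integral S (\<lambda>x. \<bar>det (matrix (g' x))\<bar> * f (g x)) = b
     \<longleftrightarrow> ?I2 \<and> integral (g ` S) f = b" for b
  proof -
    have "(\<lambda>x. \<bar>det (matrix (g' x))\<bar> *\<^sub>R vec (f (g x)) :: real^1) absolutely_integrable_on S \<and>
           integral S (\<lambda>x. \<bar>det (matrix (g' x))\<bar> *\<^sub>R vec (f (g x))) = (vec b :: real^1)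
       \<longleftrightarrow> (\<lambda>x. vec (f x) :: real^1) absolutely_integrable_on (g ` S) \<and>
           integral (g ` S) (\<lambda>x. vec (f x)) = (vec b :: real^1)"
      by (intro has_absolute_integral_change_of_variables assms)
    then show ?thesis
      by (simp add: absolutely_integrable_on_1_iff integral_on_1_eq)
  qed
  show iff: "?I1 \<longleftrightarrow> ?I2" using * by blast
  show "(LINT x:S|lebesgue. \<bar>det (matrix (g' x))\<bar> * f (g x)) = (LINT y:g ` S|lebesgue. f y)"
  proof (cases ?I1)
    case True
    with iff have "?I2" by simp
    with True * show ?thesis by (simp add: set_lebesgue_integral_eq_integral(2))
  next
    case False
    with iff have "\<not> ?I2" by simp
    with False show ?thesis
      by (simp add: set_lebesgue_integral_def set_integrable_def not_integrable_integral_eq)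
  qed
qed

lemma change_of_variables_reindex:
  fixes f :: "real^'n::finite \<Rightarrow> real" and g :: "real^'n \<Rightarrow> real^'n"
    and \<pi> :: "'m::{finite,wellorder} \<Rightarrow> 'n"
  assumes \<pi>: "bij \<pi>" and S: "open S"
    and der: "\<And>x. x \<in> S \<Longrightarrow> (g has_derivative g' x) (at x)"
    and inj: "inj_on g S"
  shows "(set_integrable lebesgue S (\<lambda>x. \<bar>det (matrix (g' x))\<bar> * f (g x)) \<longleftrightarrow>
           set_integrable lebesgue (g ` S) f) \<and>
         (LINT x:S|lebesgue. \<bar>det (matrix (g' x))\<bar> * f (g x)) = (LINT y:g ` S|lebesgue. f y)"
proof -
  let ?P = "reindex_vec \<pi> :: real^'n \<Rightarrow> real^'m::_" and ?Q = "reindex_vec (inv \<pi>) :: real^'m::_ \<Rightarrow> real^'n"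
  note PQ [simp] = reindex_vec_inv[OF \<pi>]
  have inv: "bij (inv \<pi>)" using \<pi> by (rule bij_imp_bij_inv)
  define T where "T = ?Q -` S"
  have PS: "T = ?P ` S" by (force simp: T_def image_iff)
  have openT: "open T" unfolding T_def by (intro open_vimage S continuous_reindex_vec)
  define G where "G = ?P \<circ> g \<circ> ?Q"
  define G' where "G' x = ?P \<circ> g' (?Q x) \<circ> ?Q" for x
  have bl: "bounded_linear ?P" "bounded_linear ?Q"
    using linear_reindex_vec linear_conv_bounded_linear by auto
  have derG: "(G has_derivative G' x) (at x within T)" if "x \<in> T" for x
  proof -
    have "(?Q has_derivative ?Q) (at x)" using bl(2) by (rule bounded_linear_imp_has_derivative)
    moreover have "(g has_derivative g' (?Q x)) (at (?Q x))" using that der by (simp add: T_def)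
    ultimately have "(g \<circ> ?Q has_derivative g' (?Q x) \<circ> ?Q) (at x)" by (rule diff_chain_at)
    moreover have "(?P has_derivative ?P) (at ((g \<circ> ?Q) x))" using bl(1) by (rule bounded_linear_imp_has_derivative)
    ultimately have "(?P \<circ> (g \<circ> ?Q) has_derivative ?P \<circ> (g' (?Q x) \<circ> ?Q)) (at x)" by (rule diff_chain_at)
    then show ?thesis unfolding G_def G'_def by (auto simp: o_assoc intro: has_derivative_at_withinI)
  qed
  have injG: "inj_on G T"
  proof (rule inj_onI)
    fix x y assume xy: "x \<in> T" "y \<in> T" "G x = G y"
    then have "?Q (G x) = ?Q (G y)" by simp
    then have "g (?Q x) = g (?Q y)" by (simp add: G_def)
    then have "?Q x = ?Q y" using xy inj by (auto simp: T_def inj_on_def)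
    then have "?P (?Q x) = ?P (?Q y)" by simp
    then show "x = y" by simp
  qed
  have GT: "G ` T = ?P ` (g ` S)" unfolding PS G_def by (auto simp: image_comp o_def)
  have detG: "det (matrix (G' x)) = det (matrix (g' (?Q x)))" for x
  proof -
    have ax: "?Q (axis b 1) = axis (\<pi> b) 1" for b
    proof -
      have "inv \<pi> k = b \<longleftrightarrow> k = \<pi> b" for k using \<pi> by (metis bij_inv_eq_iff)
      then show ?thesis by (simp add: vec_eq_iff axis_def)
    qed
    have "matrix (G' x) = (\<chi> a b. matrix (g' (?Q x)) $ \<pi> a $ \<pi> b)"
      by (simp add: matrix_def G'_def ax vec_eq_iff)
    then show ?thesis using det_reindex[OF \<pi>] by simp
  qed
  have mem: "?P x \<in> T \<longleftrightarrow> x \<in> S" "?P y \<in> G ` T \<longleftrightarrow> y \<in> g ` S" for x y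
  proof -
    show "?P x \<in> T \<longleftrightarrow> x \<in> S" by (simp add: T_def)
    show "?P y \<in> G ` T \<longleftrightarrow> y \<in> g ` S"
      unfolding GT by (metis (no_types, lifting) PQ(2) image_iff)
  qed
  have ind: "indicator T (?P x) = (indicator S x :: real)"
      "indicator (G ` T) (?P y) = (indicator (g ` S) y :: real)" for x y
    using mem by (auto simp: indicator_def)
  note cov = change_of_variables_wellorder[OF _ derG injG, of "\<lambda>z. f (?Q z)"]
  have l1: "set_integrable lebesgue T (\<lambda>x. \<bar>det (matrix (G' x))\<bar> * f (?Q (G x)))
      \<longleftrightarrow> set_integrable lebesgue S (\<lambda>x. \<bar>det (matrix (g' x))\<bar> * f (g x))"
    unfolding set_integrable_def detG G_def
    by (subst integrable_reindex_vec(1)[OF \<pi>, symmetric]) (simp add: ind)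
  have l2: "(LINT x:T|lebesgue. \<bar>det (matrix (G' x))\<bar> * f (?Q (G x)))
      = (LINT x:S|lebesgue. \<bar>det (matrix (g' x))\<bar> * f (g x))"
    unfolding set_lebesgue_integral_def detG G_def
    by (subst integrable_reindex_vec(2)[OF \<pi>, symmetric]) (simp add: ind)
  have r1: "set_integrable lebesgue (G ` T) (\<lambda>z. f (?Q z)) \<longleftrightarrow> set_integrable lebesgue (g ` S) f"
    unfolding set_integrable_def
    by (subst integrable_reindex_vec(1)[OF \<pi>, symmetric]) (simp add: ind)
  have r2: "(LINT z:G ` T|lebesgue. f (?Q z)) = (LINT y:g ` S|lebesgue. f y)"
    unfolding set_lebesgue_integral_def
    by (subst integrable_reindex_vec(2)[OF \<pi>, symmetric]) (simp add: ind)
  show ?thesis using cov openT by (simp add: l1 l2 r1 r2)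
qed

text \<open>Index types with two or three elements are in bijection with the well-ordered types \<open>2\<close> and \<open>3\<close>.\<close>

lemma change_of_variables_2_3:
  fixes f :: "real^'n::finite \<Rightarrow> real" and g :: "real^'n \<Rightarrow> real^'n"
  assumes dim: "CARD('n) = 2 \<or> CARD('n) = 3" and S: "open S"
    and der: "\<And>x. x \<in> S \<Longrightarrow> (g has_derivative g' x) (at x)"
    and inj: "inj_on g S"
  shows "set_integrable lebesgue S (\<lambda>x. \<bar>det (matrix (g' x))\<bar> * f (g x)) \<longleftrightarrow>
           set_integrable lebesgue (g ` S) f"
    and "(LINT x:S|lebesgue. \<bar>det (matrix (g' x))\<bar> * f (g x)) = (LINT y:g ` S|lebesgue. f y)"
proof -
  have "(set_integrable lebesgue S (\<lambda>x. \<bar>det (matrix (g' x))\<bar> * f (g x)) \<longleftrightarrow>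
           set_integrable lebesgue (g ` S) f) \<and>
         (LINT x:S|lebesgue. \<bar>det (matrix (g' x))\<bar> * f (g x)) = (LINT y:g ` S|lebesgue. f y)"
    using dim
  proof
    assume "CARD('n) = 2"
    then obtain \<pi> :: "2 \<Rightarrow> 'n" where "bij \<pi>"
      using finite_same_card_bij[of "UNIV :: 2 set" "UNIV :: 'n set"] by auto
    then show ?thesis by (rule change_of_variables_reindex[OF _ S der inj])
  next
    assume "CARD('n) = 3"
    then obtain \<pi> :: "3 \<Rightarrow> 'n" where "bij \<pi>"
      using finite_same_card_bij[of "UNIV :: 3 set" "UNIV :: 'n set"] by auto
    then show ?thesis by (rule change_of_variables_reindex[OF _ S der inj])
  qed
  then show "set_integrable lebesgue S (\<lambda>x. \<bar>det (matrix (g' x))\<bar> * f (g x)) \<longleftrightarrow>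
           set_integrable lebesgue (g ` S) f"
    and "(LINT x:S|lebesgue. \<bar>det (matrix (g' x))\<bar> * f (g x)) = (LINT y:g ` S|lebesgue. f y)"
    by auto
qed

section \<open>Derivatives of determinants and the divergence of a Piola transform\<close>

lemma has_derivative_vecI:
  fixes f :: "'a::real_normed_vector \<Rightarrow> 'b::euclidean_space^'n::finite"
  assumes "\<And>i. ((\<lambda>x. f x $ i) has_derivative (\<lambda>e. f' e $ i)) (at x within S)"
  shows "(f has_derivative f') (at x within S)"
proof -
  have "((\<lambda>x. f x \<bullet> b) has_derivative (\<lambda>e. f' e \<bullet> b)) (at x within S)" if b: "b \<in> Basis" for b
  proof -
    obtain i c where "b = axis i c" "c \<in> Basis" using b by (auto simp: Basis_vec_def)
    then show ?thesis
      using bounded_linear.has_derivative[OF bounded_linear_inner_left assms[of i], of c]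
      by (simp add: inner_axis)
  qed
  then show ?thesis using has_derivative_componentwise_within[of f f' x S] by blast
qed

lemma continuous_on_vecI:
  fixes f :: "'a::topological_space \<Rightarrow> 'b::topological_space^'n::finite"
  assumes "\<And>i. continuous_on S (\<lambda>x. f x $ i)"
  shows "continuous_on S f"
  using continuous_on_vec_lambda[of S "\<lambda>i x. f x $ i"] assms by simp

lemma continuous_on_det:
  fixes A :: "'a::topological_space \<Rightarrow> real^'n::finite^'n"
  assumes "continuous_on S A"
  shows "continuous_on S (\<lambda>x. det (A x))"
  unfolding det_def using assms by (intro continuous_intros)

lemma matrix_inv_det_nz:
  fixes A :: "real^'n::finite^'n"
  assumes "det A \<noteq> 0"
  shows "A ** matrix_inv A = mat 1" "matrix_inv A ** A = mat 1"
proof -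
  have "invertible A" using assms by (simp add: invertible_det_nz)
  then have "\<exists>B. A ** B = mat 1 \<and> B ** A = mat 1" by (simp add: invertible_def)
  then have "A ** matrix_inv A = mat 1 \<and> matrix_inv A ** A = mat 1"
    unfolding matrix_inv_def by (rule someI_ex)
  then show "A ** matrix_inv A = mat 1" "matrix_inv A ** A = mat 1" by auto
qed

lemma matrix_inv_vector_mul:
  fixes A :: "real^'n::finite^'n"
  assumes "det A \<noteq> 0"
  shows "A *v (matrix_inv A *v x) = x" "matrix_inv A *v (A *v x) = x"
  using matrix_inv_det_nz[OF assms] by (simp_all add: matrix_vector_mul_assoc)

text \<open>Cramer's rule writes the entries of the inverse as quotients of determinants.\<close>

lemma continuous_on_matrix_inv:
  fixes A :: "'a::topological_space \<Rightarrow> real^'n::finite^'n"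
  assumes A: "continuous_on S A" and nz: "\<And>x. x \<in> S \<Longrightarrow> det (A x) \<noteq> 0"
  shows "continuous_on S (\<lambda>x. matrix_inv (A x))"
proof (intro continuous_on_vecI)
  fix k l
  have eq: "matrix_inv (A x) $ k $ l
     = det (\<chi> i j. if j = k then axis l 1 $ i else A x $ i $ j) / det (A x)" if "x \<in> S" for x
  proof -
    have "A x *v (matrix_inv (A x) *v axis l 1) = axis l 1"
      by (rule matrix_inv_vector_mul[OF nz[OF that]])
    then have "matrix_inv (A x) *v axis l 1
        = (\<chi> k. det (\<chi> i j. if j = k then axis l 1 $ i else A x $ i $ j) / det (A x))"
      using cramer[OF nz[OF that]] by blast
    moreover have "matrix_inv (A x) $ k $ l = (matrix_inv (A x) *v axis l 1) $ k"
      by (simp add: matrix_vector_mult_basis column_def)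
    ultimately show ?thesis by simp
  qed
  have entry: "continuous_on S (\<lambda>x. if j = k then c else A x $ i $ j)" for i j c
    by (cases "j = k") (auto intro!: continuous_intros A)
  have "continuous_on S (\<lambda>x. det (\<chi> i j. if j = k then axis l 1 $ i else A x $ i $ j) / det (A x))"
    using nz by (intro continuous_on_divide continuous_on_det A continuous_on_vec_lambda entry) auto
  then show "continuous_on S (\<lambda>x. matrix_inv (A x) $ k $ l)"
    using eq by (simp cong: continuous_on_cong)
qed

text \<open>Jacobi's formula. Differentiating the Leibniz expansion replaces one row at a time by the
  corresponding row of the direction, and Cramer's rule evaluates the resulting determinants.\<close>

lemma has_derivative_det:
  fixes A :: "'a::real_normed_vector \<Rightarrow> real^'n::finite^'n"
  assumes A: "(A has_derivative A') (at x within S)" and nz: "det (A x) \<noteq> 0"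
  shows "((\<lambda>x. det (A x)) has_derivative (\<lambda>e. det (A x) * trace (matrix_inv (A x) ** A' e))) (at x within S)"
proof -
  have entry: "((\<lambda>x. A x $ i $ j) has_derivative (\<lambda>e. A' e $ i $ j)) (at x within S)" for i j
    using bounded_linear.has_derivative[OF bounded_linear_vec_nth
        bounded_linear.has_derivative[OF bounded_linear_vec_nth A]] .
  let ?P = "{p. p permutes (UNIV :: 'n set)}"
  define D where "D e = (\<Sum>p\<in>?P. of_int (sign p) *
      (\<Sum>i\<in>UNIV. A' e $ i $ p i * (\<Prod>j\<in>UNIV - {i}. A x $ j $ p j)))" for e
  have 1: "((\<lambda>x. det (A x)) has_derivative D) (at x within S)"
    unfolding det_def D_def
    by (intro has_derivative_sum has_derivative_mult_right has_derivative_prod entry)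
  have "D e = det (A x) * trace (matrix_inv (A x) ** A' e)" for e
  proof -
    \<comment> \<open>coefficients of the rows of the direction with respect to the rows of \<open>A x\<close>\<close>
    let ?c = "A' e ** matrix_inv (A x)"
    have row: "row i (A' e) = (\<Sum>k\<in>UNIV. ?c $ i $ k *s row k (A x))" for i
    proof -
      have "?c ** A x = A' e"
        by (simp add: matrix_mul_assoc[symmetric] matrix_inv_det_nz(2)[OF nz])
      then have "A' e $ i $ j = (\<Sum>k\<in>UNIV. ?c $ i $ k * A x $ k $ j)" for j
        by (metis (no_types, lifting) matrix_matrix_mult_def sum.cong vec_lambda_beta)
      then show ?thesis by (simp add: vec_eq_iff row_def)
    qed
    have "D e = (\<Sum>i\<in>UNIV. \<Sum>p\<in>?P. of_int (sign p) *
        (A' e $ i $ p i * (\<Prod>j\<in>UNIV - {i}. A x $ j $ p j)))"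
      unfolding D_def sum_distrib_left by (rule sum.swap)
    also have "\<dots> = (\<Sum>i\<in>UNIV. det (\<chi> k. if k = i then row i (A' e) else row k (A x)))"
    proof (rule sum.cong[OF refl])
      fix i :: 'n
      have "(\<Prod>j\<in>UNIV. (\<chi> k. if k = i then row i (A' e) else row k (A x)) $ j $ p j)
          = A' e $ i $ p i * (\<Prod>j\<in>UNIV - {i}. A x $ j $ p j)" for p
        by (subst prod.remove[of _ i]) (auto simp: row_def intro!: prod.cong)
      then show "(\<Sum>p\<in>?P. of_int (sign p) * (A' e $ i $ p i * (\<Prod>j\<in>UNIV - {i}. A x $ j $ p j)))
          = det (\<chi> k. if k = i then row i (A' e) else row k (A x))"
        unfolding det_def by simp
    qed
    also have "\<dots> = (\<Sum>i\<in>UNIV. ?c $ i $ i * det (A x))"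
    proof (rule sum.cong[OF refl])
      fix i :: 'n
      have "det (\<chi> k. if k = i then row i (A' e) else row k (A x))
          = det (\<chi> k. if k = i then (\<Sum>k\<in>UNIV. (?c $ i) $ k *s row k (A x)) else row k (A x))"
        unfolding row[of i] ..
      also have "\<dots> = ?c $ i $ i * det (A x)"
        by (rule cramer_lemma_transpose)
      finally show "det (\<chi> k. if k = i then row i (A' e) else row k (A x)) = ?c $ i $ i * det (A x)" .
    qed
    also have "\<dots> = det (A x) * trace (A' e ** matrix_inv (A x))"
      by (simp add: trace_def sum_distrib_left mult.commute)
    finally show ?thesis by (subst trace_mul_sym)
  qed
  then have "D = (\<lambda>e. det (A x) * trace (matrix_inv (A x) ** A' e))" by (rule ext)
  with 1 show ?thesis by simp
qed

text \<open>Two applications of the mean value theorem turn the second difference into a mixed derivative at a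
  nearby point. The second difference is symmetric in the two directions, so both mixed derivatives
  are its limit.\<close>

lemma second_difference_mvt:
  fixes f :: "'a::real_normed_vector \<Rightarrow> real"
  assumes h: "0 < h"
    and U: "\<And>s t. s \<in> {0..h} \<Longrightarrow> t \<in> {0..h} \<Longrightarrow> x + s *\<^sub>R a + t *\<^sub>R b \<in> U"
    and f: "\<And>z. z \<in> U \<Longrightarrow> f differentiable (at z)"
    and fa: "\<And>z. z \<in> U \<Longrightarrow> dir_deriv a f differentiable (at z)"
  shows "\<exists>s\<in>{0..h}. \<exists>t\<in>{0..h}. f (x + h *\<^sub>R a + h *\<^sub>R b) - f (x + h *\<^sub>R a) - f (x + h *\<^sub>R b) + f x
       = h^2 * dir_deriv b (dir_deriv a f) (x + s *\<^sub>R a + t *\<^sub>R b)"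
proof -
  have line: "((\<lambda>s. g (z + s *\<^sub>R c)) has_real_derivative dir_deriv c g (z + s *\<^sub>R c)) (at s)"
    if "g differentiable (at (z + s *\<^sub>R c))" for g :: "'a \<Rightarrow> real" and z c s
  proof -
    have "(g has_derivative frechet_derivative g (at (z + s *\<^sub>R c))) (at (z + s *\<^sub>R c))"
      using that by (simp add: frechet_derivative_works)
    moreover have "((\<lambda>s. z + s *\<^sub>R c) has_derivative (\<lambda>r. r *\<^sub>R c)) (at s)"
      by (auto intro!: derivative_eq_intros)
    ultimately have "((\<lambda>s. g (z + s *\<^sub>R c)) has_derivative
        (\<lambda>r. frechet_derivative g (at (z + s *\<^sub>R c)) (r *\<^sub>R c))) (at s)"
      using has_derivative_compose by blast
    moreover have "frechet_derivative g (at (z + s *\<^sub>R c)) (r *\<^sub>R c) = r * dir_deriv c g (z + s *\<^sub>R c)" for r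
      using linear_frechet_derivative[OF that] by (simp add: linear_cmul dir_deriv_def)
    ultimately show ?thesis by (simp add: has_field_derivative_def mult.commute[of _ "dir_deriv _ _ _"])
  qed
  have "\<exists>s. 0 < s \<and> s < h \<and> (f (x + h *\<^sub>R b + h *\<^sub>R a) - f (x + h *\<^sub>R a)) - (f (x + h *\<^sub>R b + 0 *\<^sub>R a) - f (x + 0 *\<^sub>R a))
      = (h - 0) * (dir_deriv a f (x + h *\<^sub>R b + s *\<^sub>R a) - dir_deriv a f (x + s *\<^sub>R a))"
  proof (rule MVT2[OF h])
    fix s assume s: "0 \<le> s" "s \<le> h"
    show "((\<lambda>s. f (x + h *\<^sub>R b + s *\<^sub>R a) - f (x + s *\<^sub>R a)) has_real_derivative
        dir_deriv a f (x + h *\<^sub>R b + s *\<^sub>R a) - dir_deriv a f (x + s *\<^sub>R a)) (at s)"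
      using U[of s h] U[of s 0] s h by (intro DERIV_diff line f) (auto simp: algebra_simps)
  qed
  then obtain s where s: "0 < s" "s < h" and
    e1: "(f (x + h *\<^sub>R b + h *\<^sub>R a) - f (x + h *\<^sub>R a)) - (f (x + h *\<^sub>R b + 0 *\<^sub>R a) - f (x + 0 *\<^sub>R a))
      = (h - 0) * (dir_deriv a f (x + h *\<^sub>R b + s *\<^sub>R a) - dir_deriv a f (x + s *\<^sub>R a))" by blast
  have "\<exists>t. 0 < t \<and> t < h \<and> dir_deriv a f (x + s *\<^sub>R a + h *\<^sub>R b) - dir_deriv a f (x + s *\<^sub>R a + 0 *\<^sub>R b)
      = (h - 0) * dir_deriv b (dir_deriv a f) (x + s *\<^sub>R a + t *\<^sub>R b)"
    by (rule MVT2[OF h]) (use U[of s] s in \<open>auto intro!: line fa\<close>)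
  then obtain t where t: "0 < t" "t < h" and
    e2: "dir_deriv a f (x + s *\<^sub>R a + h *\<^sub>R b) - dir_deriv a f (x + s *\<^sub>R a + 0 *\<^sub>R b)
      = (h - 0) * dir_deriv b (dir_deriv a f) (x + s *\<^sub>R a + t *\<^sub>R b)" by blast
  have "f (x + h *\<^sub>R a + h *\<^sub>R b) - f (x + h *\<^sub>R a) - f (x + h *\<^sub>R b) + f x
       = h * (dir_deriv a f (x + s *\<^sub>R a + h *\<^sub>R b) - dir_deriv a f (x + s *\<^sub>R a))"
    using e1 by (simp add: algebra_simps)
  also have "\<dots> = h^2 * dir_deriv b (dir_deriv a f) (x + s *\<^sub>R a + t *\<^sub>R b)"
    using e2 by (simp add: power2_eq_square)
  finally show ?thesis using s t by (intro bexI[of _ s] bexI[of _ t]) auto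
qed

lemma mixed_dir_derivs_commute:
  fixes f :: "'a::real_normed_vector \<Rightarrow> real"
  assumes U: "open U" "x \<in> U"
    and f: "\<And>z. z \<in> U \<Longrightarrow> f differentiable (at z)"
    and fa: "\<And>z. z \<in> U \<Longrightarrow> dir_deriv a f differentiable (at z)"
    and fb: "\<And>z. z \<in> U \<Longrightarrow> dir_deriv b f differentiable (at z)"
    and cab: "continuous_on U (dir_deriv b (dir_deriv a f))"
    and cba: "continuous_on U (dir_deriv a (dir_deriv b f))"
  shows "dir_deriv b (dir_deriv a f) x = dir_deriv a (dir_deriv b f) x"
proof (rule ccontr)
  let ?p = "dir_deriv b (dir_deriv a f)" and ?q = "dir_deriv a (dir_deriv b f)"
  assume "?p x \<noteq> ?q x"
  define \<epsilon> where "\<epsilon> = \<bar>?p x - ?q x\<bar> / 2"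
  have \<epsilon>: "\<epsilon> > 0" using \<open>?p x \<noteq> ?q x\<close> by (simp add: \<epsilon>_def)
  obtain r0 where r0: "r0 > 0" "ball x r0 \<subseteq> U" using U open_contains_ball by blast
  obtain r1 where r1: "r1 > 0" "\<And>z. z \<in> U \<Longrightarrow> dist z x < r1 \<Longrightarrow> dist (?p z) (?p x) < \<epsilon>"
    using cab U(2) \<epsilon> unfolding continuous_on_iff by blast
  obtain r2 where r2: "r2 > 0" "\<And>z. z \<in> U \<Longrightarrow> dist z x < r2 \<Longrightarrow> dist (?q z) (?q x) < \<epsilon>"
    using cba U(2) \<epsilon> unfolding continuous_on_iff by blast
  define r where "r = min r0 (min r1 r2)"
  have r: "r > 0" "r \<le> r0" "r \<le> r1" "r \<le> r2" using r0 r1 r2 by (auto simp: r_def)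
  \<comment> \<open>so small that the parallelogram spanned by \<open>h a\<close> and \<open>h b\<close> stays where both derivatives vary by less than \<open>\<epsilon>\<close>\<close>
  define h where "h = r / (norm a + norm b + 1)"
  have h: "h > 0" using r by (simp add: h_def add_nonneg_pos)
  have near: "dist (x + s *\<^sub>R a + t *\<^sub>R b) x < r" if "s \<in> {0..h}" "t \<in> {0..h}" for s t
  proof -
    have "dist (x + s *\<^sub>R a + t *\<^sub>R b) x = norm (s *\<^sub>R a + t *\<^sub>R b)"
      by (simp add: dist_norm add.assoc)
    also have "\<dots> \<le> s * norm a + t * norm b"
      using that by (intro order_trans[OF norm_triangle_ineq]) auto
    also have "\<dots> \<le> h * norm a + h * norm b"
      using that by (intro add_mono mult_right_mono) auto
    also have "\<dots> < h * (norm a + norm b + 1)" using h by (simp add: algebra_simps)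
    also have "\<dots> = r" by (simp add: h_def) (metis add_nonneg_eq_0_iff norm_ge_zero add.assoc add_nonneg_pos less_numeral_extra(1) less_irrefl)
    finally show ?thesis .
  qed
  have inU: "x + s *\<^sub>R a + t *\<^sub>R b \<in> U" if "s \<in> {0..h}" "t \<in> {0..h}" for s t
    using near[OF that] r r0 by (auto simp: subset_iff dist_commute)
  have inU': "x + s *\<^sub>R b + t *\<^sub>R a \<in> U" if "s \<in> {0..h}" "t \<in> {0..h}" for s t
    using inU[of t s] that by (simp add: algebra_simps)
  obtain s t where st: "s \<in> {0..h}" "t \<in> {0..h}" and
    e1: "f (x + h *\<^sub>R a + h *\<^sub>R b) - f (x + h *\<^sub>R a) - f (x + h *\<^sub>R b) + f x = h^2 * ?p (x + s *\<^sub>R a + t *\<^sub>R b)"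
    using second_difference_mvt[OF h inU f fa] by blast
  obtain s' t' where st': "s' \<in> {0..h}" "t' \<in> {0..h}" and
    e2: "f (x + h *\<^sub>R b + h *\<^sub>R a) - f (x + h *\<^sub>R b) - f (x + h *\<^sub>R a) + f x = h^2 * ?q (x + s' *\<^sub>R b + t' *\<^sub>R a)"
    using second_difference_mvt[OF h inU' f fb] by blast
  have "h^2 * ?p (x + s *\<^sub>R a + t *\<^sub>R b) = h^2 * ?q (x + s' *\<^sub>R b + t' *\<^sub>R a)"
    using e1 e2 by (simp add: algebra_simps)
  then have "?p (x + s *\<^sub>R a + t *\<^sub>R b) = ?q (x + s' *\<^sub>R b + t' *\<^sub>R a)" using h by simp
  moreover have "dist (?p (x + s *\<^sub>R a + t *\<^sub>R b)) (?p x) < \<epsilon>"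
    using near[OF st] inU[OF st] r r1 by auto
  moreover have "dist (?q (x + s' *\<^sub>R b + t' *\<^sub>R a)) (?q x) < \<epsilon>"
    using near[OF st'(2,1)] inU'[OF st'] r r2 by (auto simp: algebra_simps)
  ultimately show False
    unfolding \<epsilon>_def dist_real_def by (smt (verit) field_sum_of_halves)
qed

text \<open>The algebraic core of the Piola identity: the derivatives of \<open>1 / det J\<close> and of \<open>J\<close> contribute
  the same trace, with opposite signs, because the second derivative \<open>H\<close> of the parametrisation is
  symmetric.\<close>

lemma trace_piola_derivative:
  fixes J Ji :: "real^'n::finite^'n" and H :: "real^'n \<Rightarrow> real^'n^'n" and P' :: "real^'n \<Rightarrow> real^'n"
    and p :: "real^'n" and d :: real
  assumes inv: "Ji ** J = mat 1" and H: "linear H" and P': "linear P'"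
    and sym: "\<And>e q. H e *v q = H q *v e"
  defines "W' \<equiv> (\<lambda>e. (1 / d) *\<^sub>R (H e *v p + J *v P' e) - (trace (Ji ** H e) / d) *\<^sub>R (J *v p))"
  shows "trace (matrix W' ** Ji) = trace (matrix P') / d"
proof -
  have JJ: "Ji *v (J *v z) = z" for z by (simp add: matrix_vector_mul_assoc inv)
  have col: "(Ji ** B) $ k $ k = (Ji *v (B *v axis k 1)) $ k" for B :: "real^'n^'n" and k
    by (simp only: matrix_vector_mult_basis)
      (simp add: column_def matrix_vector_mult_def matrix_matrix_mult_def)
  have W: "Ji *v W' e = (1 / d) *\<^sub>R (Ji *v (H p *v e) + P' e) - (trace (Ji ** H e) / d) *\<^sub>R p" for e
    unfolding W'_def
    by (simp add: matrix_vector_mult_diff_distrib matrix_vector_right_distrib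
        matrix_vector_mult_scaleR JJ sym[of e p])
  have m: "matrix W' *v axis k 1 = W' (axis k 1)" for k
    by (simp add: matrix_vector_mult_basis column_def matrix_def vec_eq_iff)
  have lin: "trace (Ji ** H p) = (\<Sum>k\<in>UNIV. p $ k * trace (Ji ** H (axis k 1)))"
  proof -
    have L: "linear (\<lambda>e. trace (Ji ** H e))"
      using H by (auto simp: linear_iff trace_def sum_distrib_left matrix_matrix_mult_def
          algebra_simps sum.distrib)
    have "trace (Ji ** H (\<Sum>k\<in>UNIV. p $ k *\<^sub>R axis k 1))
        = (\<Sum>k\<in>UNIV. p $ k *\<^sub>R trace (Ji ** H (axis k 1)))"
      using linear_sum[OF L, of "\<lambda>k. p $ k *\<^sub>R axis k 1" UNIV] linear_cmul[OF L] by simp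
    moreover have "(\<Sum>k\<in>UNIV. p $ k *\<^sub>R axis k 1) = p"
      by (simp add: vec_eq_iff axis_def sum.delta if_distrib cong: if_cong)
    ultimately show ?thesis by simp
  qed
  have "trace (matrix W' ** Ji) = trace (Ji ** matrix W')" by (rule trace_mul_sym)
  also have "\<dots> = (\<Sum>k\<in>UNIV. (Ji *v W' (axis k 1)) $ k)"
    by (simp add: trace_def col m)
  also have "\<dots> = (\<Sum>k\<in>UNIV. (1 / d) * (Ji *v (H p *v axis k 1)) $ k) + (\<Sum>k\<in>UNIV. (1 / d) * P' (axis k 1) $ k)
      - (\<Sum>k\<in>UNIV. trace (Ji ** H (axis k 1)) / d * p $ k)"
    unfolding W by (simp add: sum.distrib sum_subtractf algebra_simps)
  also have "(\<Sum>k\<in>UNIV. (1 / d) * (Ji *v (H p *v axis k 1)) $ k) = (1 / d) * trace (Ji ** H p)"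
    by (simp only: trace_def col sum_distrib_left)
  also have "(\<Sum>k\<in>UNIV. trace (Ji ** H (axis k 1)) / d * p $ k) = (1 / d) * trace (Ji ** H p)"
    unfolding lin sum_distrib_left by (intro sum.cong) auto
  also have "(\<Sum>k\<in>UNIV. (1 / d) * P' (axis k 1) $ k) = trace (matrix P') / d"
    by (simp add: trace_def matrix_def sum_divide_distrib)
  finally show ?thesis by simp
qed

section \<open>Geometry of the parametrised mesh\<close>

lemma Ck_on_imp_continuous_on: "Ck_on k U f \<Longrightarrow> continuous_on U f"
  by (cases k) (auto simp: continuous_on_eq_continuous_within
      intro: differentiable_imp_continuous_within continuous_at_imp_continuous_at_within)

lemma jacobian_nth: "jacobian a x $ i $ j = dir_deriv (axis j 1) a x $ i"
  by (simp add: jacobian_def matrix_def dir_deriv_def)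

lemma jacobian_works:
  assumes "a differentiable (at x)"
  shows "(a has_derivative (\<lambda>e. jacobian a x *v e)) (at x)"
proof -
  have "(a has_derivative frechet_derivative a (at x)) (at x)"
    using assms by (simp add: frechet_derivative_works)
  moreover have "(\<lambda>e. jacobian a x *v e) = frechet_derivative a (at x)"
    unfolding jacobian_def using linear_frechet_derivative[OF assms] by (simp add: matrix_works fun_eq_iff)
  ultimately show ?thesis by simp
qed

lemma jacobian_eq:
  assumes "(a has_derivative A) (at x)"
  shows "jacobian a x = matrix A"
  using frechet_derivative_at[OF assms] by (simp add: jacobian_def)

lemma dir_deriv_eq: "(a has_derivative A) (at x) \<Longrightarrow> dir_deriv e a x = A e"
  using frechet_derivative_at[of a A x] by (simp add: dir_deriv_def)

lemma knot_interval_exists: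
  fixes \<zeta> :: "nat \<Rightarrow> real"
  assumes "2 \<le> N" "x \<in> {\<zeta> 1..\<zeta> N}"
  shows "\<exists>j\<in>{1..<N}. x \<in> {\<zeta> j..\<zeta> (j + 1)}"
  using assms
proof (induction N rule: nat_induct_at_least)
  case base
  then show ?case by (intro bexI[of _ 1]) (auto simp: numeral_2_eq_2)
next
  case (Suc N)
  show ?case
  proof (cases "x \<le> \<zeta> N")
    case True
    then obtain j where "j \<in> {1..<N}" "x \<in> {\<zeta> j..\<zeta> (j + 1)}" using Suc by auto
    then show ?thesis by (intro bexI[of _ j]) auto
  next
    case False
    then show ?thesis using Suc by (intro bexI[of _ N]) auto
  qed
qed

lemma knots_strict_mono:
  fixes \<zeta> :: "nat \<Rightarrow> real"
  assumes "\<forall>j\<in>{1..<N}. \<zeta> j < \<zeta> (j + 1)" "1 \<le> a" "a < b" "b \<le> N"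
  shows "\<zeta> a < \<zeta> b"
  using assms(3,4)
proof (induction b)
  case (Suc b)
  have step: "\<zeta> b < \<zeta> (Suc b)" using assms(1,2) Suc.prems by auto
  show ?case
  proof (cases "a = b")
    case False
    then have "\<zeta> a < \<zeta> b" using Suc by auto
    with step show ?thesis by simp
  qed (use step in simp)
qed simp

locale iga_mesh =
  fixes D :: "('n::finite) iga" and q :: nat
  assumes adm: "admissible q D"
begin

abbreviation "lo \<equiv> lower D"
abbreviation "up \<equiv> upper D"
abbreviation "F \<equiv> param D"
abbreviation "J \<equiv> jacobian (param D)"
abbreviation "dJ \<equiv> \<lambda>x. det (jacobian (param D) x)"
abbreviation "cell_open m \<equiv> box (cell_lower D m) (cell_upper D m)"
abbreviation "cell_closed m \<equiv> cbox (cell_lower D m) (cell_upper D m)"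
abbreviation "knots i \<equiv> knot D i ` {1..nknots D i}"

definition broken_box :: "(real^'n) set" where
  "broken_box = {x \<in> box lo up. \<forall>j. x $ j \<notin> knots j}"

definition C2_nbhd :: "(real^'n) set" where
  "C2_nbhd = (SOME U. open U \<and> cbox lo up \<subseteq> U \<and> Ck_on (q + 2) U F)"

text \<open>Fields pulled back to one cell extend to \<open>C1\<close> fields on this neighbourhood of the closed box, which
  is what makes them and their derivatives bounded and continuous up to the facets.\<close>

definition reg :: "(real^'n) set" where
  "reg = {x \<in> C2_nbhd. dJ x \<noteq> 0}"

lemma adm_facts:
  shows "2 \<le> nknots D i" "\<forall>j\<in>{1..<nknots D i}. knot D i j < knot D i (j + 1)"
    "\<exists>U. open U \<and> cbox lo up \<subseteq> U \<and> Ck_on (q + 2) U F"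
    "inj_on F (cbox lo up)" "x \<in> cbox lo up \<Longrightarrow> dJ x \<noteq> 0" "0 < meshsize D"
  using adm unfolding admissible_def by blast+

lemma C2_nbhd: "open C2_nbhd" "cbox lo up \<subseteq> C2_nbhd" "Ck_on (q + 2) C2_nbhd F"
proof -
  from someI_ex[OF adm_facts(3)] show "open C2_nbhd" "cbox lo up \<subseteq> C2_nbhd" "Ck_on (q + 2) C2_nbhd F"
    unfolding C2_nbhd_def by blast+
qed

lemma C2_facts:
  shows "x \<in> C2_nbhd \<Longrightarrow> F differentiable (at x)"
    and "x \<in> C2_nbhd \<Longrightarrow> dir_deriv (axis i 1) F differentiable (at x)"
    and "continuous_on C2_nbhd (dir_deriv (axis j 1) (dir_deriv (axis i 1) F))"
proof -
  have C: "Ck_on (Suc (Suc q)) C2_nbhd F" using C2_nbhd(3) by (simp only: add_2_eq_Suc')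
  then show "x \<in> C2_nbhd \<Longrightarrow> F differentiable (at x)" unfolding Ck_on.simps by blast
  have C1: "Ck_on (Suc q) C2_nbhd (dir_deriv (axis i 1) F)" using C unfolding Ck_on.simps(2)[of "Suc q"] by blast
  then show "x \<in> C2_nbhd \<Longrightarrow> dir_deriv (axis i 1) F differentiable (at x)" unfolding Ck_on.simps by blast
  show "continuous_on C2_nbhd (dir_deriv (axis j 1) (dir_deriv (axis i 1) F))"
    using C1 unfolding Ck_on.simps by (intro Ck_on_imp_continuous_on[of q]) blast
qed

text \<open>The derivative of the Jacobian of \<open>F\<close> at \<open>x\<close> in direction \<open>e\<close>.\<close>

definition hess :: "real^'n \<Rightarrow> real^'n \<Rightarrow> real^'n^'n" where
  "hess x e = (\<chi> i j. dir_deriv e (dir_deriv (axis j 1) F) x $ i)"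

lemma hess_has_derivative_aux:
  assumes "x \<in> C2_nbhd"
  shows "(J has_derivative hess x) (at x)"
proof (intro has_derivative_vecI)
  fix i j
  have "(dir_deriv (axis j 1) F has_derivative frechet_derivative (dir_deriv (axis j 1) F) (at x)) (at x)"
    using C2_facts(2)[OF assms, of j] by (simp add: frechet_derivative_works)
  from bounded_linear.has_derivative[OF bounded_linear_vec_nth this, of i]
  show "((\<lambda>x. J x $ i $ j) has_derivative (\<lambda>e. hess x e $ i $ j)) (at x)"
    by (simp add: jacobian_nth hess_def dir_deriv_def)
qed

lemma J_continuous_aux: "continuous_on C2_nbhd J"
  by (intro continuous_at_imp_continuous_on ballI has_derivative_continuous[OF hess_has_derivative_aux])

lemma reg_open: "open reg"
proof -
  have "continuous_on C2_nbhd dJ" by (intro continuous_on_det J_continuous_aux)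
  then have "open (dJ -` (- {0}) \<inter> C2_nbhd)"
    using C2_nbhd(1) continuous_on_open_vimage[OF C2_nbhd(1), of dJ] by auto
  also have "dJ -` (- {0}) \<inter> C2_nbhd = reg" by (auto simp: reg_def)
  finally show ?thesis .
qed

lemma cbox_reg: "cbox lo up \<subseteq> reg"
  using adm_facts(5) C2_nbhd(2) by (auto simp: reg_def)

lemma dJ_nz: "x \<in> reg \<Longrightarrow> dJ x \<noteq> 0"
  by (simp add: reg_def)

lemma F_derivative: "x \<in> reg \<Longrightarrow> (F has_derivative (\<lambda>e. J x *v e)) (at x)"
  by (intro jacobian_works C2_facts) (simp add: reg_def)

lemma F_continuous: "continuous_on reg F"
  by (intro continuous_at_imp_continuous_on ballI has_derivative_continuous[OF F_derivative])

lemma J_derivative: "x \<in> reg \<Longrightarrow> (J has_derivative hess x) (at x)"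
  by (intro hess_has_derivative_aux) (simp add: reg_def)

lemma J_continuous: "continuous_on reg J"
  by (rule continuous_on_subset[OF J_continuous_aux]) (auto simp: reg_def)

lemma dJ_continuous: "continuous_on reg dJ"
  by (intro continuous_on_det J_continuous)

lemma J_inv_continuous: "continuous_on reg (\<lambda>x. matrix_inv (J x))"
  by (intro continuous_on_matrix_inv J_continuous) (simp add: reg_def)

lemma hess_linear: "x \<in> reg \<Longrightarrow> linear (hess x)"
  by (rule has_derivative_linear[OF J_derivative])

lemma hess_expand:
  assumes "x \<in> reg"
  shows "hess x e = (\<Sum>k\<in>UNIV. e $ k *\<^sub>R hess x (axis k 1))"
proof -
  have "(\<Sum>k\<in>UNIV. e $ k *\<^sub>R axis k 1) = e"
    by (simp add: vec_eq_iff axis_def sum.delta if_distrib cong: if_cong)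
  then show ?thesis
    using linear_sum[OF hess_linear[OF assms], of "\<lambda>k. e $ k *\<^sub>R axis k 1" UNIV]
      linear_cmul[OF hess_linear[OF assms]] by simp
qed

lemma hess_continuous: "continuous_on reg (\<lambda>x. hess x e)"
proof -
  have "continuous_on reg (\<lambda>x. \<Sum>k\<in>UNIV. e $ k *\<^sub>R hess x (axis k 1))"
  proof (intro continuous_on_sum continuous_on_scaleR continuous_on_const, intro continuous_on_vecI)
    fix k i j
    have "continuous_on reg (dir_deriv (axis k 1) (dir_deriv (axis j 1) F))"
      by (rule continuous_on_subset[OF C2_facts(3)]) (auto simp: reg_def)
    then show "continuous_on reg (\<lambda>x. hess x (axis k 1) $ i $ j)"
      unfolding hess_def by (simp add: continuous_on_component)
  qed
  then show ?thesis using hess_expand[of _ e] by (simp cong: continuous_on_cong)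
qed

lemma hess_sym:
  assumes x: "x \<in> reg"
  shows "hess x e *v p = hess x p *v e"
proof -
  have ax: "hess x (axis k 1) $ i $ j = hess x (axis j 1) $ i $ k" for i j k
  proof -
    have comp: "dir_deriv b (\<lambda>z. g z $ i) z = dir_deriv b g z $ i"
      if "g differentiable (at z)" for g :: "real^'n \<Rightarrow> real^'n" and b z
    proof -
      have "(g has_derivative frechet_derivative g (at z)) (at z)"
        using that by (simp add: frechet_derivative_works)
      from dir_deriv_eq[OF bounded_linear.has_derivative[OF bounded_linear_vec_nth this]]
      show ?thesis by (simp add: dir_deriv_def)
    qed
    have dcomp: "(\<lambda>z. g z $ i) differentiable (at z)" if "g differentiable (at z)"
      for g :: "real^'n \<Rightarrow> real^'n" and z
      using that bounded_linear.has_derivative[OF bounded_linear_vec_nth]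
      unfolding differentiable_def by blast
    define f where "f = (\<lambda>z. F z $ i)"
    have df: "dir_deriv (axis k 1) f z = dir_deriv (axis k 1) F z $ i" if "z \<in> reg" for z k
      unfolding f_def using that by (intro comp C2_facts) (simp add: reg_def)
    have Dd: "(dir_deriv (axis k 1) f has_derivative
         (\<lambda>e. frechet_derivative (dir_deriv (axis k 1) F) (at z) e $ i)) (at z)" if z: "z \<in> reg" for z k
    proof -
      have "(dir_deriv (axis k 1) F has_derivative frechet_derivative (dir_deriv (axis k 1) F) (at z)) (at z)"
        using C2_facts(2)[of z k] z by (simp add: frechet_derivative_works reg_def)
      from bounded_linear.has_derivative[OF bounded_linear_vec_nth this, of i]
      show ?thesis
        by (rule has_derivative_transform_within_open[OF _ reg_open z]) (simp add: df)
    qed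
    have dd: "dir_deriv (axis j 1) (dir_deriv (axis k 1) f) z = hess z (axis j 1) $ i $ k" if "z \<in> reg" for z j k
      using dir_deriv_eq[OF Dd[OF that]] by (simp add: hess_def dir_deriv_def)
    have cts: "continuous_on reg (dir_deriv (axis j 1) (dir_deriv (axis k 1) f))" for j k
    proof -
      have "continuous_on reg (\<lambda>z. hess z (axis j 1) $ i $ k)"
        using hess_continuous by (intro continuous_intros)
      then show ?thesis using dd by (simp cong: continuous_on_cong)
    qed
    have "dir_deriv (axis k 1) (dir_deriv (axis j 1) f) x = dir_deriv (axis j 1) (dir_deriv (axis k 1) f) x"
    proof (rule mixed_dir_derivs_commute[OF reg_open x])
      show "f differentiable (at z)" if "z \<in> reg" for z
        unfolding f_def using that by (intro dcomp C2_facts) (simp add: reg_def)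
      show "dir_deriv (axis j 1) f differentiable (at z)" if "z \<in> reg" for z j
        using Dd[OF that] unfolding differentiable_def by blast
      show "dir_deriv (axis k 1) f differentiable (at z)" if "z \<in> reg" for z
        using Dd[OF that] unfolding differentiable_def by blast
    qed (rule cts)+
    then show ?thesis using dd x by simp
  qed
  have "(hess x e *v p) $ i = (hess x p *v e) $ i" for i
  proof -
    have "(hess x e *v p) $ i = (\<Sum>j\<in>UNIV. \<Sum>k\<in>UNIV. e $ k * hess x (axis k 1) $ i $ j * p $ j)" for e p
      by (subst hess_expand[OF x]) (simp add: matrix_vector_mult_def sum_distrib_right)
    moreover have "(\<Sum>j\<in>UNIV. \<Sum>k\<in>UNIV. e $ k * hess x (axis k 1) $ i $ j * p $ j)
        = (\<Sum>j\<in>UNIV. \<Sum>k\<in>UNIV. p $ k * hess x (axis k 1) $ i $ j * e $ j)"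
      by (subst sum.swap) (auto intro!: sum.cong simp: ax[of _ i])
    ultimately show ?thesis by simp
  qed
  then show ?thesis by (simp add: vec_eq_iff)
qed

lemma nknots_ge: "2 \<le> nknots D i"
  by (rule adm_facts)

lemma knot_less:
  assumes "1 \<le> a" "a < b" "b \<le> nknots D i"
  shows "knot D i a < knot D i b"
  by (rule knots_strict_mono[OF adm_facts(2) assms])

lemma knot_le:
  assumes "1 \<le> a" "a \<le> b" "b \<le> nknots D i"
  shows "knot D i a \<le> knot D i b"
  using knot_less[of a b i] assms by (cases "a = b") auto

lemma lo_less_up: "lo $ i < up $ i"
  using knot_less[of 1 "nknots D i" i] nknots_ge[of i] by (simp add: lower_def upper_def)

lemma F_inj: "inj_on F (cbox lo up)"
  by (rule adm_facts)

lemma F_continuous_cbox: "continuous_on (cbox lo up) F"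
  by (rule continuous_on_subset[OF F_continuous cbox_reg])

lemma box_reg: "box lo up \<subseteq> reg"
  using cbox_reg box_subset_cbox by blast

lemma open_image: "open S \<Longrightarrow> S \<subseteq> box lo up \<Longrightarrow> open (F ` S)"
  by (intro invariance_of_domain continuous_on_subset[OF F_continuous_cbox] inj_on_subset[OF F_inj])
     (use box_subset_cbox in blast)+

lemma Omega_open: "open (Omega D)"
  unfolding Omega_def by (rule open_image) auto

lemma cell_bounds:
  assumes "m \<in> cells D"
  shows "lo $ i \<le> cell_lower D m $ i" "cell_lower D m $ i < cell_upper D m $ i" "cell_upper D m $ i \<le> up $ i"
proof -
  have m: "1 \<le> m i" "m i + 1 \<le> nknots D i" using assms by (auto simp: cells_def Suc_le_eq)
  show "lo $ i \<le> cell_lower D m $ i" "cell_lower D m $ i < cell_upper D m $ i" "cell_upper D m $ i \<le> up $ i"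
    using knot_le[of 1 "m i" i] knot_less[of "m i" "m i + 1" i] knot_le[of "m i + 1" "nknots D i" i] m
    by (auto simp: lower_def upper_def cell_lower_def cell_upper_def)
qed

lemma cell_closed_subset:
  assumes "m \<in> cells D"
  shows "cell_closed m \<subseteq> cbox lo up"
proof
  fix x assume x: "x \<in> cell_closed m"
  have "lo $ i \<le> x $ i \<and> x $ i \<le> up $ i" for i
  proof -
    have "cell_lower D m $ i \<le> x $ i" "x $ i \<le> cell_upper D m $ i"
      using x by (auto simp only: mem_box_cart)
    with cell_bounds[OF assms, of i] show ?thesis by linarith
  qed
  then show "x \<in> cbox lo up" by (simp add: mem_box_cart)
qed

lemma cell_open_subset:
  assumes "m \<in> cells D"
  shows "cell_open m \<subseteq> box lo up"
proof
  fix x assume x: "x \<in> cell_open m"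
  have "lo $ i < x $ i \<and> x $ i < up $ i" for i
  proof -
    have "cell_lower D m $ i < x $ i" "x $ i < cell_upper D m $ i"
      using x by (auto simp only: mem_box_cart)
    with cell_bounds[OF assms, of i] show ?thesis by linarith
  qed
  then show "x \<in> box lo up" by (simp add: mem_box_cart)
qed

lemma element_open: "m \<in> cells D \<Longrightarrow> open (element D m)"
  unfolding element_def by (intro open_image cell_open_subset) auto

lemma element_subset: "m \<in> cells D \<Longrightarrow> element D m \<subseteq> Omega D"
  unfolding element_def Omega_def using cell_open_subset by blast

lemma finite_cells: "finite (cells D)"
proof (rule finite_subset)
  show "cells D \<subseteq> Pi\<^sub>E UNIV (\<lambda>i. {..nknots D i})" by (auto simp: cells_def less_imp_le)
  show "finite (Pi\<^sub>E UNIV (\<lambda>i::'n. {..nknots D i}))" by (intro finite_PiE) auto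
qed

lemma cell_locate:
  assumes "x \<in> cbox lo up"
  obtains m where "m \<in> cells D" "x \<in> cell_closed m"
proof -
  have "\<exists>j\<in>{1..<nknots D i}. x $ i \<in> {knot D i j..knot D i (j + 1)}" for i
    using assms by (intro knot_interval_exists[OF nknots_ge]) (auto simp: mem_box_cart lower_def upper_def)
  then obtain m where "\<And>i. m i \<in> {1..<nknots D i} \<and> x $ i \<in> {knot D i (m i)..knot D i (m i + 1)}"
    by metis
  then show ?thesis
    by (intro that[of m]) (auto simp: cells_def mem_box_cart cell_lower_def cell_upper_def)
qed

lemma cell_knot_free:
  assumes "m \<in> cells D" "knot D i (m i) < t" "t < knot D i (m i + 1)"
  shows "t \<notin> knots i"
proof
  assume "t \<in> knots i"
  then obtain j where j: "1 \<le> j" "j \<le> nknots D i" "t = knot D i j" by auto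
  have m: "1 \<le> m i" "m i + 1 \<le> nknots D i" using assms(1) by (auto simp: cells_def Suc_le_eq)
  show False
    using assms(2,3) j m knot_le[of j "m i" i] knot_le[of "m i + 1" j i] by (cases "j \<le> m i") auto
qed

lemma broken_box_eq: "broken_box = (\<Union>m\<in>cells D. cell_open m)"
proof (intro equalityI subsetI)
  fix x assume x: "x \<in> broken_box"
  then have "x \<in> cbox lo up" using box_subset_cbox by (auto simp: broken_box_def)
  then obtain m where m: "m \<in> cells D" "x \<in> cell_closed m" by (rule cell_locate)
  have ne: "x $ i \<noteq> knot D i (m i) \<and> x $ i \<noteq> knot D i (m i + 1)" for i
  proof -
    have "m i \<in> {1..nknots D i}" "m i + 1 \<in> {1..nknots D i}" using m(1) by (auto simp: cells_def Suc_le_eq less_imp_le)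
    then have "knot D i (m i) \<in> knots i" "knot D i (m i + 1) \<in> knots i" by blast+
    then show ?thesis using x unfolding broken_box_def by (metis (no_types, lifting) mem_Collect_eq)
  qed
  have "knot D i (m i) < x $ i \<and> x $ i < knot D i (m i + 1)" for i
  proof -
    have "knot D i (m i) \<le> x $ i" "x $ i \<le> knot D i (m i + 1)"
      using m(2) by (auto simp: mem_box_cart cell_lower_def cell_upper_def)
    with ne[of i] show ?thesis by linarith
  qed
  then have "x \<in> cell_open m"
    by (simp add: mem_box_cart cell_lower_def cell_upper_def)
  then show "x \<in> (\<Union>m\<in>cells D. cell_open m)" using m by blast
next
  fix x assume "x \<in> (\<Union>m\<in>cells D. cell_open m)"
  then obtain m where m: "m \<in> cells D" "x \<in> cell_open m" by blast
  then show "x \<in> broken_box"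
  proof -
    have "x \<in> box lo up" using cell_open_subset[OF m(1)] m(2) by blast
    moreover have "x $ j \<notin> knots j" for j
      using m(2) by (intro cell_knot_free[OF m(1)]) (auto simp: mem_box_cart cell_lower_def cell_upper_def)
    ultimately show ?thesis by (simp add: broken_box_def)
  qed
qed

lemma cells_disjoint:
  assumes "m \<in> cells D" "m' \<in> cells D" "x \<in> cell_open m" "x \<in> cell_open m'"
  shows "m = m'"
proof
  fix i
  have "knot D i (m i) < x $ i" "x $ i < knot D i (m i + 1)" "knot D i (m' i) < x $ i" "x $ i < knot D i (m' i + 1)"
    using assms(3,4) by (auto simp: mem_box_cart cell_lower_def cell_upper_def)
  moreover have "1 \<le> m i" "m i + 1 \<le> nknots D i" "1 \<le> m' i" "m' i + 1 \<le> nknots D i"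
    using assms(1,2) by (auto simp: cells_def Suc_le_eq)
  ultimately show "m i = m' i"
    using knot_le[of "m i + 1" "m' i" i] knot_le[of "m' i + 1" "m i" i]
    by (cases "m i" "m' i" rule: linorder_cases) auto
qed

lemma broken_box_open: "open broken_box"
  unfolding broken_box_eq by auto

lemma broken_box_subset: "broken_box \<subseteq> box lo up"
  by (auto simp: broken_box_def)

lemma cell_subset_broken_box: "m \<in> cells D \<Longrightarrow> cell_open m \<subseteq> broken_box"
  unfolding broken_box_eq by blast

lemma negligible_skeleton: "negligible (box lo up - broken_box)"
proof (rule negligible_subset)
  show "box lo up - broken_box \<subseteq> (\<Union>j. \<Union>c\<in>knots j. {x. x $ j = c})"
    by (auto simp: broken_box_def)
  show "negligible (\<Union>j. \<Union>c\<in>knots j. {x::real^'n. x $ j = c})"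
  proof -
    have hyp: "negligible {x::real^'n. x $ j = c}" for j c
      using negligible_standard_hyperplane[of "axis j 1 :: real^'n" c] axis_in_Basis_iff[of j "1::real"]
      by (simp add: inner_axis)
    show ?thesis by (intro negligible_Union finite_imageI) (auto intro!: negligible_Union hyp)
  qed
qed

lemma negligible_image:
  assumes "negligible N" "N \<subseteq> reg"
  shows "negligible (F ` N)"
proof (rule negligible_differentiable_image_negligible[OF _ assms(1)])
  show "F differentiable_on N"
    using F_derivative assms(2)
    by (auto simp: differentiable_on_def differentiable_def intro: has_derivative_at_withinI)
qed simp

definition Fi :: "real^'n \<Rightarrow> real^'n" where
  "Fi = inv_into (cbox lo up) F"

lemma Fi_F [simp]: "x \<in> cbox lo up \<Longrightarrow> Fi (F x) = x"
  unfolding Fi_def by (rule inv_into_f_f[OF F_inj])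

lemma Fi_F_box [simp]: "x \<in> box lo up \<Longrightarrow> Fi (F x) = x"
  using Fi_F box_subset_cbox by blast

lemma Fi_continuous: "continuous_on (F ` cbox lo up) Fi"
  by (rule continuous_on_inv[OF F_continuous_cbox]) auto

lemma Fi_derivative:
  assumes x: "x \<in> box lo up"
  shows "(Fi has_derivative (\<lambda>e. matrix_inv (J x) *v e)) (at (F x))"
proof (rule has_derivative_inverse_strong[where S="box lo up" and f=F and x=x and f'="\<lambda>e. J x *v e"])
  have r: "x \<in> reg" using x box_reg by blast
  show "continuous_on (box lo up) F" by (rule continuous_on_subset[OF F_continuous box_reg])
  show "(F has_derivative (\<lambda>e. J x *v e)) (at x)" by (rule F_derivative[OF r])
  show "(\<lambda>e. J x *v e) \<circ> (\<lambda>e. matrix_inv (J x) *v e) = id"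
    using matrix_inv_vector_mul(1)[OF dJ_nz[OF r]] by auto
qed (use x in auto)

text \<open>The parametrisation is a homeomorphism of the closed box onto its image, so approaching \<open>F x\<close> within
  the domain means approaching \<open>x\<close> within the open box. The open set \<open>T\<close> localises to one cell, where
  piecewise fields have a continuous description.\<close>

lemma limit_from_pullback:
  assumes x: "x \<in> cbox lo up" and T: "open T" "x \<in> T"
    and g: "(g \<longlongrightarrow> L) (at x within box lo up \<inter> T)"
    and eq: "\<And>z. z \<in> box lo up \<inter> T \<Longrightarrow> \<phi> (F z) = g z"
  shows "limit_from (Omega D) \<phi> (F x) = L"
proof -
  have OF: "Omega D \<subseteq> F ` cbox lo up"
    unfolding Omega_def using box_subset_cbox by blast
  have "(Fi \<longlongrightarrow> Fi (F x)) (at (F x) within F ` cbox lo up)"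
    using Fi_continuous x by (auto simp: continuous_on_def)
  then have Fx: "(Fi \<longlongrightarrow> x) (at (F x) within Omega D)"
    using x tendsto_within_subset[OF _ OF] by auto
  have inO: "\<forall>\<^sub>F y in at (F x) within Omega D. y \<in> Omega D \<and> y \<noteq> F x"
    by (auto simp: eventually_at_filter)
  have ev: "\<forall>\<^sub>F y in at (F x) within Omega D. Fi y \<in> box lo up \<inter> T \<and> Fi y \<noteq> x \<and> F (Fi y) = y"
    using inO topological_tendstoD[OF Fx T]
  proof eventually_elim
    case (elim y)
    then obtain z where "z \<in> box lo up" "y = F z" by (auto simp: Omega_def)
    with elim show ?case by auto
  qed
  have "filterlim Fi (at x within box lo up \<inter> T) (at (F x) within Omega D)"
    unfolding filterlim_at using Fx ev by (auto elim: eventually_mono)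
  from filterlim_compose[OF g this]
  have "((\<lambda>y. g (Fi y)) \<longlongrightarrow> L) (at (F x) within Omega D)" .
  moreover have "\<forall>\<^sub>F y in at (F x) within Omega D. g (Fi y) = \<phi> y"
    using ev by eventually_elim (metis eq)
  ultimately have lim: "(\<phi> \<longlongrightarrow> L) (at (F x) within Omega D)"
    by (rule tendsto_cong[THEN iffD1, rotated])
  have "F x \<in> closure (Omega D)"
  proof -
    have "box lo up \<noteq> {}" using lo_less_up by (auto simp: interval_ne_empty_cart)
    then have "x \<in> closure (box lo up)" using x by simp
    then have "F x \<in> F ` closure (box lo up)" by blast
    also have "\<dots> \<subseteq> closure (F ` box lo up)"
      using F_continuous_cbox \<open>box lo up \<noteq> {}\<close>
      by (intro image_closure_subset closure_subset) auto
    finally show ?thesis by (simp add: Omega_def)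
  qed
  then have "F x islimpt Omega D"
    using Omega_open interior_limit_point[of "F x" "Omega D"]
    by (cases "F x \<in> Omega D") (auto simp: interior_open closure_def)
  then have nb: "at (F x) within Omega D \<noteq> bot" by (simp add: trivial_limit_within)
  show ?thesis
    unfolding limit_from_def by (rule tendsto_Lim[OF nb lim])
qed

end

section \<open>Splines as piecewise polynomials\<close>

text \<open>The pieces are prescribed on half-open intervals. Matching of values at an interior knot extends each
  piece to its right end point; only the value at the last knot has to be redefined.\<close>

lemma spline_closed_pieces:
  fixes \<zeta> :: "nat \<Rightarrow> real"
  assumes s: "s \<in> spline_space \<zeta> N k \<alpha>" and \<alpha>: "\<And>j. 0 \<le> \<alpha> j" and N: "2 \<le> N"
    and \<zeta>: "\<forall>j\<in>{1..<N}. \<zeta> j < \<zeta> (j + 1)"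
  shows "\<exists>s' p. (\<forall>x. x < \<zeta> N \<longrightarrow> s' x = s x) \<and>
     (\<forall>j\<in>{1..<N}. degree (p j) \<le> k \<and> (\<forall>x\<in>{\<zeta> j..\<zeta> (j + 1)}. s' x = poly (p j) x))"
proof -
  obtain p :: "nat \<Rightarrow> real poly" where
    p: "\<And>j. j \<in> {1..<N} \<Longrightarrow> degree (p j) \<le> k \<and> (\<forall>x\<in>{\<zeta> j..<\<zeta> (j + 1)}. s x = poly (p j) x)" and
    match: "\<And>j m. j \<in> {2..<N} \<Longrightarrow> int m \<le> \<alpha> j \<Longrightarrow>
       poly ((pderiv ^^ m) (p (j - 1))) (\<zeta> j) = poly ((pderiv ^^ m) (p j)) (\<zeta> j)"
    using s unfolding spline_space_def by blast
  define s' where "s' x = (if x < \<zeta> N then s x else poly (p (N - 1)) x)" for x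
  have eq: "s' x = poly (p j) x" if j: "j \<in> {1..<N}" and x: "x \<in> {\<zeta> j..\<zeta> (j + 1)}" for j x
  proof (cases "x < \<zeta> (j + 1)")
    case True
    have "\<zeta> (j + 1) \<le> \<zeta> N"
      using knots_strict_mono[OF \<zeta>, of "j + 1" N] j by (cases "j + 1 = N") auto
    then show ?thesis using True p[OF j] x by (auto simp: s'_def)
  next
    case False
    with x have x: "x = \<zeta> (j + 1)" by auto
    show ?thesis
    proof (cases "j + 1 < N")
      case True
      then have "x < \<zeta> N" using knots_strict_mono[OF \<zeta>, of "j + 1" N] x by auto
      moreover have "\<zeta> (j + 1) < \<zeta> (j + 1 + 1)" using True by (intro \<zeta>[rule_format]) auto
      ultimately have "s' x = poly (p (j + 1)) x"
        using p[of "j + 1"] True x by (auto simp: s'_def)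
      moreover have "poly (p j) x = poly (p (j + 1)) x"
        using match[of "j + 1" 0] True j \<alpha> x by auto
      ultimately show ?thesis by simp
    next
      case False
      then have "j + 1 = N" using j by auto
      then show ?thesis using x by (auto simp: s'_def)
    qed
  qed
  show ?thesis
    using eq p by (intro exI[of _ s'] exI[of _ p]) (auto simp: s'_def)
qed

abbreviation multi_degrees :: "nat \<Rightarrow> ('n::finite \<Rightarrow> nat) set" where
  "multi_degrees k \<equiv> Pi\<^sub>E UNIV (\<lambda>_. {..k + 1})"

definition monomial :: "('n::finite \<Rightarrow> nat) \<Rightarrow> real^'n \<Rightarrow> real" where
  "monomial r x = (\<Prod>i\<in>UNIV. x $ i ^ r i)"

lemma finite_multi_degrees: "finite (multi_degrees k :: ('n::finite \<Rightarrow> nat) set)"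
  by (intro finite_PiE) auto

lemma prod_poly_eq_monomials:
  fixes p :: "'n::finite \<Rightarrow> real poly"
  assumes "\<And>i. degree (p i) \<le> k + 1"
  shows "(\<Prod>i\<in>UNIV. poly (p i) (x $ i)) =
    (\<Sum>r\<in>multi_degrees k. (\<Prod>i\<in>UNIV. coeff (p i) (r i)) * monomial r x)"
proof -
  have "poly (p i) t = (\<Sum>r\<le>k + 1. coeff (p i) r * t ^ r)" for i t
    unfolding poly_altdef
    by (rule sum.mono_neutral_left) (use assms[of i] in \<open>auto intro!: coeff_eq_0\<close>)
  then have "(\<Prod>i\<in>UNIV. poly (p i) (x $ i)) = (\<Prod>i\<in>UNIV. \<Sum>r\<in>{..k + 1}. coeff (p i) r * (x $ i) ^ r)"
    by simp
  also have "\<dots> = (\<Sum>r\<in>multi_degrees k. \<Prod>i\<in>UNIV. coeff (p i) (r i) * (x $ i) ^ r i)"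
    by (rule prod_sum_PiE) auto
  finally show ?thesis by (simp add: monomial_def prod.distrib)
qed

context iga_mesh
begin

text \<open>On every closed cell the pulled back velocity is one polynomial field, of degree at most \<open>k + 1\<close> in
  each variable. The adjacent polynomials agree on common facets because \<open>U\<close> is one function.\<close>

lemma velocity_pullback:
  assumes v: "v \<in> velocity_space D k q"
  obtains U a where "\<And>x. x \<in> box lo up \<Longrightarrow> piola D v x = U x"
    "\<And>m x. m \<in> cells D \<Longrightarrow> x \<in> cell_closed m \<Longrightarrow>
       U x = (\<Sum>r\<in>multi_degrees k. monomial r x *\<^sub>R (a m r :: real^'n))"
proof -
  define kk where "kk j i = (if i = j then k + 1 else k)" for j i :: 'n
  define al where "al j = (\<lambda>(i::'n) (_::nat). if i = j then int q + 1 else int q)" for j :: 'n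
  have "\<forall>j. \<exists>L s. (\<forall>l<(L::nat). \<forall>i. s l i \<in> spline_space (knot D i) (nknots D i) (kk j i) (al j i)) \<and>
        (\<forall>x\<in>box lo up. piola D v x $ j = (\<Sum>l<L. \<Prod>i\<in>UNIV. s l i (x $ i)))"
    using v unfolding velocity_space_def tensor_spline_space_def kk_def al_def by blast
  from choice[OF this] obtain L where "\<forall>j. \<exists>s. (\<forall>l<(L j::nat). \<forall>i. s l i \<in> spline_space (knot D i) (nknots D i) (kk j i) (al j i)) \<and>
        (\<forall>x\<in>box lo up. piola D v x $ j = (\<Sum>l<L j. \<Prod>i\<in>UNIV. s l i (x $ i)))" ..
  from choice[OF this] obtain s where "\<forall>j. (\<forall>l<(L j::nat). \<forall>i. s j l i \<in> spline_space (knot D i) (nknots D i) (kk j i) (al j i)) \<and>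
        (\<forall>x\<in>box lo up. piola D v x $ j = (\<Sum>l<L j. \<Prod>i\<in>UNIV. s j l i (x $ i)))" ..
  then have
    s: "\<And>j l i. l < L j \<Longrightarrow> s j l i \<in> spline_space (knot D i) (nknots D i) (kk j i) (al j i)" and
    pi: "\<And>j x. x \<in> box lo up \<Longrightarrow> piola D v x $ j = (\<Sum>l<(L j::nat). \<Prod>i\<in>UNIV. s j l i (x $ i))"
    by blast+
  have kn: "\<forall>j\<in>{1..<nknots D i}. knot D i j < knot D i (j + 1)" for i
    by (rule adm_facts)
  define Q where "Q j l i s' p \<longleftrightarrow> (\<forall>x. x < up $ i \<longrightarrow> s' x = s j l i x) \<and>
     (\<forall>c\<in>{1..<nknots D i}. degree (p c) \<le> k + 1 \<and> (\<forall>x\<in>{knot D i c..knot D i (c + 1)}. s' x = poly (p c) x))"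
    for j l i and s' :: "real \<Rightarrow> real" and p :: "nat \<Rightarrow> real poly"
  define sp where "sp j l i = (SOME sp. Q j l i (fst sp) (snd sp))" for j l i
  define s' where "s' j l i = fst (sp j l i)" for j l i
  define p where "p j l i = snd (sp j l i)" for j l i
  have "Q j l i (s' j l i) (p j l i)" if True: "l < L j" for j l i
  proof -
    have al0: "0 \<le> al j i c" for c by (simp add: al_def)
    obtain s1 p1 where "\<forall>x. x < knot D i (nknots D i) \<longrightarrow> s1 x = s j l i x"
      "\<forall>c\<in>{1..<nknots D i}. degree (p1 c) \<le> kk j i \<and> (\<forall>x\<in>{knot D i c..knot D i (c + 1)}. s1 x = poly (p1 c) x)"
      using spline_closed_pieces[OF s[OF True, of i] al0 nknots_ge kn[of i]] by blast
    moreover have "kk j i \<le> k + 1" by (simp add: kk_def)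
    ultimately have "Q j l i (fst (s1, p1)) (snd (s1, p1))"
      unfolding Q_def by (auto simp: lower_def upper_def intro: order_trans)
    then show ?thesis unfolding s'_def p_def sp_def by (rule someI)
  qed
  then have
    e: "\<And>j l i x. l < L j \<Longrightarrow> x < up $ i \<Longrightarrow> s' j l i x = s j l i x" and
    d: "\<And>j l i c. l < L j \<Longrightarrow> c \<in> {1..<nknots D i} \<Longrightarrow> degree (p j l i c) \<le> k + 1" and
    pp: "\<And>j l i c x. l < L j \<Longrightarrow> c \<in> {1..<nknots D i} \<Longrightarrow> x \<in> {knot D i c..knot D i (c + 1)} \<Longrightarrow>
       s' j l i x = poly (p j l i c) x"
    unfolding Q_def by blast+
  define U :: "real^'n \<Rightarrow> real^'n" where "U x = (\<chi> j. \<Sum>l<L j. \<Prod>i\<in>UNIV. s' j l i (x $ i))" for x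
  define a :: "('n \<Rightarrow> nat) \<Rightarrow> ('n \<Rightarrow> nat) \<Rightarrow> real^'n"
    where "a m r = (\<chi> j. \<Sum>l<L j. \<Prod>i\<in>UNIV. coeff (p j l i (m i)) (r i))" for m r
  show ?thesis
  proof
    show "piola D v x = U x" if "x \<in> box lo up" for x
      using that by (auto simp: vec_eq_iff pi U_def mem_box_cart e intro!: sum.cong prod.cong)
    fix m x assume m: "m \<in> cells D" and x: "x \<in> cell_closed m"
    have mi: "m i \<in> {1..<nknots D i}" "x $ i \<in> {knot D i (m i)..knot D i (m i + 1)}" for i
      using m x by (auto simp: cells_def mem_box_cart cell_lower_def cell_upper_def)
    have "U x $ j = (\<Sum>r\<in>multi_degrees k. monomial r x *\<^sub>R a m r) $ j" for j
    proof -
      have "U x $ j = (\<Sum>l<L j. \<Prod>i\<in>UNIV. poly (p j l i (m i)) (x $ i))"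
        unfolding U_def using pp mi by (auto intro!: sum.cong prod.cong)
      also have "\<dots> = (\<Sum>l<L j. \<Sum>r\<in>multi_degrees k. (\<Prod>i\<in>UNIV. coeff (p j l i (m i)) (r i)) * monomial r x)"
        using d mi by (intro sum.cong prod_poly_eq_monomials) auto
      also have "\<dots> = (\<Sum>r\<in>multi_degrees k. monomial r x * a m r $ j)"
        by (subst sum.swap) (simp add: a_def sum_distrib_left mult.commute)
      finally show ?thesis by simp
    qed
    then show "U x = (\<Sum>r\<in>multi_degrees k. monomial r x *\<^sub>R a m r)" by (simp add: vec_eq_iff)
  qed
qed

end

section \<open>Piecewise smooth fields on the parametric box\<close>

lemma bounded_bilinear_matrix_vector_mult:
  "bounded_bilinear (\<lambda>(A::real^'n::finite^'m::finite) x. A *v x)"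
proof -
  have "bilinear (\<lambda>(A::real^'n^'m) x. A *v x)"
    unfolding bilinear_def
    by (auto simp: linear_iff matrix_vector_mult_def vec_eq_iff sum.distrib sum_distrib_left algebra_simps)
  then show ?thesis by (simp add: bilinear_conv_bounded_bilinear)
qed

lemma bounded_bilinear_matrix_mult:
  "bounded_bilinear (\<lambda>(A::real^'n::finite^'m::finite) (B::real^'k::finite^'n). A ** B)"
proof -
  have "bilinear (\<lambda>(A::real^'n^'m) (B::real^'k^'n). A ** B)"
    unfolding bilinear_def
    by (auto simp: linear_iff matrix_matrix_mult_def vec_eq_iff sum.distrib sum_distrib_left algebra_simps)
  then show ?thesis by (simp add: bilinear_conv_bounded_bilinear)
qed

lemma continuous_on_trace:
  fixes A :: "'a::topological_space \<Rightarrow> real^'n::finite^'n"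
  shows "continuous_on S A \<Longrightarrow> continuous_on S (\<lambda>x. trace (A x))"
  unfolding trace_def by (intro continuous_on_sum continuous_on_component)

definition monomial_deriv :: "('n::finite \<Rightarrow> nat) \<Rightarrow> real^'n \<Rightarrow> real^'n \<Rightarrow> real" where
  "monomial_deriv r x e = (\<Sum>i\<in>UNIV. (real (r i) * x $ i ^ (r i - 1) * e $ i) * (\<Prod>j\<in>UNIV - {i}. x $ j ^ r j))"

lemma monomial_derivative: "(monomial r has_derivative monomial_deriv r x) (at x)"
proof -
  have nth: "((\<lambda>x. x $ i) has_derivative (\<lambda>e. e $ i)) (at x)" for i and x :: "real^'a"
    by (rule bounded_linear_imp_has_derivative[OF bounded_linear_vec_nth])
  have pow: "((\<lambda>x. x $ i ^ r i) has_derivative (\<lambda>e. real (r i) * x $ i ^ (r i - 1) * e $ i)) (at x)" for i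
    using has_derivative_power[OF nth[of i x], of "r i"] by (simp add: mult_ac)
  show ?thesis
    unfolding monomial_def[abs_def] monomial_deriv_def by (rule has_derivative_prod[OF pow])
qed

lemma monomial_deriv_continuous: "continuous_on S (\<lambda>x. monomial_deriv r x e)"
  unfolding monomial_deriv_def by (intro continuous_intros)

lemma set_integral_lborel_lebesgue:
  fixes f :: "real^'n::finite \<Rightarrow> real"
  assumes "set_integrable lborel S f"
  shows "set_integrable lebesgue S f" "(LINT x:S|lebesgue. f x) = (LINT x:S|lborel. f x)"
proof -
  have m: "(\<lambda>x. indicator S x *\<^sub>R f x) \<in> borel_measurable lborel"
    using assms by (auto simp: set_integrable_def)
  show "set_integrable lebesgue S f"
    using assms integrable_completion[OF m] by (simp add: set_integrable_def)
  show "(LINT x:S|lebesgue. f x) = (LINT x:S|lborel. f x)"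
    unfolding set_lebesgue_integral_def by (rule integral_completion[OF m])
qed

lemma set_integral_sum_real:
  fixes f :: "'i \<Rightarrow> 'a \<Rightarrow> real"
  assumes "\<And>i. i \<in> I \<Longrightarrow> set_integrable M A (f i)"
  shows "set_integrable M A (\<lambda>x. \<Sum>i\<in>I. f i x)"
    and "(LINT x:A|M. \<Sum>i\<in>I. f i x) = (\<Sum>i\<in>I. LINT x:A|M. f i x)"
  using assms unfolding set_integrable_def set_lebesgue_integral_def
  by (simp_all add: sum_distrib_left)

context iga_mesh
begin

lemma broken_box_cbox: "broken_box \<subseteq> cbox lo up"
  using broken_box_subset box_subset_cbox by blast

text \<open>Continuity up to the facets of each open cell, with no matching between cells. This is what
  derivatives of discrete fields satisfy, and it is enough for boundedness and integrability.\<close>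

definition piecewise_continuous :: "(real^'n \<Rightarrow> 'b::real_normed_vector) \<Rightarrow> bool" where
  "piecewise_continuous f \<longleftrightarrow>
     (\<forall>m\<in>cells D. \<exists>g. continuous_on (cell_closed m) g \<and> (\<forall>x\<in>cell_open m. f x = g x))"

lemma piecewise_continuousE:
  assumes "piecewise_continuous f" "m \<in> cells D"
  obtains g where "continuous_on (cell_closed m) g" "\<And>x. x \<in> cell_open m \<Longrightarrow> f x = g x"
  using assms unfolding piecewise_continuous_def by blast

lemma continuous_imp_piecewise_continuous:
  "continuous_on (cbox lo up) f \<Longrightarrow> piecewise_continuous f"
  unfolding piecewise_continuous_def using cell_closed_subset continuous_on_subset by blast

lemma piecewise_continuous_bilinear:
  assumes B: "bounded_bilinear B" and f: "piecewise_continuous f" and g: "piecewise_continuous g"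
  shows "piecewise_continuous (\<lambda>x. B (f x) (g x))"
  unfolding piecewise_continuous_def
proof
  fix m assume m: "m \<in> cells D"
  obtain f1 where f1: "continuous_on (cell_closed m) f1" "\<And>x. x \<in> cell_open m \<Longrightarrow> f x = f1 x"
    using piecewise_continuousE[OF f m] by blast
  obtain g1 where g1: "continuous_on (cell_closed m) g1" "\<And>x. x \<in> cell_open m \<Longrightarrow> g x = g1 x"
    using piecewise_continuousE[OF g m] by blast
  show "\<exists>h. continuous_on (cell_closed m) h \<and> (\<forall>x\<in>cell_open m. B (f x) (g x) = h x)"
    by (intro exI[of _ "\<lambda>x. B (f1 x) (g1 x)"]) (simp add: bounded_bilinear.continuous_on[OF B] f1 g1)
qed

lemma piecewise_continuous_add:
  assumes f: "piecewise_continuous f" and g: "piecewise_continuous g"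
  shows "piecewise_continuous (\<lambda>x. f x + g x)"
  unfolding piecewise_continuous_def
proof
  fix m assume m: "m \<in> cells D"
  obtain f1 where f1: "continuous_on (cell_closed m) f1" "\<And>x. x \<in> cell_open m \<Longrightarrow> f x = f1 x"
    using piecewise_continuousE[OF f m] by blast
  obtain g1 where g1: "continuous_on (cell_closed m) g1" "\<And>x. x \<in> cell_open m \<Longrightarrow> g x = g1 x"
    using piecewise_continuousE[OF g m] by blast
  show "\<exists>h. continuous_on (cell_closed m) h \<and> (\<forall>x\<in>cell_open m. f x + g x = h x)"
    by (intro exI[of _ "\<lambda>x. f1 x + g1 x"]) (simp add: continuous_on_add f1 g1)
qed

lemma piecewise_continuous_const: "piecewise_continuous (\<lambda>_. c)"
  by (rule continuous_imp_piecewise_continuous) simp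

lemma piecewise_continuous_sum:
  "(\<And>i. i \<in> I \<Longrightarrow> piecewise_continuous (f i)) \<Longrightarrow> piecewise_continuous (\<lambda>x. \<Sum>i\<in>I. f i x)"
  by (induction I rule: infinite_finite_induct)
     (auto intro: piecewise_continuous_const piecewise_continuous_add)

lemmas piecewise_continuous_intros =
  piecewise_continuous_const piecewise_continuous_sum
  piecewise_continuous_bilinear[OF bounded_bilinear_mult]
  piecewise_continuous_bilinear[OF bounded_bilinear_inner]
  piecewise_continuous_bilinear[OF bounded_bilinear_scaleR]

lemma piecewise_continuous_norm_sq:
  "piecewise_continuous f \<Longrightarrow> piecewise_continuous (\<lambda>x. (norm (f x :: 'b::real_inner))\<^sup>2)"
  unfolding power2_norm_eq_inner by (intro piecewise_continuous_intros)

lemma piecewise_continuous_imp_continuous: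
  assumes f: "piecewise_continuous f"
  shows "continuous_on broken_box f"
  unfolding broken_box_eq
proof (rule continuous_on_open_UN)
  fix m assume m: "m \<in> cells D"
  obtain g where g: "continuous_on (cell_closed m) g" "\<And>x. x \<in> cell_open m \<Longrightarrow> f x = g x"
    using piecewise_continuousE[OF f m] by blast
  have "continuous_on (cell_open m) g" by (rule continuous_on_subset[OF g(1) box_subset_cbox])
  then show "continuous_on (cell_open m) f"
    using g(2) continuous_on_cong[of "cell_open m" "cell_open m" f g] by blast
qed auto

lemma piecewise_continuous_bounded:
  assumes f: "piecewise_continuous f"
  obtains C where "\<And>x. x \<in> broken_box \<Longrightarrow> norm (f x) \<le> C"
proof -
  have "bounded (f ` broken_box)"
    unfolding broken_box_eq image_UN
  proof (rule bounded_UN[OF finite_cells], rule ballI)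
    fix m assume m: "m \<in> cells D"
    obtain g where g: "continuous_on (cell_closed m) g" "\<And>x. x \<in> cell_open m \<Longrightarrow> f x = g x"
      using piecewise_continuousE[OF f m] by blast
    have "bounded (g ` cell_closed m)"
      by (intro compact_imp_bounded compact_continuous_image g) auto
    then show "bounded (f ` cell_open m)"
      by (rule bounded_subset) (use g(2) box_subset_cbox in force)
  qed
  then obtain C where "\<forall>z\<in>f ` broken_box. norm z \<le> C" unfolding bounded_iff by blast
  then show ?thesis by (intro that[of C]) auto
qed

lemma piecewise_continuous_integrable:
  fixes f :: "real^'n \<Rightarrow> real"
  assumes f: "piecewise_continuous f"
  shows "set_integrable lborel broken_box f"
proof -
  obtain C where C: "\<And>x. x \<in> broken_box \<Longrightarrow> norm (f x) \<le> C"
    using piecewise_continuous_bounded[OF f] by blast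
  show ?thesis
    by (rule integrable_bounded_on_box[OF broken_box_open broken_box_cbox piecewise_continuous_imp_continuous[OF f]])
      (use C in auto)
qed

text \<open>The pieces are required to be \<open>C1\<close> on all of \<open>reg\<close> rather than up to the boundary of the closed
  cell: no one-sided derivatives are needed, and continuity across facets is enforced by demanding
  equality on closed cells.\<close>

definition piecewise_C1 :: "(real^'n \<Rightarrow> 'b::real_normed_vector) \<Rightarrow> bool" where
  "piecewise_C1 f \<longleftrightarrow> (\<forall>m\<in>cells D. \<exists>P P'. (\<forall>x\<in>reg. (P has_derivative P' x) (at x)) \<and>
      (\<forall>e. continuous_on reg (\<lambda>x. P' x e)) \<and> (\<forall>x\<in>cell_closed m. f x = P x))"

lemma piecewise_C1E:
  assumes "piecewise_C1 f" "m \<in> cells D"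
  obtains P P' where "\<And>x. x \<in> reg \<Longrightarrow> (P has_derivative P' x) (at x)"
    "\<And>e. continuous_on reg (\<lambda>x. P' x e)" "\<And>x. x \<in> cell_closed m \<Longrightarrow> f x = P x"
  using assms unfolding piecewise_C1_def by blast

lemma C1_imp_continuous: "(\<And>x. x \<in> reg \<Longrightarrow> (P has_derivative P' x) (at x)) \<Longrightarrow> continuous_on reg P"
  by (intro continuous_at_imp_continuous_on ballI has_derivative_continuous)

lemma piecewise_C1_global:
  assumes "\<And>x. x \<in> reg \<Longrightarrow> (P has_derivative P' x) (at x)" "\<And>e. continuous_on reg (\<lambda>x. P' x e)"
  shows "piecewise_C1 P"
  unfolding piecewise_C1_def using assms by blast

lemma piecewise_C1_const: "piecewise_C1 (\<lambda>_. c)"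
  by (rule piecewise_C1_global[of _ "\<lambda>_ _. 0"]) auto

lemma piecewise_C1_bilinear:
  assumes "bounded_bilinear B" "piecewise_C1 f" "piecewise_C1 g"
  shows "piecewise_C1 (\<lambda>x. B (f x) (g x))"
  unfolding piecewise_C1_def
proof
  interpret bounded_bilinear B by fact
  fix m assume m: "m \<in> cells D"
  obtain P P' where P: "\<And>x. x \<in> reg \<Longrightarrow> (P has_derivative P' x) (at x)"
    "\<And>e. continuous_on reg (\<lambda>x. P' x e)" "\<And>x. x \<in> cell_closed m \<Longrightarrow> f x = P x"
    using piecewise_C1E[OF assms(2) m] by blast
  obtain Q Q' where Q: "\<And>x. x \<in> reg \<Longrightarrow> (Q has_derivative Q' x) (at x)"
    "\<And>e. continuous_on reg (\<lambda>x. Q' x e)" "\<And>x. x \<in> cell_closed m \<Longrightarrow> g x = Q x"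
    using piecewise_C1E[OF assms(3) m] by blast
  show "\<exists>R R'. (\<forall>x\<in>reg. (R has_derivative R' x) (at x)) \<and>
      (\<forall>e. continuous_on reg (\<lambda>x. R' x e)) \<and> (\<forall>x\<in>cell_closed m. B (f x) (g x) = R x)"
    by (intro exI[of _ "\<lambda>x. B (P x) (Q x)"] exI[of _ "\<lambda>x e. B (P x) (Q' x e) + B (P' x e) (Q x)"])
      (auto simp: P(3) Q(3) intro!: FDERIV P Q continuous_on_add continuous_on
        C1_imp_continuous[OF P(1)] C1_imp_continuous[OF Q(1)])
qed

lemma piecewise_C1_diff:
  assumes "piecewise_C1 f" "piecewise_C1 g"
  shows "piecewise_C1 (\<lambda>x. f x - g x)"
  unfolding piecewise_C1_def
proof
  fix m assume m: "m \<in> cells D"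
  obtain P P' where P: "\<And>x. x \<in> reg \<Longrightarrow> (P has_derivative P' x) (at x)"
    "\<And>e. continuous_on reg (\<lambda>x. P' x e)" "\<And>x. x \<in> cell_closed m \<Longrightarrow> f x = P x"
    using piecewise_C1E[OF assms(1) m] by blast
  obtain Q Q' where Q: "\<And>x. x \<in> reg \<Longrightarrow> (Q has_derivative Q' x) (at x)"
    "\<And>e. continuous_on reg (\<lambda>x. Q' x e)" "\<And>x. x \<in> cell_closed m \<Longrightarrow> g x = Q x"
    using piecewise_C1E[OF assms(2) m] by blast
  show "\<exists>R R'. (\<forall>x\<in>reg. (R has_derivative R' x) (at x)) \<and>
      (\<forall>e. continuous_on reg (\<lambda>x. R' x e)) \<and> (\<forall>x\<in>cell_closed m. f x - g x = R x)"
    by (intro exI[of _ "\<lambda>x. P x - Q x"] exI[of _ "\<lambda>x e. P' x e - Q' x e"])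
      (auto simp: P(3) Q(3) intro!: has_derivative_diff P Q continuous_on_diff)
qed

lemma piecewise_C1_linear:
  assumes "bounded_linear L" "piecewise_C1 f"
  shows "piecewise_C1 (\<lambda>x. L (f x))"
  unfolding piecewise_C1_def
proof
  fix m assume m: "m \<in> cells D"
  obtain P P' where P: "\<And>x. x \<in> reg \<Longrightarrow> (P has_derivative P' x) (at x)"
    "\<And>e. continuous_on reg (\<lambda>x. P' x e)" "\<And>x. x \<in> cell_closed m \<Longrightarrow> f x = P x"
    using piecewise_C1E[OF assms(2) m] by blast
  show "\<exists>R R'. (\<forall>x\<in>reg. (R has_derivative R' x) (at x)) \<and>
      (\<forall>e. continuous_on reg (\<lambda>x. R' x e)) \<and> (\<forall>x\<in>cell_closed m. L (f x) = R x)"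
    by (intro exI[of _ "\<lambda>x. L (P x)"] exI[of _ "\<lambda>x e. L (P' x e)"])
      (auto simp: P(3) intro!: bounded_linear.has_derivative[OF assms(1)] P
        bounded_linear.continuous_on[OF assms(1)])
qed

lemma piecewise_C1_derivative:
  assumes f: "piecewise_C1 f" and x: "x \<in> broken_box"
  shows "(f has_derivative frechet_derivative f (at x)) (at x)"
proof -
  obtain m where m: "m \<in> cells D" "x \<in> cell_open m" using x by (auto simp: broken_box_eq)
  obtain P P' where P: "\<And>x. x \<in> reg \<Longrightarrow> (P has_derivative P' x) (at x)"
    "\<And>e. continuous_on reg (\<lambda>x. P' x e)" "\<And>x. x \<in> cell_closed m \<Longrightarrow> f x = P x"
    using piecewise_C1E[OF f m(1)] by blast
  have "(f has_derivative P' x) (at x)"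
  proof (rule has_derivative_transform_within_open[OF P(1)])
    show "x \<in> reg" using m cell_open_subset box_reg by blast
    show "P z = f z" if "z \<in> cell_open m" for z using P(3) that box_subset_cbox by force
  qed (use m in auto)
  then show ?thesis using frechet_derivative_works differentiable_def by blast
qed

lemma piecewise_C1_dir_deriv_eq:
  assumes m: "m \<in> cells D" "x \<in> cell_open m"
    and P: "\<And>x. x \<in> reg \<Longrightarrow> (P has_derivative P' x) (at x)" "\<And>x. x \<in> cell_closed m \<Longrightarrow> f x = P x"
  shows "dir_deriv e f x = P' x e"
proof (rule dir_deriv_eq, rule has_derivative_transform_within_open[OF P(1)])
  show "x \<in> reg" using m cell_open_subset box_reg by blast
  show "P z = f z" if "z \<in> cell_open m" for z using P(2) that box_subset_cbox by force
qed (use m in auto)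

lemma cell_closed_reg: "m \<in> cells D \<Longrightarrow> cell_closed m \<subseteq> reg"
  using cell_closed_subset cbox_reg by blast

lemma piecewise_C1_continuous:
  assumes f: "piecewise_C1 f"
  shows "continuous_on (cbox lo up) f"
proof -
  have "continuous_on (\<Union>m\<in>cells D. cell_closed m) f"
  proof (rule continuous_on_closed_Union[OF finite_cells])
    fix m assume m: "m \<in> cells D"
    obtain P P' where P: "\<And>x. x \<in> reg \<Longrightarrow> (P has_derivative P' x) (at x)"
      "\<And>e. continuous_on reg (\<lambda>x. P' x e)" "\<And>x. x \<in> cell_closed m \<Longrightarrow> f x = P x"
      using piecewise_C1E[OF f m] by blast
    have "continuous_on (cell_closed m) P"
      by (rule continuous_on_subset[OF C1_imp_continuous[OF P(1)] cell_closed_reg[OF m]])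
    then show "continuous_on (cell_closed m) f"
      using P(3) continuous_on_cong[of "cell_closed m" _ f P] by blast
  qed auto
  then show ?thesis
    by (rule continuous_on_subset) (use cell_locate in blast)
qed

lemma piecewise_C1_dir_deriv:
  assumes f: "piecewise_C1 f"
  shows "piecewise_continuous (dir_deriv e f)"
  unfolding piecewise_continuous_def
proof
  fix m assume m: "m \<in> cells D"
  obtain P P' where P: "\<And>x. x \<in> reg \<Longrightarrow> (P has_derivative P' x) (at x)"
    "\<And>e. continuous_on reg (\<lambda>x. P' x e)" "\<And>x. x \<in> cell_closed m \<Longrightarrow> f x = P x"
    using piecewise_C1E[OF f m] by blast
  have "continuous_on (cell_closed m) (\<lambda>x. P' x e)"
    by (rule continuous_on_subset[OF P(2) cell_closed_reg[OF m]])
  then show "\<exists>g. continuous_on (cell_closed m) g \<and> (\<forall>x\<in>cell_open m. dir_deriv e f x = g x)"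
    using piecewise_C1_dir_deriv_eq[OF m _ P(1,3)] by blast
qed

lemma integral_dir_deriv:
  fixes h :: "real^'n \<Rightarrow> real"
  assumes h: "piecewise_C1 h"
  shows "(LINT x:broken_box|lborel. dir_deriv (axis i 1) h x) =
      (LINT y:flat_face lo up i|cross_section i. h (slice_pt i y (up $ i)) - h (slice_pt i y (lo $ i)))"
proof -
  note pc = piecewise_C1_dir_deriv[OF h, of "axis i 1"]
  obtain C where C: "\<And>x. x \<in> broken_box \<Longrightarrow> norm (dir_deriv (axis i 1) h x) \<le> C"
    using piecewise_continuous_bounded[OF pc] by blast
  show ?thesis
  proof (rule integral_partial_derivative[OF _ _ broken_box_def piecewise_C1_continuous[OF h]
        piecewise_continuous_imp_continuous[OF pc]])
    fix x assume x: "x \<in> broken_box"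
    have "((\<lambda>t. x + t *\<^sub>R axis i 1) has_derivative (\<lambda>t. t *\<^sub>R axis i 1)) (at 0)"
      by (auto intro!: derivative_eq_intros)
    moreover have "(h has_derivative frechet_derivative h (at x)) (at (x + 0 *\<^sub>R axis i 1))"
      using piecewise_C1_derivative[OF h x] by simp
    ultimately have "((\<lambda>t. h (x + t *\<^sub>R axis i 1)) has_derivative
        (\<lambda>t. frechet_derivative h (at x) (t *\<^sub>R axis i 1))) (at 0)"
      by (rule has_derivative_compose)
    then show "((\<lambda>t. h (x + t *\<^sub>R axis i 1)) has_real_derivative dir_deriv (axis i 1) h x) (at 0)"
      using has_derivative_linear[OF piecewise_C1_derivative[OF h x]]
      by (simp add: has_field_derivative_def dir_deriv_def linear_cmul mult_commute_abs)
  qed (use C lo_less_up in auto)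
qed

text \<open>The inverse of the Piola transform, as a field on the parametric box.\<close>

definition push :: "(real^'n \<Rightarrow> real^'n) \<Rightarrow> real^'n \<Rightarrow> real^'n" where
  "push P x = (1 / dJ x) *\<^sub>R (J x *v P x)"

text \<open>The derivative of \<open>push P\<close>, by Jacobi's formula for the factor \<open>1 / det J\<close> and the product rule.\<close>

definition push_deriv :: "(real^'n \<Rightarrow> real^'n) \<Rightarrow> (real^'n \<Rightarrow> real^'n \<Rightarrow> real^'n) \<Rightarrow> real^'n \<Rightarrow> real^'n \<Rightarrow> real^'n" where
  "push_deriv P P' x e = (1 / dJ x) *\<^sub>R (hess x e *v P x + J x *v P' x e)
      - (trace (matrix_inv (J x) ** hess x e) / dJ x) *\<^sub>R (J x *v P x)"

lemma push_derivative:
  assumes x: "x \<in> reg" and P: "(P has_derivative P' x) (at x)"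
  shows "(push P has_derivative push_deriv P P' x) (at x)"
proof -
  note nz = dJ_nz[OF x]
  have d: "((\<lambda>x. 1 / dJ x) has_derivative
      (\<lambda>e. - (trace (matrix_inv (J x) ** hess x e) / dJ x))) (at x)"
    using has_derivative_det[OF J_derivative[OF x] nz] nz
    by (auto intro!: derivative_eq_intros simp: field_simps power2_eq_square fun_eq_iff)
  have m: "((\<lambda>x. J x *v P x) has_derivative (\<lambda>e. J x *v P' x e + hess x e *v P x)) (at x)"
    by (rule bounded_bilinear.FDERIV[OF bounded_bilinear_matrix_vector_mult J_derivative[OF x] P])
  have "((\<lambda>x. (1 / dJ x) *\<^sub>R (J x *v P x)) has_derivative
      (\<lambda>e. (1 / dJ x) *\<^sub>R (J x *v P' x e + hess x e *v P x)
        + (- (trace (matrix_inv (J x) ** hess x e) / dJ x)) *\<^sub>R (J x *v P x))) (at x)"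
    by (rule has_derivative_scaleR[OF d m])
  moreover have "(\<lambda>e. (1 / dJ x) *\<^sub>R (J x *v P' x e + hess x e *v P x)
        + (- (trace (matrix_inv (J x) ** hess x e) / dJ x)) *\<^sub>R (J x *v P x)) = push_deriv P P' x"
    by (simp add: push_deriv_def fun_eq_iff add.commute)
  ultimately show ?thesis unfolding push_def[abs_def] by simp
qed

lemma push_deriv_continuous:
  assumes P: "continuous_on reg P" "continuous_on reg (\<lambda>x. P' x e)"
  shows "continuous_on reg (\<lambda>x. push_deriv P P' x e)"
proof -
  note mv = bounded_bilinear.continuous_on[OF bounded_bilinear_matrix_vector_mult]
  have tr: "continuous_on reg (\<lambda>x. trace (matrix_inv (J x) ** hess x e))"
    by (intro continuous_on_trace bounded_bilinear.continuous_on[OF bounded_bilinear_matrix_mult]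
        J_inv_continuous hess_continuous)
  show ?thesis
    unfolding push_deriv_def
    by (intro continuous_on_diff continuous_on_scaleR continuous_on_add mv P J_continuous hess_continuous
        continuous_on_divide tr dJ_continuous continuous_on_const) (use dJ_nz in auto)
qed

lemma piecewise_C1_push:
  assumes U: "piecewise_C1 U"
  shows "piecewise_C1 (push U)"
  unfolding piecewise_C1_def
proof
  fix m assume m: "m \<in> cells D"
  obtain P P' where P: "\<And>x. x \<in> reg \<Longrightarrow> (P has_derivative P' x) (at x)"
    "\<And>e. continuous_on reg (\<lambda>x. P' x e)" "\<And>x. x \<in> cell_closed m \<Longrightarrow> U x = P x"
    using piecewise_C1E[OF U m] by blast
  show "\<exists>R R'. (\<forall>x\<in>reg. (R has_derivative R' x) (at x)) \<and>
      (\<forall>e. continuous_on reg (\<lambda>x. R' x e)) \<and> (\<forall>x\<in>cell_closed m. push U x = R x)"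
    by (intro exI[of _ "push P"] exI[of _ "push_deriv P P'"])
      (auto intro!: push_derivative P push_deriv_continuous C1_imp_continuous[OF P(1)] simp: push_def P(3))
qed

abbreviation basis_index :: "nat \<Rightarrow> (('n \<Rightarrow> nat) \<times> 'n) set" where
  "basis_index k \<equiv> multi_degrees k \<times> UNIV"

lemma finite_basis_index: "finite (basis_index k)"
  using finite_multi_degrees by (intro finite_cartesian_product) auto

text \<open>Monomial fields in the coordinate directions; they span the velocities on each cell.\<close>

definition basis_field :: "('n \<Rightarrow> nat) \<times> 'n \<Rightarrow> real^'n \<Rightarrow> real^'n" where
  "basis_field p x = monomial (fst p) x *\<^sub>R axis (snd p) 1"

definition basis_field_deriv :: "('n \<Rightarrow> nat) \<times> 'n \<Rightarrow> real^'n \<Rightarrow> real^'n \<Rightarrow> real^'n" where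
  "basis_field_deriv p x e = monomial_deriv (fst p) x e *\<^sub>R axis (snd p) 1"

lemma basis_field_C1:
  "(basis_field p has_derivative basis_field_deriv p x) (at x)"
  "continuous_on S (\<lambda>x. basis_field_deriv p x e)"
proof -
  show "(basis_field p has_derivative basis_field_deriv p x) (at x)"
    unfolding basis_field_def[abs_def] basis_field_deriv_def[abs_def]
    by (rule has_derivative_scaleR_left[OF monomial_derivative])
  show "continuous_on S (\<lambda>x. basis_field_deriv p x e)"
    unfolding basis_field_deriv_def
    by (intro continuous_on_scaleR continuous_on_const monomial_deriv_continuous)
qed

lemma field_expand_basis:
  "(\<Sum>r\<in>R. monomial r x *\<^sub>R a r) = (\<Sum>p\<in>R \<times> UNIV. (a (fst p) $ snd p) *\<^sub>R basis_field p x)"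
proof -
  have "(\<Sum>p\<in>R \<times> UNIV. (a (fst p) $ snd p) *\<^sub>R basis_field p x)
      = (\<Sum>r\<in>R. \<Sum>j\<in>UNIV. (a r $ j) *\<^sub>R basis_field (r, j) x)"
    by (simp add: sum.cartesian_product case_prod_beta)
  also have "\<dots> = (\<Sum>r\<in>R. monomial r x *\<^sub>R a r)"
  proof (rule sum.cong[OF refl])
    fix r
    have "(\<Sum>j\<in>UNIV. (a r $ j) *\<^sub>R axis j (1::real)) = a r"
      by (simp add: vec_eq_iff axis_def sum.delta if_distrib cong: if_cong)
    then have "monomial r x *\<^sub>R a r = monomial r x *\<^sub>R (\<Sum>j\<in>UNIV. (a r $ j) *\<^sub>R axis j 1)" by simp
    then show "(\<Sum>j\<in>UNIV. (a r $ j) *\<^sub>R basis_field (r, j) x) = monomial r x *\<^sub>R a r"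
      by (simp add: basis_field_def scaleR_sum_right mult.commute)
  qed
  finally show ?thesis by simp
qed

lemma piola_imp_push:
  assumes x: "x \<in> reg" and "piola D v x = U x"
  shows "v (F x) = push U x"
proof -
  have "J x *v U x = dJ x *\<^sub>R v (F x)"
    unfolding assms(2)[symmetric] piola_def
    by (simp add: matrix_vector_mult_scaleR matrix_inv_vector_mul[OF dJ_nz[OF x]])
  then show ?thesis using dJ_nz[OF x] by (simp add: push_def)
qed

lemma velocity_field:
  assumes v: "v \<in> velocity_space D k q"
  obtains U c where "piecewise_C1 U" "\<And>x. x \<in> box lo up \<Longrightarrow> v (F x) = push U x"
    "\<And>m x. m \<in> cells D \<Longrightarrow> x \<in> cell_open m \<Longrightarrow>
       v (F x) = (\<Sum>p\<in>basis_index k. c m p *\<^sub>R push (basis_field p) x)"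
proof -
  obtain U a where U: "\<And>x. x \<in> box lo up \<Longrightarrow> piola D v x = U x"
    "\<And>m x. m \<in> cells D \<Longrightarrow> x \<in> cell_closed m \<Longrightarrow>
       U x = (\<Sum>r\<in>multi_degrees k. monomial r x *\<^sub>R (a m r :: real^'n))"
    using velocity_pullback[OF v] by blast
  define c where "c m p = a m (fst p) $ snd p" for m p
  have Uc: "U x = (\<Sum>p\<in>basis_index k. c m p *\<^sub>R basis_field p x)" if "m \<in> cells D" "x \<in> cell_closed m" for m x
    unfolding U(2)[OF that] field_expand_basis c_def ..
  have "piecewise_C1 U"
    unfolding piecewise_C1_def
  proof
    fix m assume m: "m \<in> cells D"
    show "\<exists>P P'. (\<forall>x\<in>reg. (P has_derivative P' x) (at x)) \<and>
        (\<forall>e. continuous_on reg (\<lambda>x. P' x e)) \<and> (\<forall>x\<in>cell_closed m. U x = P x)"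
      by (intro exI[of _ "\<lambda>x. \<Sum>p\<in>basis_index k. c m p *\<^sub>R basis_field p x"]
          exI[of _ "\<lambda>x e. \<Sum>p\<in>basis_index k. c m p *\<^sub>R basis_field_deriv p x e"])
        (auto simp: Uc[OF m] intro!: has_derivative_sum has_derivative_scaleR_right basis_field_C1
          continuous_on_sum continuous_on_scaleR continuous_on_const)
  qed
  moreover have vU: "v (F x) = push U x" if "x \<in> box lo up" for x
    using that box_reg by (intro piola_imp_push U) auto
  moreover have "v (F x) = (\<Sum>p\<in>basis_index k. c m p *\<^sub>R push (basis_field p) x)"
    if "m \<in> cells D" "x \<in> cell_open m" for m x
  proof -
    have "x \<in> box lo up" "x \<in> cell_closed m" using that cell_open_subset box_subset_cbox by blast+
    then show ?thesis
      by (simp add: vU push_def Uc[OF that(1)] linear_sum[OF matrix_vector_mul_linear]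
          matrix_vector_mult_scaleR scaleR_sum_right mult.commute)
  qed
  ultimately show ?thesis by (rule that)
qed

lemma derivative_through_param:
  assumes x: "x \<in> box lo up" and W: "(W has_derivative W') (at x)"
    and S: "open S" "S \<subseteq> box lo up" "x \<in> S" and eq: "\<And>z. z \<in> S \<Longrightarrow> v (F z) = W z"
  shows "(v has_derivative (\<lambda>e. W' (matrix_inv (J x) *v e))) (at (F x))"
proof -
  have "((\<lambda>y. W (Fi y)) has_derivative (\<lambda>e. W' (matrix_inv (J x) *v e))) (at (F x))"
    using Fi_derivative[OF x] W x by (intro has_derivative_compose[OF Fi_derivative[OF x]]) simp
  then show ?thesis
  proof (rule has_derivative_transform_within_open)
    show "open (F ` S)" by (rule open_image[OF S(1,2)])
    show "F x \<in> F ` S" using S by blast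
    fix y assume "y \<in> F ` S"
    then obtain z where "z \<in> S" "y = F z" by blast
    then show "W (Fi y) = v y" using S eq by auto
  qed
qed

lemma jacobian_through_param:
  assumes "x \<in> box lo up" "(W has_derivative W') (at x)"
    and "open S" "S \<subseteq> box lo up" "x \<in> S" "\<And>z. z \<in> S \<Longrightarrow> v (F z) = W z"
  shows "jacobian v (F x) = matrix W' ** matrix_inv (J x)"
proof -
  note d = derivative_through_param[OF assms]
  have W: "W' = (\<lambda>e. matrix W' *v e)"
    using has_derivative_linear[OF assms(2)] by (simp add: fun_eq_iff matrix_works)
  have "jacobian v (F x) = matrix (\<lambda>e. W' (matrix_inv (J x) *v e))" by (rule jacobian_eq[OF d])
  also have "\<dots> = matrix (\<lambda>e. (matrix W' ** matrix_inv (J x)) *v e)"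
    by (subst W) (simp add: matrix_vector_mul_assoc)
  finally show ?thesis by simp
qed

text \<open>The Piola transform commutes with the divergence up to the factor \<open>det J\<close>.\<close>

lemma divergence_push:
  assumes U: "piecewise_C1 U" and x: "x \<in> broken_box" and v: "\<And>x. x \<in> box lo up \<Longrightarrow> v (F x) = push U x"
  shows "divg v (F x) = (\<Sum>i\<in>UNIV. dir_deriv (axis i 1) U x $ i) / dJ x"
proof -
  have xb: "x \<in> box lo up" and xr: "x \<in> reg" using x broken_box_subset box_reg by auto
  let ?U' = "\<lambda>x. frechet_derivative U (at x)"
  have dU: "(U has_derivative ?U' x) (at x)" by (rule piecewise_C1_derivative[OF U x])
  have dp: "(push U has_derivative push_deriv U ?U' x) (at x)" by (rule push_derivative[where P=U and P'="?U'", OF xr dU])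
  have "jacobian v (F x) = matrix (push_deriv U ?U' x) ** matrix_inv (J x)"
    by (rule jacobian_through_param[OF xb dp open_box subset_refl xb v])
  then have "divg v (F x) = trace (matrix (push_deriv U ?U' x) ** matrix_inv (J x))"
    by (simp add: divg_def grad_def trace_def transpose_def)
  also have "\<dots> = trace (matrix (?U' x)) / dJ x"
    unfolding push_deriv_def
    by (rule trace_piola_derivative[OF matrix_inv_det_nz(2)[OF dJ_nz[OF xr]] hess_linear[OF xr]
          has_derivative_linear[OF dU] hess_sym[OF xr]])
  also have "trace (matrix (?U' x)) = (\<Sum>i\<in>UNIV. dir_deriv (axis i 1) U x $ i)"
    by (simp add: trace_def matrix_def dir_deriv_def)
  finally show ?thesis .
qed

end

section \<open>Surface measure on the faces of the box\<close>

context iga_mesh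
begin

abbreviation "face i s \<equiv> {x \<in> cbox lo up. x $ i = face_coord D i s}"

lemma face_coord_bounds: "face_coord D i s \<in> {lo $ i..up $ i}"
  using lo_less_up[of i] by (auto simp: face_coord_def)

lemma slice_in_face:
  "y \<in> space (cross_section i) \<Longrightarrow> slice_pt i y (face_coord D i s) \<in> face i s \<longleftrightarrow> y \<in> flat_face lo up i"
  using face_coord_bounds[of i s]
  by (auto simp: flat_face_def mem_box_cart space_PiM PiE_iff split: if_splits)

text \<open>The normal is parallel to the \<open>i\<close>-th row of the inverse Jacobian, so its product with \<open>J a\<close> is a
  multiple of \<open>a $ i\<close>: the normal velocity on a face is, up to a nonzero factor, the corresponding
  component of the pulled back velocity.\<close>

lemma normal_dot_push:
  assumes x: "x \<in> reg"
  shows "norm (normal D i x) = 1" "k \<noteq> i \<Longrightarrow> normal D i x \<bullet> column k (J x) = 0"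
    "normal D i x \<bullet> push U x = 0 \<longleftrightarrow> U x $ i = 0"
proof -
  define z where "z = transpose (matrix_inv (J x)) *v axis i (1::real)"
  have zJ: "z \<bullet> (J x *v a) = a $ i" for a
    unfolding z_def transpose_matrix_vector dot_lmul_matrix
    by (simp add: matrix_inv_vector_mul[OF dJ_nz[OF x]] inner_axis')
  have z0: "z \<noteq> 0" using zJ[of "axis i 1"] by auto
  have n: "normal D i x = (1 / norm z) *\<^sub>R z" by (simp add: normal_def z_def sgn_div_norm divide_inverse)
  show "norm (normal D i x) = 1" using z0 by (simp add: n)
  have "column k (J x) = J x *v axis k 1" by (simp add: matrix_vector_mult_basis)
  then show "k \<noteq> i \<Longrightarrow> normal D i x \<bullet> column k (J x) = 0" using zJ[of "axis k 1"] by (simp add: n axis_def)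
  show "normal D i x \<bullet> push U x = 0 \<longleftrightarrow> U x $ i = 0"
    using z0 dJ_nz[OF x] by (simp add: n push_def zJ)
qed

text \<open>Completing the tangent vectors by the unit normal to a basis turns the Gram determinant into the
  square of an ordinary nonzero determinant.\<close>

lemma area_element_pos:
  assumes x: "x \<in> reg"
  shows "0 < area_element F i x"
proof -
  define N where "N = normal D i x"
  note N = normal_dot_push[OF x, where i=i, folded N_def]
  have NN: "N \<bullet> N = 1" using N(1) by (simp add: dot_square_norm)
  define A :: "real^'n^'n" where "A = (\<chi> a b. if b = i then N $ a else J x $ a $ b)"
  have col: "column b A = (if b = i then N else column b (J x))" for b
    by (simp add: A_def column_def vec_eq_iff)
  have gram: "(\<chi> j k. if j = i \<or> k = i then (if j = k then 1 else 0)
        else column j (J x) \<bullet> column k (J x)) = transpose A ** A"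
  proof -
    have "(transpose A ** A) $ j $ k = column j A \<bullet> column k A" for j k
      by (simp add: matrix_matrix_mult_def transpose_def column_def inner_vec_def)
    moreover have "k \<noteq> i \<Longrightarrow> column k (J x) \<bullet> N = 0" for k using N(2) by (simp add: inner_commute)
    ultimately show ?thesis by (auto simp: vec_eq_iff col NN N(2))
  qed
  have "det A \<noteq> 0"
  proof -
    have "y = 0" if y: "A *v y = 0" for y
    proof -
      have "A *v y = (\<Sum>b\<in>UNIV. y $ b *\<^sub>R column b A)"
        by (simp add: matrix_mult_sum scalar_mult_eq_scaleR)
      then have "N \<bullet> (A *v y) = (\<Sum>b\<in>UNIV. y $ b * (N \<bullet> column b A))"
        by (simp add: inner_sum_right)
      also have "\<dots> = (\<Sum>b\<in>UNIV. if b = i then y $ b else 0)"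
        by (intro sum.cong) (auto simp: col NN N(2))
      finally have yi: "y $ i = 0" using y by simp
      have "A *v y = J x *v y"
        by (auto simp: vec_eq_iff matrix_vector_mult_def A_def yi intro!: sum.cong)
      then have "matrix_inv (J x) *v (J x *v y) = 0" using y by simp
      then show "y = 0" by (simp add: matrix_inv_vector_mul[OF dJ_nz[OF x]])
    qed
    then have "invertible A"
      using matrix_left_invertible_ker[of A] invertible_left_inverse[of A] by blast
    then show ?thesis by (simp add: invertible_det_nz)
  qed
  then have "0 < det (transpose A ** A)" by (simp add: det_mul zero_less_mult_iff) linarith
  then show ?thesis unfolding area_element_def gram by simp
qed

lemma area_element_continuous: "continuous_on (cbox lo up) (area_element F i)"
proof -
  have Jc: "continuous_on (cbox lo up) (\<lambda>x. column j (J x))" for j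
    unfolding column_def by (intro continuous_on_vec_lambda continuous_on_component
        continuous_on_subset[OF J_continuous cbox_reg])
  have "continuous_on (cbox lo up) (\<lambda>x. if j = i \<or> k = i then (if j = k then 1 else 0)
                       else column j (J x) \<bullet> column k (J x))" for j k
    by (cases "j = i \<or> k = i") (simp_all only: if_True if_False continuous_on_const continuous_on_inner Jc)
  then show ?thesis
    unfolding area_element_def by (intro continuous_on_real_sqrt continuous_on_det continuous_on_vec_lambda)
qed

lemma face_closed: "closed (face i s)"
proof -
  have eq: "face i s = cbox lo up \<inter> {x. x $ i = face_coord D i s}" by auto
  have "closed {x::real^'n. x $ i = face_coord D i s}"
    by (intro closed_Collect_eq continuous_intros)
  then show ?thesis unfolding eq by (rule closed_Int[OF closed_cbox])
qed

lemma hyperplane_measure_eq: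
  "hyperplane_measure i c = completion (distr (cross_section i) borel (\<lambda>y. slice_pt i y c))"
  by (simp add: hyperplane_measure_def slice_pt_def)

lemma face_measure_eq:
  "face_measure D i s = density (restrict_space
     (completion (distr (cross_section i) borel (\<lambda>y. slice_pt i y (face_coord D i s)))) (face i s))
     (\<lambda>x. ennreal (area_element F i x))"
  by (simp add: face_measure_def facet_measure_def hyperplane_measure_eq)

lemma space_face_measure: "space (face_measure D i s) = face i s"
  by (simp add: face_measure_eq space_restrict_space)

lemma borel_measurable_face_base:
  fixes f :: "real^'n \<Rightarrow> 'b::{real_normed_vector, second_countable_topology}"
  assumes f: "continuous_on (cbox lo up) f"
  shows "f \<in> borel_measurable (restrict_space (completion (distr (cross_section i) borel
     (\<lambda>y. slice_pt i y (face_coord D i s)))) (face i s))"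
proof -
  have "(\<lambda>x. indicator (face i s) x *\<^sub>R f x) \<in> borel_measurable borel"
    using face_closed by (intro borel_measurable_continuous_on_indicator continuous_on_subset[OF f]) auto
  then have "(\<lambda>x. indicator (face i s) x *\<^sub>R f x) \<in> borel_measurable
      (completion (distr (cross_section i) borel (\<lambda>y. slice_pt i y (face_coord D i s))))"
    by (intro measurable_completion) simp
  then have "(\<lambda>x. indicator (face i s) x *\<^sub>R f x) \<in> borel_measurable (restrict_space
      (completion (distr (cross_section i) borel (\<lambda>y. slice_pt i y (face_coord D i s)))) (face i s))"
    by (rule measurable_restrict_space1)
  then show ?thesis
    by (rule measurable_cong[THEN iffD1, rotated]) (simp add: space_restrict_space)
qed

lemma borel_measurable_face:
  fixes f :: "real^'n \<Rightarrow> 'b::{real_normed_vector, second_countable_topology}"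
  assumes "continuous_on (cbox lo up) f"
  shows "f \<in> borel_measurable (face_measure D i s)"
  using borel_measurable_face_base[OF assms] by (simp add: face_measure_eq)

lemma face_in_completion:
  "face i s \<inter> space (completion (distr (cross_section i) borel (\<lambda>y. slice_pt i y c)))
     \<in> sets (completion (distr (cross_section i) borel (\<lambda>y. slice_pt i y c)))"
  using face_closed by (auto intro!: sets_completionI_sets)

text \<open>Unwinding the surface measure: density, restriction, completion and image measure are removed one
  after another, which leaves an integral over the flat face weighted with the area element.\<close>

lemma face_integral:
  fixes \<phi> :: "real^'n \<Rightarrow> real"
  assumes \<phi>: "continuous_on (cbox lo up) \<phi>"
  shows "set_integrable (cross_section i) (flat_face lo up i) (\<lambda>y. \<phi> (slice_pt i y (face_coord D i s)))" (is ?th1)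
    and "integrable (face_measure D i s) \<phi>" (is ?th2)
    and "(\<integral>x. \<phi> x \<partial>face_measure D i s) = (LINT y:flat_face lo up i|cross_section i.
       area_element F i (slice_pt i y (face_coord D i s)) * \<phi> (slice_pt i y (face_coord D i s)))" (is ?th3)
proof -
  let ?sl = "\<lambda>y. slice_pt i y (face_coord D i s)"
  let ?H = "distr (cross_section i) borel ?sl"
  have eq: "indicator (face i s) (?sl y) = (indicator (flat_face lo up i) y :: real)"
    if "y \<in> space (cross_section i)" for y
    using slice_in_face[OF that, of s] by (simp add: indicator_def)
  have int: "set_integrable (cross_section i) (flat_face lo up i) (\<lambda>y. \<psi> (?sl y)) \<and>
      (\<lambda>x. indicator (face i s) x *\<^sub>R \<psi> x) \<in> borel_measurable borel"
    if \<psi>: "continuous_on (cbox lo up) \<psi>" for \<psi> :: "real^'n \<Rightarrow> real"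
  proof
    show m: "(\<lambda>x. indicator (face i s) x *\<^sub>R \<psi> x) \<in> borel_measurable borel"
      using face_closed by (intro borel_measurable_continuous_on_indicator continuous_on_subset[OF \<psi>]) auto
    have "bounded (\<psi> ` cbox lo up)" by (intro compact_imp_bounded compact_continuous_image \<psi>) auto
    then obtain C where C: "\<And>x. x \<in> cbox lo up \<Longrightarrow> \<bar>\<psi> x\<bar> \<le> C" unfolding bounded_iff by auto
    show "set_integrable (cross_section i) (flat_face lo up i) (\<lambda>y. \<psi> (?sl y))"
      unfolding set_integrable_def
    proof (rule integrableI_bounded_set[where A="flat_face lo up i" and B=C])
      have "(\<lambda>y. indicator (face i s) (?sl y) *\<^sub>R \<psi> (?sl y)) \<in> borel_measurable (cross_section i)"
        by (rule measurable_compose[OF measurable_slice_pt m])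
      then show "(\<lambda>y. indicator (flat_face lo up i) y *\<^sub>R \<psi> (?sl y)) \<in> borel_measurable (cross_section i)"
        by (rule measurable_cong[THEN iffD1, rotated]) (simp add: eq)
      show "AE y in cross_section i. y \<in> flat_face lo up i \<longrightarrow> norm (indicator (flat_face lo up i) y *\<^sub>R \<psi> (?sl y)) \<le> C"
        using C slice_in_cbox[OF _ face_coord_bounds] by (intro always_eventually) auto
    qed (auto simp: emeasure_flat_face[simplified])
  qed
  show ?th1 using int[OF \<phi>] by blast
  let ?\<psi> = "\<lambda>x. area_element F i x * \<phi> x"
  have \<psi>: "continuous_on (cbox lo up) ?\<psi>" by (intro continuous_on_mult area_element_continuous \<phi>)
  note I = int[OF \<psi>]
  have nn: "AE x in restrict_space (completion ?H) (face i s). 0 \<le> area_element F i x"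
    using area_element_pos cbox_reg by (intro AE_I2) (auto simp: space_restrict_space intro: less_imp_le)
  have ma: "area_element F i \<in> borel_measurable (restrict_space (completion ?H) (face i s))"
    by (rule borel_measurable_face_base[OF area_element_continuous])
  have mp: "\<phi> \<in> borel_measurable (restrict_space (completion ?H) (face i s))"
    by (rule borel_measurable_face_base[OF \<phi>])
  have mH: "(\<lambda>x. indicator (face i s) x *\<^sub>R ?\<psi> x) \<in> borel_measurable ?H" using I by simp
  have chain: "integrable (face_measure D i s) \<phi> \<longleftrightarrow> integrable ?H (\<lambda>x. indicator (face i s) x *\<^sub>R ?\<psi> x)"
    unfolding face_measure_eq
    by (subst integrable_density[OF mp ma nn], subst integrable_restrict_space[OF face_in_completion],
        subst integrable_completion) (use mH in auto)
  have "integrable ?H (\<lambda>x. indicator (face i s) x *\<^sub>R ?\<psi> x) \<longleftrightarrow>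
      integrable (cross_section i) (\<lambda>y. indicator (face i s) (?sl y) *\<^sub>R ?\<psi> (?sl y))"
    by (rule integrable_distr_eq[OF measurable_slice_pt]) (use I in blast)
  also have "\<dots> \<longleftrightarrow> set_integrable (cross_section i) (flat_face lo up i) (\<lambda>y. ?\<psi> (?sl y))"
    unfolding set_integrable_def by (rule Bochner_Integration.integrable_cong[OF refl]) (simp add: eq)
  finally show ?th2 using chain I by blast
  have "(\<integral>x. \<phi> x \<partial>face_measure D i s) = (\<integral>x. indicator (face i s) x *\<^sub>R ?\<psi> x \<partial>?H)"
    unfolding face_measure_eq
    by (subst integral_density[OF mp ma nn], subst integral_restrict_space[OF face_in_completion],
        subst integral_completion) (use mH in auto)
  also have "\<dots> = (\<integral>y. indicator (face i s) (?sl y) *\<^sub>R ?\<psi> (?sl y) \<partial>cross_section i)"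
    by (rule integral_distr[OF measurable_slice_pt]) (use I in blast)
  also have "\<dots> = (LINT y:flat_face lo up i|cross_section i. ?\<psi> (?sl y))"
    unfolding set_lebesgue_integral_def by (rule Bochner_Integration.integral_cong[OF refl]) (simp add: eq)
  finally show ?th3 .
qed

text \<open>The area element is positive, so surface null sets are null sets of the flat face.\<close>

lemma face_AE_imp_slice_AE:
  fixes \<phi> :: "real^'n \<Rightarrow> real"
  assumes \<phi>: "continuous_on (cbox lo up) \<phi>" and AE: "AE x in face_measure D i s. \<phi> x = 0"
  shows "AE y in cross_section i. y \<in> flat_face lo up i \<longrightarrow> \<phi> (slice_pt i y (face_coord D i s)) = 0"
proof -
  let ?sl = "\<lambda>y. slice_pt i y (face_coord D i s)"
  have a: "continuous_on (cbox lo up) (\<lambda>x. \<bar>\<phi> x\<bar>)" by (intro continuous_intros \<phi>)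
  have aa: "continuous_on (cbox lo up) (\<lambda>x. area_element F i x * \<bar>\<phi> x\<bar>)"
    by (intro continuous_on_mult area_element_continuous a)
  have "(\<integral>x. \<bar>\<phi> x\<bar> \<partial>face_measure D i s) = 0"
    by (rule integral_eq_zero_AE) (use AE in auto)
  then have "(\<integral>y. indicator (flat_face lo up i) y *\<^sub>R (area_element F i (?sl y) * \<bar>\<phi> (?sl y)\<bar>) \<partial>cross_section i) = 0"
    using face_integral(3)[OF a, of i s] by (simp add: set_lebesgue_integral_def)
  moreover have pos: "0 < area_element F i (?sl y)" if "y \<in> flat_face lo up i" for y
    using area_element_pos slice_in_cbox[OF that face_coord_bounds] cbox_reg by blast
  ultimately have "AE y in cross_section i. indicator (flat_face lo up i) y *\<^sub>R (area_element F i (?sl y) * \<bar>\<phi> (?sl y)\<bar>) = 0"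
    using face_integral(1)[OF aa, of i s] unfolding set_integrable_def
    by (subst (asm) integral_nonneg_eq_0_iff_AE) (auto simp: indicator_def less_imp_le)
  then show ?thesis
  proof eventually_elim
    case (elim y)
    then show ?case using pos[of y] by (auto simp: indicator_def)
  qed
qed

text \<open>The edges lie in finitely many hyperplanes that cut the face transversally.\<close>

lemma face_AE_off_edges: "AE x in face_measure D i s. \<forall>j. j \<noteq> i \<longrightarrow> x $ j \<notin> knots j"
proof -
  let ?sl = "\<lambda>y. slice_pt i y (face_coord D i s)"
  let ?H = "distr (cross_section i) borel ?sl"
  let ?P = "\<lambda>x::real^'n. \<forall>j. j \<noteq> i \<longrightarrow> x $ j \<notin> knots j"
  have "closed (\<Union>j\<in>-{i}. \<Union>c\<in>knots j. {x::real^'n. x $ j = c})"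
    by (intro closed_UN finite_imageI) (auto intro!: closed_UN closed_Collect_eq continuous_intros)
  moreover have "{x. \<not> ?P x} = (\<Union>j\<in>-{i}. \<Union>c\<in>knots j. {x::real^'n. x $ j = c})" by auto
  ultimately have "closed {x. \<not> ?P x}" by simp
  then have "open (- {x. \<not> ?P x})" by (rule open_Compl)
  also have "- {x. \<not> ?P x} = {x \<in> space borel. ?P x}" by auto
  finally have meas: "{x \<in> space borel. ?P x} \<in> sets borel" by (rule borel_open)
  have "AE y in cross_section i. ?P (?sl y)"
    using AE_cross_section_avoid[of knots i, OF finite_imageI[OF finite_atLeastAtMost]] by eventually_elim auto
  then have "AE x in ?H. ?P x"
    by (subst AE_distr_iff[OF measurable_slice_pt meas])
  then have "AE x in completion ?H. ?P x" by (rule AE_completion)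
  then have "AE x in restrict_space (completion ?H) (face i s). ?P x"
    by (subst AE_restrict_space_iff[OF face_in_completion]) auto
  moreover have "(\<lambda>x. ennreal (area_element F i x)) \<in> borel_measurable (restrict_space (completion ?H) (face i s))"
    using borel_measurable_face_base[OF area_element_continuous] by measurable
  ultimately show ?thesis
    unfolding face_measure_eq by (subst AE_density) auto
qed

end

section \<open>Change of variables on the mesh\<close>

locale iga_mesh_23 = iga_mesh D q for D :: "('n::finite) iga" and q +
  assumes dim: "CARD('n) = 2 \<or> CARD('n) = 3"
begin

text \<open>Integrals over the domain are integrals over the open cells of the parametric box: the images of the
  facets are null sets, since \<open>F\<close> is differentiable there.\<close>

lemma integral_Omega:
  fixes \<phi> :: "real^'n \<Rightarrow> real"
  shows "integrable (lebesgue_on (Omega D)) \<phi> \<longleftrightarrow>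
      set_integrable lebesgue broken_box (\<lambda>x. \<bar>dJ x\<bar> * \<phi> (F x))" (is ?th1)
    and "(\<integral>y. \<phi> y \<partial>lebesgue_on (Omega D)) = (LINT x:broken_box|lebesgue. \<bar>dJ x\<bar> * \<phi> (F x))" (is ?th2)
proof -
  have der: "(F has_derivative (\<lambda>e. J x *v e)) (at x)" if "x \<in> broken_box" for x
    using that broken_box_subset box_reg by (intro F_derivative) auto
  have inj: "inj_on F broken_box"
    by (rule inj_on_subset[OF F_inj]) (use broken_box_subset box_subset_cbox in blast)
  note cov = change_of_variables_2_3[OF dim broken_box_open der inj, of \<phi>, unfolded matrix_of_matrix_vector_mul]
  have neg: "negligible (F ` (box lo up - broken_box))"
    by (rule negligible_image[OF negligible_skeleton]) (use box_reg in blast)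
  have sub: "F ` broken_box \<subseteq> Omega D" "Omega D - F ` broken_box \<subseteq> F ` (box lo up - broken_box)"
    unfolding Omega_def using broken_box_subset by auto
  have e: "F ` broken_box - Omega D = {}" using sub(1) by blast
  have neg2: "negligible (Omega D - F ` broken_box)" by (rule negligible_subset[OF neg sub(2)])
  have OmL: "Omega D \<inter> space lebesgue \<in> sets lebesgue" using Omega_open by (simp add: lmeasurable_iff_has_integral)
  have spike: "set_integrable lebesgue (F ` broken_box) \<phi> \<longleftrightarrow> set_integrable lebesgue (Omega D) \<phi>"
    by (rule absolutely_integrable_spike_set_eq) (use neg2 e in \<open>auto intro: negligible_subset\<close>)
  show ?th1
    using cov(1) spike integrable_restrict_space[OF OmL, of \<phi>] by (simp add: set_integrable_def)
  have "(LINT y:F ` broken_box|lebesgue. \<phi> y) = (LINT y:Omega D|lebesgue. \<phi> y)"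
  proof (cases "set_integrable lebesgue (Omega D) \<phi>")
    case True
    then have "integral (F ` broken_box) \<phi> = integral (Omega D) \<phi>"
      by (intro integral_spike_set) (use neg2 e in \<open>auto intro: negligible_subset\<close>)
    with True spike show ?thesis by (simp add: set_lebesgue_integral_eq_integral(2))
  next
    case False
    with spike show ?thesis
      by (simp add: set_lebesgue_integral_def set_integrable_def not_integrable_integral_eq)
  qed
  then show ?th2
    using cov(2) integral_restrict_space[OF OmL, of \<phi>] by (simp add: set_lebesgue_integral_def)
qed

end

section \<open>The normal component vanishes on the boundary\<close>

lemma smooth_facts:
  fixes w :: "real^'n::finite \<Rightarrow> real^'n"
  assumes "smooth w"
  shows "(w has_derivative (\<lambda>e. jacobian w x *v e)) (at x)"
    and "continuous_on UNIV (jacobian w)" and "continuous_on S w"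
proof -
  have C: "Ck_on (Suc 0) UNIV w" using assms by (simp only: smooth_def)
  have d: "w differentiable (at x)" for x using C by simp
  then show der: "(w has_derivative (\<lambda>e. jacobian w x *v e)) (at x)" for x by (rule jacobian_works)
  have "continuous_on UNIV (dir_deriv (axis i 1) w)" for i using C by simp
  then show "continuous_on UNIV (jacobian w)"
    by (intro continuous_on_vecI) (simp add: jacobian_nth continuous_on_component)
  show "continuous_on S w"
    by (intro continuous_at_imp_continuous_on ballI has_derivative_continuous[OF der])
qed

lemma norm_sq_add_le:
  fixes a b :: "'a::real_inner"
  shows "(norm (a + b))\<^sup>2 \<le> 2 * (norm a)\<^sup>2 + 2 * (norm b)\<^sup>2"
proof -
  have "(norm (a + b))\<^sup>2 + (norm (a - b))\<^sup>2 = 2 * (norm a)\<^sup>2 + 2 * (norm b)\<^sup>2"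
    by (simp add: power2_norm_eq_inner inner_diff_left inner_diff_right inner_add_left inner_add_right)
  then show ?thesis by (smt (verit) zero_le_power2)
qed

lemma norm_sq_diff_le:
  fixes a b :: "'a::real_inner"
  shows "(norm (a - b))\<^sup>2 \<le> 2 * (norm a)\<^sup>2 + 2 * (norm b)\<^sup>2"
  using norm_sq_add_le[of a "- b"] by simp

lemma square_integrable_diff:
  assumes "square_integrable M f" "square_integrable M g"
  shows "integrable M (\<lambda>x. (norm (f x - g x))\<^sup>2)"
    and "(\<integral>x. (norm (f x - g x))\<^sup>2 \<partial>M) \<le> 2 * (\<integral>x. (norm (f x))\<^sup>2 \<partial>M) + 2 * (\<integral>x. (norm (g x))\<^sup>2 \<partial>M)"
proof -
  have m: "f \<in> borel_measurable M" "g \<in> borel_measurable M"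
    and i: "integrable M (\<lambda>x. (norm (f x))\<^sup>2)" "integrable M (\<lambda>x. (norm (g x))\<^sup>2)"
    using assms by (auto simp: square_integrable_def)
  have ii: "integrable M (\<lambda>x. 2 * (norm (f x))\<^sup>2 + 2 * (norm (g x))\<^sup>2)"
    using i by simp
  show int: "integrable M (\<lambda>x. (norm (f x - g x))\<^sup>2)"
    by (rule Bochner_Integration.integrable_bound[OF ii]) (use m norm_sq_diff_le in \<open>auto intro!: AE_I2 order_trans[OF norm_sq_diff_le]\<close>)
  have "(\<integral>x. (norm (f x - g x))\<^sup>2 \<partial>M) \<le> (\<integral>x. 2 * (norm (f x))\<^sup>2 + 2 * (norm (g x))\<^sup>2 \<partial>M)"
    by (rule integral_mono[OF int ii]) (rule norm_sq_diff_le)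
  then show "(\<integral>x. (norm (f x - g x))\<^sup>2 \<partial>M) \<le> 2 * (\<integral>x. (norm (f x))\<^sup>2 \<partial>M) + 2 * (\<integral>x. (norm (g x))\<^sup>2 \<partial>M)"
    using i by simp
qed

context iga_mesh
begin

text \<open>A trace inequality in which the gradient has an arbitrarily small weight: integrate the derivative of the squared norm times an affine
  cutoff that is one on the face and zero on the opposite face.\<close>

lemma face_trace_bound:
  fixes f :: "real^'n \<Rightarrow> real^'n"
  assumes f: "piecewise_C1 f" and K: "0 < K"
  shows "(LINT y:flat_face lo up i|cross_section i. (norm (f (slice_pt i y (face_coord D i s))))\<^sup>2)
     \<le> (1 / (up $ i - lo $ i) + K) * (LINT x:broken_box|lborel. (norm (f x))\<^sup>2)
       + (1 / K) * (LINT x:broken_box|lborel. (norm (dir_deriv (axis i 1) f x))\<^sup>2)"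
proof -
  define L where "L = up $ i - lo $ i"
  have L: "0 < L" using lo_less_up[of i] by (simp add: L_def)
  \<comment> \<open>\<open>p\<close> is the cutoff and \<open>\<sigma>\<close> the sign of the outward direction along axis \<open>i\<close>\<close>
  define \<sigma> where "\<sigma> = (if s then 1 else -1 :: real)"
  define p where "p x = (if s then (x $ i - lo $ i) / L else (up $ i - x $ i) / L)" for x :: "real^'n"
  have p': "(p has_derivative (\<lambda>e. \<sigma> * e $ i / L)) (at x)" for x
    unfolding p_def[abs_def] \<sigma>_def using L
    by (auto intro!: derivative_eq_intros bounded_linear_imp_has_derivative[OF bounded_linear_vec_nth])
  have pC: "piecewise_C1 p"
    by (rule piecewise_C1_global[OF p']) simp
  have ffC: "piecewise_C1 (\<lambda>x. f x \<bullet> f x)"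
    by (rule piecewise_C1_bilinear[OF bounded_bilinear_inner f f])
  define h where "h x = p x * (f x \<bullet> f x)" for x
  have hC: "piecewise_C1 h"
    unfolding h_def[abs_def] by (rule piecewise_C1_bilinear[OF bounded_bilinear_mult pC ffC])
  have dh: "dir_deriv (axis i 1) h x = \<sigma> / L * (f x \<bullet> f x) + 2 * p x * (f x \<bullet> dir_deriv (axis i 1) f x)"
    if x: "x \<in> broken_box" for x
  proof -
    note d = piecewise_C1_derivative[OF f x]
    have "(h has_derivative (\<lambda>e. p x * (f x \<bullet> frechet_derivative f (at x) e + frechet_derivative f (at x) e \<bullet> f x)
        + \<sigma> * e $ i / L * (f x \<bullet> f x))) (at x)"
      unfolding h_def[abs_def] by (intro has_derivative_mult p' has_derivative_inner d)
    from dir_deriv_eq[OF this] show ?thesis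
      by (simp add: dir_deriv_def inner_commute algebra_simps)
  qed
  have p01: "0 \<le> p x \<and> p x \<le> 1" if "x \<in> cbox lo up" for x
    using that L by (auto simp: p_def L_def mem_box_cart divide_simps)
  note sub = broken_box_cbox
  note if2 = piecewise_continuous_integrable[OF piecewise_continuous_norm_sq[OF
      continuous_imp_piecewise_continuous[OF piecewise_C1_continuous[OF f]]]]
  note id2 = piecewise_continuous_integrable[OF piecewise_continuous_norm_sq[OF
      piecewise_C1_dir_deriv[OF f, of "axis i 1"]]]
  note ih = piecewise_continuous_integrable[OF piecewise_C1_dir_deriv[OF hC, of "axis i 1"]]
  have bound: "\<sigma> * dir_deriv (axis i 1) h x \<le> (1 / L + K) * (norm (f x))\<^sup>2 + (1 / K) * (norm (dir_deriv (axis i 1) f x))\<^sup>2"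
    if x: "x \<in> broken_box" for x
  proof -
    let ?d = "dir_deriv (axis i 1) f x"
    have sq: "\<sigma> * \<sigma> = 1" by (simp add: \<sigma>_def)
    have "2 * (norm (f x) * norm ?d) \<le> K * (norm (f x))\<^sup>2 + (1 / K) * (norm ?d)\<^sup>2"
    proof -
      have "0 \<le> (K * norm (f x) - norm ?d)\<^sup>2 / K" using K by simp
      then show ?thesis using K by (simp add: power2_eq_square field_simps)
    qed
    moreover have "\<sigma> * (2 * p x * (f x \<bullet> ?d)) \<le> 2 * (norm (f x) * norm ?d)"
    proof -
      have "\<sigma> * (2 * p x * (f x \<bullet> ?d)) \<le> \<bar>\<sigma> * (2 * p x * (f x \<bullet> ?d))\<bar>" by simp
      also have "\<dots> = 2 * (p x * \<bar>f x \<bullet> ?d\<bar>)" using p01[of x] x sub by (auto simp: abs_mult \<sigma>_def)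
      also have "\<dots> \<le> 2 * (1 * (norm (f x) * norm ?d))"
        using p01[of x] x sub by (intro mult_left_mono mult_mono Cauchy_Schwarz_ineq2) auto
      finally show ?thesis by simp
    qed
    moreover have "\<sigma> * dir_deriv (axis i 1) h x = (\<sigma> * \<sigma>) / L * (norm (f x))\<^sup>2 + \<sigma> * (2 * p x * (f x \<bullet> ?d))"
      unfolding dh[OF x] by (simp add: power2_norm_eq_inner algebra_simps)
    ultimately show ?thesis unfolding sq by (simp add: algebra_simps)
  qed
  have jump: "h (slice_pt i y (up $ i)) - h (slice_pt i y (lo $ i)) = \<sigma> * (norm (f (slice_pt i y (face_coord D i s))))\<^sup>2" for y
    using L by (simp add: h_def p_def \<sigma>_def L_def face_coord_def power2_norm_eq_inner)
  have "(LINT y:flat_face lo up i|cross_section i. (norm (f (slice_pt i y (face_coord D i s))))\<^sup>2)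
     = (LINT y:flat_face lo up i|cross_section i. \<sigma> * (\<sigma> * (norm (f (slice_pt i y (face_coord D i s))))\<^sup>2))"
    by (simp add: \<sigma>_def)
  also have "\<dots> = \<sigma> * (LINT x:broken_box|lborel. dir_deriv (axis i 1) h x)"
    unfolding integral_dir_deriv[OF hC] jump set_integral_mult_right ..
  also have "\<dots> = (LINT x:broken_box|lborel. \<sigma> * dir_deriv (axis i 1) h x)"
    by (simp only: set_integral_mult_right)
  also have "\<dots> \<le> (LINT x:broken_box|lborel. (1 / L + K) * (norm (f x))\<^sup>2 + (1 / K) * (norm (dir_deriv (axis i 1) f x))\<^sup>2)"
    by (intro set_integral_mono set_integrable_mult_right set_integral_add ih if2 id2 bound)
  also have "\<dots> = (1 / L + K) * (LINT x:broken_box|lborel. (norm (f x))\<^sup>2)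
       + (1 / K) * (LINT x:broken_box|lborel. (norm (dir_deriv (axis i 1) f x))\<^sup>2)"
    by (subst set_integral_add(2)) (auto intro!: set_integrable_mult_right if2 id2 simp: set_integral_mult_right)
  finally show ?thesis unfolding L_def .
qed

text \<open>Strong convergence in the interior together with bounded gradients gives convergence on the faces,
  because the weight of the gradient in the trace inequality can be made small.\<close>

lemma face_trace_tendsto:
  fixes f :: "nat \<Rightarrow> real^'n \<Rightarrow> real^'n"
  assumes f: "\<And>l. piecewise_C1 (f l)"
    and lim: "(\<lambda>l. LINT x:broken_box|lborel. (norm (f l x))\<^sup>2) \<longlonglongrightarrow> 0"
    and bdd: "\<And>l. (LINT x:broken_box|lborel. (norm (dir_deriv (axis i 1) (f l) x))\<^sup>2) \<le> B"
  shows "(\<lambda>l. LINT y:flat_face lo up i|cross_section i. (norm (f l (slice_pt i y (face_coord D i s))))\<^sup>2) \<longlonglongrightarrow> 0"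
    (is "?t \<longlonglongrightarrow> 0")
proof (rule LIMSEQ_I)
  fix \<epsilon> :: real assume \<epsilon>: "0 < \<epsilon>"
  \<comment> \<open>with this weight the gradient term contributes at most \<open>\<epsilon> / 2\<close>\<close>
  define K where "K = 2 * (\<bar>B\<bar> + 1) / \<epsilon>"
  have K: "0 < K" using \<epsilon> by (simp add: K_def)
  define c where "c = 1 / (up $ i - lo $ i) + K"
  have c: "0 < c" using lo_less_up[of i] K by (simp add: c_def add_pos_pos)
  obtain N where N: "\<And>l. l \<ge> N \<Longrightarrow> (LINT x:broken_box|lborel. (norm (f l x))\<^sup>2) < \<epsilon> / (2 * c)"
    using order_tendstoD(2)[OF lim, of "\<epsilon> / (2 * c)"] \<epsilon> c by (auto simp: eventually_sequentially)
  show "\<exists>N. \<forall>l\<ge>N. norm (?t l - 0) < \<epsilon>"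
  proof (intro exI[of _ N] allI impI)
    fix l assume l: "N \<le> l"
    have "?t l \<le> c * (LINT x:broken_box|lborel. (norm (f l x))\<^sup>2)
       + (1 / K) * (LINT x:broken_box|lborel. (norm (dir_deriv (axis i 1) (f l) x))\<^sup>2)"
      unfolding c_def by (rule face_trace_bound[OF f K])
    moreover have "c * (LINT x:broken_box|lborel. (norm (f l x))\<^sup>2) < c * (\<epsilon> / (2 * c))"
      using N[OF l] c by (intro mult_strict_left_mono)
    moreover have "(1 / K) * (LINT x:broken_box|lborel. (norm (dir_deriv (axis i 1) (f l) x))\<^sup>2) \<le> (1 / K) * (\<bar>B\<bar> + 1)"
      using bdd[of l] K by (intro mult_left_mono) auto
    moreover have "(1 / K) * (\<bar>B\<bar> + 1) = \<epsilon> / 2" using \<epsilon> by (simp add: K_def field_simps)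
    moreover have "c * (\<epsilon> / (2 * c)) = \<epsilon> / 2" using c by simp
    ultimately have "?t l < \<epsilon>" by linarith
    moreover have "0 \<le> ?t l"
      unfolding set_lebesgue_integral_def by (rule Bochner_Integration.integral_nonneg) simp
    ultimately show "norm (?t l - 0) < \<epsilon>" by simp
  qed
qed

end

context iga_mesh
begin

lemma piecewise_C1_smooth_comp:
  assumes w: "smooth w"
  shows "piecewise_C1 (\<lambda>x. w (F x))"
    and "x \<in> reg \<Longrightarrow> ((\<lambda>x. w (F x)) has_derivative (\<lambda>e. jacobian w (F x) *v (J x *v e))) (at x)"
proof -
  note mv = bounded_bilinear.continuous_on[OF bounded_bilinear_matrix_vector_mult]
  show d: "((\<lambda>x. w (F x)) has_derivative (\<lambda>e. jacobian w (F x) *v (J x *v e))) (at x)" if "x \<in> reg" for x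
    by (rule has_derivative_compose[OF F_derivative[OF that] smooth_facts(1)[OF w]])
  have "continuous_on reg (\<lambda>x. jacobian w (F x) *v (J x *v e))" for e
    by (intro mv continuous_on_compose2[OF smooth_facts(2)[OF w] F_continuous] J_continuous continuous_on_const) auto
  with d show "piecewise_C1 (\<lambda>x. w (F x))" by (intro piecewise_C1_global) auto
qed

lemma dJ_lower_bound:
  obtains c where "0 < c" "\<And>x. x \<in> cbox lo up \<Longrightarrow> c \<le> \<bar>dJ x\<bar>"
proof -
  have ne: "cbox lo up \<noteq> {}" using lo_less_up[THEN less_imp_le] by (auto simp: interval_ne_empty_cart)
  have cts: "continuous_on (cbox lo up) (\<lambda>x. \<bar>dJ x\<bar>)"
    by (intro continuous_intros continuous_on_subset[OF dJ_continuous cbox_reg])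
  obtain z where "z \<in> cbox lo up" "\<And>x. x \<in> cbox lo up \<Longrightarrow> \<bar>dJ z\<bar> \<le> \<bar>dJ x\<bar>"
    using continuous_attains_inf[OF compact_cbox ne cts] by blast
  then show ?thesis using dJ_nz cbox_reg by (intro that[of "\<bar>dJ z\<bar>"]) auto
qed

end

context iga_mesh_23
begin

lemma abs_dJ_piecewise_continuous: "piecewise_continuous (\<lambda>x. \<bar>dJ x\<bar>)"
  by (intro continuous_imp_piecewise_continuous continuous_on_rabs continuous_on_subset[OF dJ_continuous cbox_reg])

lemma integrable_Omega:
  assumes h: "piecewise_continuous h" and eq: "\<And>x. x \<in> broken_box \<Longrightarrow> \<phi> (F x) = (h x :: real)"
  shows "integrable (lebesgue_on (Omega D)) \<phi>"
    and "(\<integral>y. \<phi> y \<partial>lebesgue_on (Omega D)) = (LINT x:broken_box|lborel. \<bar>dJ x\<bar> * h x)"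
proof -
  have I: "set_integrable lborel broken_box (\<lambda>x. \<bar>dJ x\<bar> * h x)"
    by (intro piecewise_continuous_integrable piecewise_continuous_intros abs_dJ_piecewise_continuous h)
  have e: "indicator broken_box x *\<^sub>R (\<bar>dJ x\<bar> * \<phi> (F x)) = (indicator broken_box x *\<^sub>R (\<bar>dJ x\<bar> * h x) :: real)" for x
    using eq[of x] by (simp add: indicator_def)
  show "integrable (lebesgue_on (Omega D)) \<phi>"
    unfolding integral_Omega(1) set_integrable_def e
    using set_integral_lborel_lebesgue(1)[OF I] unfolding set_integrable_def .
  show "(\<integral>y. \<phi> y \<partial>lebesgue_on (Omega D)) = (LINT x:broken_box|lborel. \<bar>dJ x\<bar> * h x)"
    unfolding integral_Omega(2) set_integral_lborel_lebesgue(2)[OF I, symmetric]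
    unfolding set_lebesgue_integral_def e ..
qed

lemma pullback_integral_le:
  assumes h: "piecewise_continuous h" and eq: "\<And>x. x \<in> broken_box \<Longrightarrow> \<phi> (F x) = (h x :: real)"
    and nn: "\<And>x. 0 \<le> h x"
    and c: "0 < c" "\<And>x. x \<in> cbox lo up \<Longrightarrow> c \<le> \<bar>dJ x\<bar>"
  shows "(LINT x:broken_box|lborel. h x) \<le> (\<integral>y. \<phi> y \<partial>lebesgue_on (Omega D)) / c"
proof -
  have "c * (LINT x:broken_box|lborel. h x) = (LINT x:broken_box|lborel. c * h x)"
    by simp
  also have "\<dots> \<le> (LINT x:broken_box|lborel. \<bar>dJ x\<bar> * h x)"
    by (intro set_integral_mono piecewise_continuous_integrable piecewise_continuous_intros
        abs_dJ_piecewise_continuous h) (use c nn broken_box_cbox in \<open>auto intro!: mult_right_mono\<close>)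
  also have "\<dots> = (\<integral>y. \<phi> y \<partial>lebesgue_on (Omega D))" by (rule integrable_Omega(2)[OF h eq, symmetric])
  finally show ?thesis using c by (simp add: field_simps)
qed

text \<open>The traces of the smooth approximations converge on each face both to the abstract trace and to
  the boundary values of the field itself, so the two agree.\<close>

lemma normal_component_zero:
  assumes v: "v \<in> H1n D" and U: "piecewise_C1 U" and vU: "\<And>x. x \<in> box lo up \<Longrightarrow> v (F x) = push U x"
  shows "AE y in cross_section i. y \<in> flat_face lo up i \<longrightarrow> U (slice_pt i y (face_coord D i s)) $ i = 0"
proof -
  let ?W = "push U" and ?c = "face_coord D i s"
  have WC: "piecewise_C1 ?W" by (rule piecewise_C1_push[OF U])
  have Wc: "continuous_on (cbox lo up) ?W" by (rule piecewise_C1_continuous[OF WC])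
  have vW: "v (F x) = ?W x" if "x \<in> broken_box" for x using vU that broken_box_subset by blast
  obtain g where g: "has_trace D v g" and
    gn: "\<And>i s. AE x in face_measure D i s. g (F x) \<bullet> outward_normal D i s x = 0"
    using v unfolding H1n_def by blast
  have g2: "square_integrable (face_measure D i s) (\<lambda>x. g (F x))" for i s
    using g unfolding has_trace_def by blast
  obtain G w where G: "square_integrable (lebesgue_on (Omega D)) G" and w: "\<And>l::nat. smooth (w l)" and
    lim0: "(\<lambda>l. \<integral>x. (norm (w l x - v x))\<^sup>2 \<partial>lebesgue_on (Omega D)) \<longlonglongrightarrow> 0" and
    lim1: "(\<lambda>l. \<integral>x. (norm (grad (w l) x - G x))\<^sup>2 \<partial>lebesgue_on (Omega D)) \<longlonglongrightarrow> 0" and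
    limb: "(\<lambda>l. boundary_integral D (\<lambda>x _. (norm (w l x - g x))\<^sup>2)) \<longlonglongrightarrow> 0"
    using g unfolding has_trace_def by blast
  obtain c where c: "0 < c" "\<And>x. x \<in> cbox lo up \<Longrightarrow> c \<le> \<bar>dJ x\<bar>" using dJ_lower_bound by blast
  define f where "f l x = w l (F x) - ?W x" for l x
  have fC: "piecewise_C1 (f l)" for l
    unfolding f_def[abs_def] by (intro piecewise_C1_diff piecewise_C1_smooth_comp(1) w WC)
  have fc: "continuous_on (cbox lo up) (f l)" for l by (rule piecewise_C1_continuous[OF fC])
  have f2c: "continuous_on (cbox lo up) (\<lambda>x. (norm (f l x))\<^sup>2)" for l by (intro continuous_intros fc)
  have flim: "(\<lambda>l. LINT x:broken_box|lborel. (norm (f l x))\<^sup>2) \<longlonglongrightarrow> 0"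
  proof (rule tendsto_sandwich[OF _ _ tendsto_const])
    show "\<forall>\<^sub>F l in sequentially. 0 \<le> (LINT x:broken_box|lborel. (norm (f l x))\<^sup>2)"
      unfolding set_lebesgue_integral_def by (intro always_eventually allI Bochner_Integration.integral_nonneg) simp
    show "\<forall>\<^sub>F l in sequentially. (LINT x:broken_box|lborel. (norm (f l x))\<^sup>2)
        \<le> (\<integral>x. (norm (w l x - v x))\<^sup>2 \<partial>lebesgue_on (Omega D)) / c"
      by (intro always_eventually allI pullback_integral_le[OF continuous_imp_piecewise_continuous[OF f2c]] c) (simp_all add: f_def vW)
    show "(\<lambda>l. (\<integral>x. (norm (w l x - v x))\<^sup>2 \<partial>lebesgue_on (Omega D)) / c) \<longlonglongrightarrow> 0"
      using tendsto_divide[OF lim0 tendsto_const[of c]] c by simp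
  qed
  have gradc: "continuous_on UNIV (grad (w l))" for l
    unfolding grad_def[abs_def] transpose_def
    by (intro continuous_on_vec_lambda continuous_on_component smooth_facts(2)[OF w])
  have gradF: "continuous_on (cbox lo up) (\<lambda>x. (norm (grad (w l) (F x)))\<^sup>2)" for l
    by (intro continuous_intros continuous_on_compose2[OF gradc F_continuous_cbox]) auto
  note gradP = continuous_imp_piecewise_continuous[OF gradF]
  have gradL2: "square_integrable (lebesgue_on (Omega D)) (grad (w l))" for l
    unfolding square_integrable_def
  proof
    show "grad (w l) \<in> borel_measurable (lebesgue_on (Omega D))"
      using borel_measurable_continuous_onI[OF gradc]
      by (intro measurable_restrict_space1 measurable_completion) simp
    show "integrable (lebesgue_on (Omega D)) (\<lambda>x. (norm (grad (w l) x))\<^sup>2)"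
      by (rule integrable_Omega(1)[OF gradP]) simp
  qed
  obtain B1 where B1: "\<And>l. (\<integral>x. (norm (grad (w l) x - G x))\<^sup>2 \<partial>lebesgue_on (Omega D)) \<le> B1"
  proof -
    have "bounded (range (\<lambda>l. \<integral>x. (norm (grad (w l) x - G x))\<^sup>2 \<partial>lebesgue_on (Omega D)))"
      using lim1 by (intro convergent_imp_bounded)
    then obtain b where "\<And>l. norm (\<integral>x. (norm (grad (w l) x - G x))\<^sup>2 \<partial>lebesgue_on (Omega D)) \<le> b"
      unfolding bounded_iff by blast
    then show ?thesis by (intro that[of b]) (simp add: abs_le_iff)
  qed
  obtain B2 where B2: "\<And>l. (\<integral>x. (norm (grad (w l) x))\<^sup>2 \<partial>lebesgue_on (Omega D)) \<le> B2"
  proof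
    fix l
    have diff: "square_integrable (lebesgue_on (Omega D)) (\<lambda>x. grad (w l) x - G x)"
      using square_integrable_diff(1)[OF gradL2[of l] G] gradL2[of l] G by (auto simp: square_integrable_def)
    have mG: "square_integrable (lebesgue_on (Omega D)) (\<lambda>x. - G x)"
      using G by (auto simp: square_integrable_def)
    from square_integrable_diff(2)[OF diff mG]
    show "(\<integral>x. (norm (grad (w l) x))\<^sup>2 \<partial>lebesgue_on (Omega D)) \<le> 2 * B1 + 2 * (\<integral>x. (norm (G x))\<^sup>2 \<partial>lebesgue_on (Omega D))"
      using B1[of l] by simp
  qed
  obtain CW where CW: "\<And>x. x \<in> broken_box \<Longrightarrow> norm (dir_deriv (axis i 1) ?W x) \<le> CW"
    using piecewise_continuous_bounded[OF piecewise_C1_dir_deriv[OF WC]] by blast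
  have "bounded_bilinear (\<lambda>(A::real^'n^'n) x. transpose A *v x)"
  proof -
    have "bounded_bilinear (\<lambda>(A::real^'n^'n) x. x v* A)"
      unfolding bilinear_conv_bounded_bilinear[symmetric] bilinear_def
      by (auto simp: linear_iff vector_matrix_mult_def vec_eq_iff sum.distrib sum_distrib_left algebra_simps)
    then show ?thesis by (simp add: transpose_matrix_vector)
  qed
  then obtain K0 where K0: "0 \<le> K0" "\<And>(A::real^'n^'n) x. norm (transpose A *v x) \<le> norm A * norm x * K0"
    using bounded_bilinear.nonneg_bounded by blast
  obtain CJ where CJ: "\<And>x. x \<in> cbox lo up \<Longrightarrow> norm (J x *v axis i 1) \<le> CJ"
  proof -
    have "bounded ((\<lambda>x. J x *v axis i 1) ` cbox lo up)"
      by (intro compact_imp_bounded compact_continuous_image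
          bounded_bilinear.continuous_on[OF bounded_bilinear_matrix_vector_mult]
          continuous_on_subset[OF J_continuous cbox_reg] continuous_on_const) auto
    then show ?thesis using that unfolding bounded_iff by auto
  qed
  define B where "B = 2 * (CJ * K0)\<^sup>2 * (B2 / c) + 2 * CW\<^sup>2 * (LINT x:broken_box|lborel. 1)"
  have one: "set_integrable lborel broken_box (\<lambda>_. 1 :: real)"
    by (intro piecewise_continuous_integrable piecewise_continuous_intros)
  have fbdd: "(LINT x:broken_box|lborel. (norm (dir_deriv (axis i 1) (f l) x))\<^sup>2) \<le> B" for l
  proof -
    have pt: "(norm (dir_deriv (axis i 1) (f l) x))\<^sup>2 \<le> 2 * (CJ * K0)\<^sup>2 * (norm (grad (w l) (F x)))\<^sup>2 + 2 * CW\<^sup>2 * 1"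
      if x: "x \<in> broken_box" for x
    proof -
      have xr: "x \<in> reg" and xc: "x \<in> cbox lo up" using x broken_box_cbox cbox_reg by auto
      have eq: "dir_deriv (axis i 1) (f l) x = jacobian (w l) (F x) *v (J x *v axis i 1) - dir_deriv (axis i 1) ?W x"
        unfolding f_def[abs_def]
        using dir_deriv_eq[OF has_derivative_diff[OF piecewise_C1_smooth_comp(2)[OF w xr, of l] piecewise_C1_derivative[OF WC x]], of "axis i 1"]
        by (simp add: dir_deriv_def)
      have "norm (jacobian (w l) (F x) *v (J x *v axis i 1)) \<le> norm (grad (w l) (F x)) * norm (J x *v axis i 1) * K0"
        using K0(2)[of "grad (w l) (F x)"] by (simp add: grad_def transpose_transpose)
      also have "\<dots> \<le> norm (grad (w l) (F x)) * CJ * K0"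
        using CJ[OF xc] K0(1) by (intro mult_right_mono mult_left_mono) auto
      finally have "(norm (jacobian (w l) (F x) *v (J x *v axis i 1)))\<^sup>2 \<le> (norm (grad (w l) (F x)) * CJ * K0)\<^sup>2"
        by (intro power_mono) auto
      moreover have "(norm (dir_deriv (axis i 1) ?W x))\<^sup>2 \<le> CW\<^sup>2" using CW[OF x] by (intro power_mono) auto
      ultimately show ?thesis
        unfolding eq using norm_sq_diff_le[of "jacobian (w l) (F x) *v (J x *v axis i 1)" "dir_deriv (axis i 1) ?W x"]
        by (simp add: power_mult_distrib mult_ac)
    qed
    have "(LINT x:broken_box|lborel. (norm (dir_deriv (axis i 1) (f l) x))\<^sup>2)
      \<le> (LINT x:broken_box|lborel. 2 * (CJ * K0)\<^sup>2 * (norm (grad (w l) (F x)))\<^sup>2 + 2 * CW\<^sup>2 * 1)"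
      by (intro set_integral_mono set_integral_add set_integrable_mult_right one pt
          piecewise_continuous_integrable gradP piecewise_continuous_norm_sq piecewise_C1_dir_deriv fC)
    also have "\<dots> = 2 * (CJ * K0)\<^sup>2 * (LINT x:broken_box|lborel. (norm (grad (w l) (F x)))\<^sup>2) + 2 * CW\<^sup>2 * (LINT x:broken_box|lborel. 1)"
    proof -
      have e1: "set_integrable lborel broken_box (\<lambda>x. 2 * (CJ * K0)\<^sup>2 * (norm (grad (w l) (F x)))\<^sup>2)"
        by (intro set_integrable_mult_right piecewise_continuous_integrable gradP)
      have e2: "set_integrable lborel broken_box (\<lambda>x. 2 * CW\<^sup>2 * 1)"
        by (intro set_integrable_mult_right one)
      show ?thesis by (simp only: set_integral_add(2)[OF e1 e2] set_integral_mult_right)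
    qed
    also have "\<dots> \<le> B"
    proof -
      have "(LINT x:broken_box|lborel. (norm (grad (w l) (F x)))\<^sup>2) \<le> (\<integral>x. (norm (grad (w l) x))\<^sup>2 \<partial>lebesgue_on (Omega D)) / c"
        by (rule pullback_integral_le[where \<phi>="\<lambda>x. (norm (grad (w l) x))\<^sup>2" and h="\<lambda>x. (norm (grad (w l) (F x)))\<^sup>2",
              OF gradP refl zero_le_power2 c])
      also have "\<dots> \<le> B2 / c" using B2[of l] c by (intro divide_right_mono) auto
      finally show ?thesis unfolding B_def by (intro add_right_mono mult_left_mono) auto
    qed
    finally show ?thesis .
  qed
  let ?sl = "\<lambda>y. slice_pt i y ?c"
  have tr: "(\<lambda>l. LINT y:flat_face lo up i|cross_section i. (norm (f l (?sl y)))\<^sup>2) \<longlonglongrightarrow> 0"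
    by (rule face_trace_tendsto[OF fC flim fbdd])
  obtain CA where CA: "\<And>x. x \<in> cbox lo up \<Longrightarrow> \<bar>area_element F i x\<bar> \<le> CA"
  proof -
    have "bounded (area_element F i ` cbox lo up)"
      by (intro compact_imp_bounded compact_continuous_image area_element_continuous) auto
    then show ?thesis using that unfolding bounded_iff by auto
  qed
  have af2c: "continuous_on (cbox lo up) (\<lambda>x. area_element F i x * (norm (f l x))\<^sup>2)" for l
    by (intro continuous_on_mult area_element_continuous f2c)
  have dlim: "(\<lambda>l. \<integral>x. (norm (f l x))\<^sup>2 \<partial>face_measure D i s) \<longlonglongrightarrow> 0"
  proof (rule tendsto_sandwich[OF _ _ tendsto_const])
    show "\<forall>\<^sub>F l in sequentially. 0 \<le> (\<integral>x. (norm (f l x))\<^sup>2 \<partial>face_measure D i s)"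
      by (intro always_eventually allI Bochner_Integration.integral_nonneg) simp
    show "\<forall>\<^sub>F l in sequentially. (\<integral>x. (norm (f l x))\<^sup>2 \<partial>face_measure D i s)
        \<le> CA * (LINT y:flat_face lo up i|cross_section i. (norm (f l (?sl y)))\<^sup>2)"
    proof (intro always_eventually allI)
      fix l
      have "(\<integral>x. (norm (f l x))\<^sup>2 \<partial>face_measure D i s) =
         (LINT y:flat_face lo up i|cross_section i. area_element F i (?sl y) * (norm (f l (?sl y)))\<^sup>2)"
        by (rule face_integral(3)[OF f2c])
      also have "\<dots> \<le> (LINT y:flat_face lo up i|cross_section i. CA * (norm (f l (?sl y)))\<^sup>2)"
        using CA slice_in_cbox[OF _ face_coord_bounds]
        by (intro set_integral_mono set_integrable_mult_right face_integral(1)[OF f2c] face_integral(1)[OF af2c] mult_right_mono)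
          (auto intro: order_trans[OF abs_ge_self])
      finally show "(\<integral>x. (norm (f l x))\<^sup>2 \<partial>face_measure D i s)
        \<le> CA * (LINT y:flat_face lo up i|cross_section i. (norm (f l (?sl y)))\<^sup>2)" by simp
    qed
    show "(\<lambda>l. CA * (LINT y:flat_face lo up i|cross_section i. (norm (f l (?sl y)))\<^sup>2)) \<longlonglongrightarrow> 0"
      using tendsto_mult_right_zero[OF tr, of CA] by simp
  qed
  have elim: "(\<lambda>l. \<integral>x. (norm (w l (F x) - g (F x)))\<^sup>2 \<partial>face_measure D i s) \<longlonglongrightarrow> 0"
  proof (rule tendsto_sandwich[OF _ _ tendsto_const limb])
    have nn: "0 \<le> (\<integral>x. (norm (w l (F x) - g (F x)))\<^sup>2 \<partial>face_measure D i s)" for l i s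
      by (intro Bochner_Integration.integral_nonneg) simp
    show "\<forall>\<^sub>F l in sequentially. 0 \<le> (\<integral>x. (norm (w l (F x) - g (F x)))\<^sup>2 \<partial>face_measure D i s)"
      using nn by simp
    show "\<forall>\<^sub>F l in sequentially. (\<integral>x. (norm (w l (F x) - g (F x)))\<^sup>2 \<partial>face_measure D i s)
       \<le> boundary_integral D (\<lambda>x _. (norm (w l x - g x))\<^sup>2)"
    proof (intro always_eventually allI)
      fix l
      let ?I = "\<lambda>i s. \<integral>x. (norm (w l (F x) - g (F x)))\<^sup>2 \<partial>face_measure D i s"
      have "?I i s \<le> (\<Sum>s\<in>UNIV. ?I i s)" using nn by (intro member_le_sum) auto
      also have "\<dots> \<le> (\<Sum>i\<in>UNIV. \<Sum>s\<in>UNIV. ?I i s)"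
        using nn by (intro member_le_sum[of i UNIV "\<lambda>i. \<Sum>s\<in>UNIV. ?I i s"] sum_nonneg) auto
      finally show "?I i s \<le> boundary_integral D (\<lambda>x _. (norm (w l x - g x))\<^sup>2)"
        by (simp add: boundary_integral_def)
    qed
  qed
  have cts_sq: "square_integrable (face_measure D i s) h" if "continuous_on (cbox lo up) h" for h :: "real^'n \<Rightarrow> real^'n"
    unfolding square_integrable_def using that
    by (intro conjI borel_measurable_face face_integral(2)) (auto intro!: continuous_intros)
  have wFc: "continuous_on (cbox lo up) (\<lambda>x. w l (F x))" for l
    by (rule piecewise_C1_continuous[OF piecewise_C1_smooth_comp(1)[OF w]])
  have Wg: "AE x in face_measure D i s. ?W x = g (F x)"
  proof -
    have I: "integrable (face_measure D i s) (\<lambda>x. (norm (?W x - g (F x)))\<^sup>2)"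
      by (rule square_integrable_diff(1)[OF cts_sq[OF Wc] g2])
    have le: "(\<integral>x. (norm (?W x - g (F x)))\<^sup>2 \<partial>face_measure D i s) \<le>
        2 * (\<integral>x. (norm (w l (F x) - g (F x)))\<^sup>2 \<partial>face_measure D i s) + 2 * (\<integral>x. (norm (f l x))\<^sup>2 \<partial>face_measure D i s)" for l
    proof -
      have "square_integrable (face_measure D i s) (\<lambda>x. w l (F x) - g (F x))"
        using square_integrable_diff(1)[OF cts_sq[OF wFc] g2] cts_sq[OF wFc, of l] g2[of i s]
        by (auto simp: square_integrable_def)
      from square_integrable_diff(2)[OF this cts_sq[OF fc, of l]]
      show ?thesis by (simp add: f_def)
    qed
    have "(\<lambda>l. 2 * (\<integral>x. (norm (w l (F x) - g (F x)))\<^sup>2 \<partial>face_measure D i s) + 2 * (\<integral>x. (norm (f l x))\<^sup>2 \<partial>face_measure D i s)) \<longlonglongrightarrow> 2 * 0 + 2 * 0"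
      by (intro tendsto_intros elim dlim)
    then have "(\<integral>x. (norm (?W x - g (F x)))\<^sup>2 \<partial>face_measure D i s) \<le> 0"
      using le by (intro LIMSEQ_le_const) auto
    moreover have "0 \<le> (\<integral>x. (norm (?W x - g (F x)))\<^sup>2 \<partial>face_measure D i s)"
      by (intro Bochner_Integration.integral_nonneg) simp
    ultimately have "(\<integral>x. (norm (?W x - g (F x)))\<^sup>2 \<partial>face_measure D i s) = 0" by linarith
    then have "AE x in face_measure D i s. (norm (?W x - g (F x)))\<^sup>2 = 0"
      using integral_nonneg_eq_0_iff_AE[OF I] by simp
    then show ?thesis by eventually_elim simp
  qed
  have "AE x in face_measure D i s. U x $ i = 0"
    using Wg gn[of i s] AE_space
  proof eventually_elim
    case (elim x)
    then have xr: "x \<in> reg" using cbox_reg by (auto simp: space_face_measure)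
    have "normal D i x \<bullet> push U x = 0"
      using elim(1,2) by (auto simp: outward_normal_def inner_commute split: if_splits)
    then show ?case using normal_dot_push(3)[OF xr] by blast
  qed
  then show ?thesis
    by (intro face_AE_imp_slice_AE continuous_on_component piecewise_C1_continuous[OF U])
qed

end

section \<open>Norm equivalence on finite-dimensional spaces of continuous fields\<close>

lemma integral_Cauchy_Schwarz_cbox:
  fixes f g :: "'a::euclidean_space \<Rightarrow> 'b::euclidean_space"
  assumes f: "continuous_on (cbox a b) f" and g: "continuous_on (cbox a b) g"
  shows "(integral (cbox a b) (\<lambda>x. f x \<bullet> g x))\<^sup>2
      \<le> integral (cbox a b) (\<lambda>x. f x \<bullet> f x) * integral (cbox a b) (\<lambda>x. g x \<bullet> g x)"
proof -
  define A B C where "A = integral (cbox a b) (\<lambda>x. f x \<bullet> f x)" and "B = integral (cbox a b) (\<lambda>x. f x \<bullet> g x)"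
    and "C = integral (cbox a b) (\<lambda>x. g x \<bullet> g x)"
  have i: "(\<lambda>x. f x \<bullet> f x) integrable_on cbox a b" "(\<lambda>x. f x \<bullet> g x) integrable_on cbox a b"
    "(\<lambda>x. g x \<bullet> g x) integrable_on cbox a b"
    by (intro integrable_continuous continuous_on_inner f g)+
  have q: "0 \<le> A - 2 * t * B + t\<^sup>2 * C" for t
  proof -
    have "((\<lambda>x. f x \<bullet> f x - (2 * t) * (f x \<bullet> g x) + t\<^sup>2 * (g x \<bullet> g x)) has_integral (A - (2 * t) * B + t\<^sup>2 * C)) (cbox a b)"
      unfolding A_def B_def C_def
      by (intro has_integral_add has_integral_diff has_integral_mult_right integrable_integral i)
    moreover have "\<And>x. f x \<bullet> f x - (2 * t) * (f x \<bullet> g x) + t\<^sup>2 * (g x \<bullet> g x) = (f x - t *\<^sub>R g x) \<bullet> (f x - t *\<^sub>R g x)"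
      by (simp add: inner_diff_left inner_diff_right inner_commute power2_eq_square algebra_simps)
    ultimately have "((\<lambda>x. (f x - t *\<^sub>R g x) \<bullet> (f x - t *\<^sub>R g x)) has_integral (A - (2 * t) * B + t\<^sup>2 * C)) (cbox a b)"
      by (simp only:)
    from has_integral_nonneg[OF this] show ?thesis by simp
  qed
  have "B\<^sup>2 \<le> A * C"
  proof (cases "C = 0")
    case True
    have "B = 0"
    proof (rule ccontr)
      assume "B \<noteq> 0"
      then show False using q[of "(A + 1) / (2 * B)"] True by (simp add: field_simps)
    qed
    with True show ?thesis by simp
  next
    case False
    have "0 \<le> C" unfolding C_def by (rule integral_nonneg[OF i(3)]) simp
    with False have C: "0 < C" by simp
    have "0 \<le> A - 2 * (B / C) * B + (B / C)\<^sup>2 * C" by (rule q)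
    also have "\<dots> = A - B\<^sup>2 / C" using C by (simp add: power2_eq_square)
    finally show ?thesis using C by (simp add: field_simps)
  qed
  then show ?thesis by (simp add: A_def B_def C_def)
qed

text \<open>The functionals of the space given by integration against its own members separate points, so
  finitely many of them determine every member, hence its values, with bounded constants.\<close>

lemma sup_norm_le_L2_norm:
  fixes S :: "'i \<Rightarrow> 'a::euclidean_space \<Rightarrow> 'b::euclidean_space"
  assumes I: "finite I" and S: "\<And>p. p \<in> I \<Longrightarrow> continuous_on (cbox a b) (S p)" and ne: "box a b \<noteq> {}"
  shows "\<exists>M\<ge>0. \<forall>c. \<forall>x\<in>cbox a b. (norm (\<Sum>p\<in>I. c p *\<^sub>R S p x))\<^sup>2
     \<le> M * integral (cbox a b) (\<lambda>x. (norm (\<Sum>p\<in>I. c p *\<^sub>R S p x))\<^sup>2)"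
proof -
  define g where "g c x = (\<Sum>p\<in>I. c p *\<^sub>R S p x)" for c x
  define ip where "ip f h = integral (cbox a b) (\<lambda>x. f x \<bullet> h x)" for f h :: "'a \<Rightarrow> 'b"
  have gc: "continuous_on (cbox a b) (g c)" for c
    unfolding g_def by (intro continuous_on_sum continuous_on_scaleR continuous_on_const S)
  have ii: "(\<lambda>x. f x \<bullet> h x) integrable_on cbox a b"
    if "continuous_on (cbox a b) f" "continuous_on (cbox a b) h" for f h :: "'a \<Rightarrow> 'b"
    by (intro integrable_continuous continuous_on_inner that)
  have exp: "ip (g e) (g c) = (\<Sum>p\<in>I. c p * ip (g e) (S p))" for c e
  proof -
    have "ip (g e) (g c) = integral (cbox a b) (\<lambda>x. \<Sum>p\<in>I. c p * (g e x \<bullet> S p x))"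
      unfolding ip_def by (simp add: g_def[of c] inner_sum_right)
    also have "\<dots> = (\<Sum>p\<in>I. integral (cbox a b) (\<lambda>x. c p * (g e x \<bullet> S p x)))"
      using I by (intro integral_sum integrable_on_mult_right ii gc S)
    finally show ?thesis by (simp add: ip_def)
  qed
  obtain M :: nat and l d where dual: "\<And>e c. ip (g e) (g c) =
        (\<Sum>k<M. ip (g (l k)) (g c) * ip (g e) (g (d k)))"
    using finite_dual_functionals[OF I, where \<Lambda>=UNIV and L="\<lambda>e p. ip (g e) (S p)"]
    unfolding exp[symmetric] by auto
  have rep: "g c x = (\<Sum>k<M. ip (g (l k)) (g c) *\<^sub>R g (d k) x)" if x: "x \<in> cbox a b" for c x
  proof -
    define e where "e p = c p - (\<Sum>k<M. ip (g (l k)) (g c) * d k p)" for p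
    have ge: "g e x = g c x - (\<Sum>k<M. ip (g (l k)) (g c) *\<^sub>R g (d k) x)" for x
    proof -
      have "g e x = g c x - (\<Sum>p\<in>I. \<Sum>k<M. (ip (g (l k)) (g c) * d k p) *\<^sub>R S p x)"
        by (simp add: g_def e_def scaleR_diff_left sum_subtractf scaleR_sum_left)
      also have "(\<Sum>p\<in>I. \<Sum>k<M. (ip (g (l k)) (g c) * d k p) *\<^sub>R S p x)
          = (\<Sum>k<M. ip (g (l k)) (g c) *\<^sub>R g (d k) x)"
        by (subst sum.swap) (simp add: g_def scaleR_sum_right)
      finally show ?thesis .
    qed
    have "ip (g e) (g e) = ip (g e) (g c) - (\<Sum>k<M. ip (g (l k)) (g c) * ip (g e) (g (d k)))"
    proof -
      have "ip (g e) (g e) = (\<Sum>p\<in>I. c p * ip (g e) (S p)) - (\<Sum>p\<in>I. \<Sum>k<M. ip (g (l k)) (g c) * (d k p * ip (g e) (S p)))"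
        unfolding exp[of e e] sum_subtractf[symmetric]
        by (intro sum.cong refl) (subst e_def, simp add: left_diff_distrib sum_distrib_right mult.assoc)
      also have "(\<Sum>p\<in>I. \<Sum>k<M. ip (g (l k)) (g c) * (d k p * ip (g e) (S p))) =
          (\<Sum>k<M. ip (g (l k)) (g c) * ip (g e) (g (d k)))"
        by (subst sum.swap) (simp add: exp[of e "d _"] sum_distrib_left)
      finally show ?thesis by (simp add: exp[of e c])
    qed
    then have "ip (g e) (g e) = 0" using dual[of e c] by simp
    moreover have "((\<lambda>x. g e x \<bullet> g e x) has_integral ip (g e) (g e)) (cbox a b)"
      unfolding ip_def by (rule integrable_integral[OF ii[OF gc gc]])
    ultimately have "((\<lambda>x. g e x \<bullet> g e x) has_integral 0) (cbox a b)" by simp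
    from has_integral_0_cbox_imp_0[OF continuous_on_inner[OF gc gc] _ this ne x]
    have "g e x = 0" by simp
    then show ?thesis using ge[of x] by simp
  qed
  have "\<exists>B. \<forall>x\<in>cbox a b. norm (g (d k) x) \<le> B" for k
  proof -
    have "bounded (g (d k) ` cbox a b)" by (intro compact_imp_bounded compact_continuous_image gc) auto
    then show ?thesis unfolding bounded_iff by auto
  qed
  then obtain Bd where Bd: "\<And>k x. x \<in> cbox a b \<Longrightarrow> norm (g (d k) x) \<le> Bd k" by metis
  have ipnn: "0 \<le> ip (g c) (g c)" for c
    unfolding ip_def by (rule integral_nonneg[OF ii[OF gc gc]]) simp
  define M0 where "M0 = (\<Sum>k<M. sqrt (ip (g (l k)) (g (l k))) * Bd k)"
  have "(norm (g c x))\<^sup>2 \<le> M0\<^sup>2 * ip (g c) (g c)" if x: "x \<in> cbox a b" for c x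
  proof -
    have cs: "\<bar>ip (g e) (g c)\<bar> \<le> sqrt (ip (g e) (g e)) * sqrt (ip (g c) (g c))" for e
      using integral_Cauchy_Schwarz_cbox[OF gc gc, of e c]
      by (simp add: ip_def real_sqrt_mult[symmetric] real_le_rsqrt)
    have "norm (g c x) \<le> (\<Sum>k<M. norm (ip (g (l k)) (g c) *\<^sub>R g (d k) x))"
      unfolding rep[OF x, of c] by (rule norm_sum)
    also have "\<dots> \<le> (\<Sum>k<M. (sqrt (ip (g (l k)) (g (l k))) * sqrt (ip (g c) (g c))) * Bd k)"
      by (intro sum_mono) (auto intro!: mult_mono mult_nonneg_nonneg cs Bd x simp: ipnn)
    also have "\<dots> = M0 * sqrt (ip (g c) (g c))"
      by (simp add: M0_def sum_distrib_left sum_distrib_right mult_ac)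
    finally have "(norm (g c x))\<^sup>2 \<le> (M0 * sqrt (ip (g c) (g c)))\<^sup>2" by (intro power_mono) auto
    then show ?thesis using ipnn[of c] by (simp add: power_mult_distrib)
  qed
  then show ?thesis
    by (intro exI[of _ "M0\<^sup>2"]) (simp add: g_def ip_def power2_norm_eq_inner)
qed

section \<open>The convective term\<close>

context iga_mesh
begin

lemma dJ_sign: "\<exists>\<sigma>. \<forall>x\<in>cbox lo up. \<bar>dJ x\<bar> = \<sigma> * dJ x"
proof -
  have "connected (dJ ` cbox lo up)"
    by (intro connected_continuous_image continuous_on_subset[OF dJ_continuous cbox_reg]
        convex_connected convex_box)
  then have ivl: "0 \<in> dJ ` cbox lo up" if "x \<in> cbox lo up" "y \<in> cbox lo up" "dJ x < 0" "0 < dJ y" for x y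
    using connectedD_interval[of "dJ ` cbox lo up" "dJ x" "dJ y" 0] that by auto
  have nz: "dJ x \<noteq> 0" if "x \<in> cbox lo up" for x using dJ_nz cbox_reg that by blast
  have "(\<forall>x\<in>cbox lo up. 0 < dJ x) \<or> (\<forall>x\<in>cbox lo up. dJ x < 0)"
  proof (rule ccontr)
    assume "\<not> ?thesis"
    then obtain x y where "x \<in> cbox lo up" "y \<in> cbox lo up" "\<not> 0 < dJ y" "\<not> dJ x < 0" by blast
    then have "0 \<in> dJ ` cbox lo up" using ivl[of y x] nz[of x] nz[of y] by linarith
    then show False using nz by (auto simp: image_iff)
  qed
  then show ?thesis
  proof
    assume "\<forall>x\<in>cbox lo up. 0 < dJ x"
    then show ?thesis by (intro exI[of _ 1]) auto
  next
    assume "\<forall>x\<in>cbox lo up. dJ x < 0"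
    then show ?thesis by (intro exI[of _ "-1"]) auto
  qed
qed

lemma negligible_Fi_image:
  assumes "negligible N" "N \<subseteq> Omega D"
  shows "negligible (Fi ` N)"
proof (rule negligible_differentiable_image_negligible[OF _ assms(1)])
  show "Fi differentiable_on N"
    unfolding differentiable_on_def
  proof
    fix y assume "y \<in> N"
    then obtain x where x: "x \<in> box lo up" "y = F x" using assms(2) by (auto simp: Omega_def)
    then show "Fi differentiable at y within N"
      using Fi_derivative[OF x(1)] unfolding differentiable_def by (auto intro: has_derivative_at_withinI)
  qed
qed simp

text \<open>The inverse parametrisation is differentiable, so it maps the exceptional null set to a null set.\<close>

lemma divergence_pullback_zero:
  assumes AE: "AE y in lebesgue_on (Omega D). divg v y = 0"
    and U: "piecewise_C1 U" and vU: "\<And>x. x \<in> box lo up \<Longrightarrow> v (F x) = push U x"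
  shows "AE x in lebesgue. x \<in> broken_box \<longrightarrow> (\<Sum>i\<in>UNIV. dir_deriv (axis i 1) U x $ i) = 0"
proof -
  have OmL: "Omega D \<inter> space lebesgue \<in> sets lebesgue" using Omega_open by simp
  have "AE y in lebesgue. y \<in> Omega D \<longrightarrow> divg v y = 0"
    using AE by (simp add: AE_restrict_space_iff[OF OmL])
  then obtain N where N: "negligible N" "{y. \<not> (y \<in> Omega D \<longrightarrow> divg v y = 0)} \<subseteq> N"
    unfolding eventually_ae_filter_negligible by blast
  have neg: "negligible (Fi ` (N \<inter> Omega D))"
    by (rule negligible_Fi_image) (use N(1) in \<open>auto intro: negligible_subset\<close>)
  have "{x. \<not> (x \<in> broken_box \<longrightarrow> (\<Sum>i\<in>UNIV. dir_deriv (axis i 1) U x $ i) = 0)} \<subseteq> Fi ` (N \<inter> Omega D)"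
  proof
    fix x assume "x \<in> {x. \<not> (x \<in> broken_box \<longrightarrow> (\<Sum>i\<in>UNIV. dir_deriv (axis i 1) U x $ i) = 0)}"
    then have x: "x \<in> broken_box" "(\<Sum>i\<in>UNIV. dir_deriv (axis i 1) U x $ i) \<noteq> 0" by auto
    have xb: "x \<in> box lo up" using x broken_box_subset by blast
    have "divg v (F x) \<noteq> 0"
      using divergence_push[OF U x(1) vU] x(2) dJ_nz xb box_reg by auto
    moreover have "F x \<in> Omega D" using xb by (auto simp: Omega_def)
    ultimately have "F x \<in> N \<inter> Omega D" using N(2) by blast
    then show "x \<in> Fi ` (N \<inter> Omega D)" using Fi_F_box[OF xb] by (metis image_eqI)
  qed
  with neg show ?thesis unfolding eventually_ae_filter_negligible by blast
qed

end

lemma convective_integrand: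
  fixes a :: "real^'n::finite"
  shows "tensor_prod a a \<bullet> grad v x = a \<bullet> (jacobian v x *v a)"
proof -
  have "tensor_prod a a \<bullet> grad v x = (\<Sum>i\<in>UNIV. \<Sum>j\<in>UNIV. a $ i * a $ j * jacobian v x $ j $ i)"
    by (simp add: inner_vec_def tensor_prod_def grad_def transpose_def)
  also have "\<dots> = (\<Sum>j\<in>UNIV. \<Sum>i\<in>UNIV. a $ i * a $ j * jacobian v x $ j $ i)" by (rule sum.swap)
  also have "\<dots> = a \<bullet> (jacobian v x *v a)"
    by (simp add: inner_vec_def matrix_vector_mult_def sum_distrib_left mult_ac)
  finally show ?thesis .
qed

context iga_mesh_23
begin

text \<open>Pulled back, the integrand \<open>v \<bullet> (grad v)\<^sup>T v\<close> becomes, up to a constant sign, the directional derivative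
  of the kinetic energy density \<open>\<psi>\<close> along the divergence-free field \<open>U\<close>, hence the divergence of
  \<open>\<psi> U\<close>. Its integral reduces to the values of \<open>\<psi> U $ i\<close> on the faces orthogonal to axis \<open>i\<close>, where
  \<open>U $ i\<close> vanishes. No jumps appear because \<open>\<psi> U\<close> is continuous across the facets.\<close>

lemma convective_form_zero:
  assumes v: "v \<in> div_free_space D k q"
  shows "C_form D v v v = 0"
proof -
  have vV: "v \<in> velocity_space D k q" and div: "AE y in lebesgue_on (Omega D). divg v y = 0"
    using v by (auto simp: div_free_space_def)
  have vH: "v \<in> H1n D" using vV by (simp add: velocity_space_def)
  obtain U c where U: "piecewise_C1 U" and vU: "\<And>x. x \<in> box lo up \<Longrightarrow> v (F x) = push U x"
    and "\<And>m x. m \<in> cells D \<Longrightarrow> x \<in> cell_open m \<Longrightarrow>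
       v (F x) = (\<Sum>p\<in>basis_index k. c m p *\<^sub>R push (basis_field p) x)"
    using velocity_field[OF vV] by blast
  let ?W = "push U"
  have WC: "piecewise_C1 ?W" by (rule piecewise_C1_push[OF U])
  define \<psi> where "\<psi> x = (1/2) * (?W x \<bullet> ?W x)" for x
  have psiC: "piecewise_C1 \<psi>"
    unfolding \<psi>_def[abs_def]
    by (rule piecewise_C1_bilinear[OF bounded_bilinear_mult piecewise_C1_const
          piecewise_C1_bilinear[OF bounded_bilinear_inner WC WC]])
  define h where "h i x = \<psi> x * U x $ i" for i x
  have hC: "piecewise_C1 (h i)" for i
    unfolding h_def[abs_def]
    by (rule piecewise_C1_bilinear[OF bounded_bilinear_mult psiC piecewise_C1_linear[OF bounded_linear_vec_nth U]])
  define dU where "dU x = (\<Sum>i\<in>UNIV. dir_deriv (axis i 1) U x $ i)" for x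
  have dh: "dir_deriv (axis i 1) (h i) x = \<psi> x * dir_deriv (axis i 1) U x $ i + U x $ i * (?W x \<bullet> dir_deriv (axis i 1) ?W x)"
    if x: "x \<in> broken_box" for i x
  proof -
    note dW = piecewise_C1_derivative[OF WC x] and dUx = piecewise_C1_derivative[OF U x]
    have dp: "(\<psi> has_derivative (\<lambda>e. (1/2) * (?W x \<bullet> frechet_derivative ?W (at x) e + frechet_derivative ?W (at x) e \<bullet> ?W x))) (at x)"
      unfolding \<psi>_def[abs_def] by (intro has_derivative_mult_right has_derivative_inner dW)
    have du: "((\<lambda>x. U x $ i) has_derivative (\<lambda>e. frechet_derivative U (at x) e $ i)) (at x)"
      by (rule bounded_linear.has_derivative[OF bounded_linear_vec_nth dUx])
    from dir_deriv_eq[OF has_derivative_mult[OF dp du], of "axis i 1"]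
    show ?thesis by (simp add: h_def[abs_def] dir_deriv_def inner_commute)
  qed
  obtain \<sigma> where \<sigma>: "\<And>x. x \<in> cbox lo up \<Longrightarrow> \<bar>dJ x\<bar> = \<sigma> * dJ x" using dJ_sign by blast
  let ?\<phi> = "\<lambda>y. tensor_prod (v y) (v y) \<bullet> grad v y"
  have pt: "\<bar>dJ x\<bar> * ?\<phi> (F x) = \<sigma> * ((\<Sum>i\<in>UNIV. dir_deriv (axis i 1) (h i) x) - \<psi> x * dU x)"
    if x: "x \<in> broken_box" for x
  proof -
    have xb: "x \<in> box lo up" and xr: "x \<in> reg" and xc: "x \<in> cbox lo up"
      using x broken_box_subset box_reg broken_box_cbox by auto
    note dW = piecewise_C1_derivative[OF WC x]
    have lin: "linear (frechet_derivative ?W (at x))" by (rule has_derivative_linear[OF dW])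
    have jac: "jacobian v (F x) = matrix (frechet_derivative ?W (at x)) ** matrix_inv (J x)"
      by (rule jacobian_through_param[OF xb dW open_box subset_refl xb vU])
    have JW: "matrix_inv (J x) *v ?W x = (1 / dJ x) *\<^sub>R U x"
      by (simp add: push_def matrix_vector_mult_scaleR matrix_inv_vector_mul[OF dJ_nz[OF xr]])
    have "jacobian v (F x) *v v (F x) = frechet_derivative ?W (at x) ((1 / dJ x) *\<^sub>R U x)"
      unfolding jac vU[OF xb] matrix_vector_mul_assoc[symmetric] JW using lin by (simp add: matrix_works)
    also have "\<dots> = (1 / dJ x) *\<^sub>R frechet_derivative ?W (at x) (\<Sum>i\<in>UNIV. U x $ i *\<^sub>R axis i 1)"
    proof -
      have "(\<Sum>i\<in>UNIV. U x $ i *\<^sub>R axis i 1) = U x"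
        by (simp add: vec_eq_iff axis_def sum.delta if_distrib cong: if_cong)
      then show ?thesis using linear_cmul[OF lin] by simp
    qed
    also have "\<dots> = (1 / dJ x) *\<^sub>R (\<Sum>i\<in>UNIV. U x $ i *\<^sub>R dir_deriv (axis i 1) ?W x)"
      using linear_sum[OF lin, of "\<lambda>i. U x $ i *\<^sub>R axis i 1" UNIV] linear_cmul[OF lin] by (simp add: dir_deriv_def)
    finally have "dJ x * ?\<phi> (F x) = (\<Sum>i\<in>UNIV. U x $ i * (?W x \<bullet> dir_deriv (axis i 1) ?W x))"
      unfolding convective_integrand using dJ_nz[OF xr] by (simp add: vU[OF xb] inner_sum_right)
    also have "\<dots> = (\<Sum>i\<in>UNIV. dir_deriv (axis i 1) (h i) x) - \<psi> x * dU x"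
      by (simp add: dh[OF x] dU_def sum.distrib sum_distrib_left)
    finally show ?thesis using \<sigma>[OF xc] by (simp add: mult.assoc)
  qed
  have dir0: "(LINT x:broken_box|lborel. dir_deriv (axis i 1) (h i) x) = 0" for i
  proof -
    have nc: "AE y in cross_section i. y \<in> flat_face lo up i \<longrightarrow> U (slice_pt i y (face_coord D i s)) $ i = 0" for s
      by (rule normal_component_zero[OF vH U], rule vU)
    have "AE y in cross_section i. indicator (flat_face lo up i) y *\<^sub>R (h i (slice_pt i y (up $ i)) - h i (slice_pt i y (lo $ i))) = 0"
      using nc[of True] nc[of False]
      by eventually_elim (auto simp: h_def face_coord_def indicator_def)
    then show ?thesis
      unfolding integral_dir_deriv[OF hC] unfolding set_lebesgue_integral_def by (rule integral_eq_zero_AE)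
  qed
  have hP: "piecewise_continuous (\<lambda>x. \<Sum>i\<in>UNIV. dir_deriv (axis i 1) (h i) x)"
    by (intro piecewise_continuous_sum piecewise_C1_dir_deriv hC)
  have dP: "piecewise_continuous (\<lambda>x. \<psi> x * (\<Sum>i\<in>UNIV. dir_deriv (axis i 1) U x \<bullet> axis i 1))"
    by (intro piecewise_continuous_intros piecewise_C1_dir_deriv U
        continuous_imp_piecewise_continuous piecewise_C1_continuous psiC)
  have inth: "set_integrable lborel broken_box (\<lambda>x. \<Sum>i\<in>UNIV. dir_deriv (axis i 1) (h i) x)"
    by (intro piecewise_continuous_integrable hP)
  have sum0: "(LINT x:broken_box|lborel. \<Sum>i\<in>UNIV. dir_deriv (axis i 1) (h i) x) = 0"
    by (subst set_integral_sum_real(2))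
      (simp_all add: piecewise_continuous_integrable[OF piecewise_C1_dir_deriv[OF hC]] dir0)
  have measurable: "(\<lambda>x. indicator broken_box x *\<^sub>R f x) \<in> borel_measurable lebesgue"
    if "continuous_on broken_box f" for f :: "real^'n \<Rightarrow> real"
    using borel_measurable_continuous_on_indicator[OF _ that] broken_box_open
    by (intro measurable_completion) auto
  have ch: "continuous_on broken_box (\<lambda>x. \<Sum>i\<in>UNIV. dir_deriv (axis i 1) (h i) x)"
    by (rule piecewise_continuous_imp_continuous[OF hP])
  have cd: "continuous_on broken_box (\<lambda>x. \<psi> x * dU x)"
    using piecewise_continuous_imp_continuous[OF dP] by (simp add: dU_def inner_axis)
  have d0: "AE x in lebesgue. x \<in> broken_box \<longrightarrow> (\<Sum>i\<in>UNIV. dir_deriv (axis i 1) U x $ i) = 0"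
    by (rule divergence_pullback_zero[OF div U], rule vU)
  have "(\<integral>y. ?\<phi> y \<partial>lebesgue_on (Omega D)) = (LINT x:broken_box|lebesgue. \<bar>dJ x\<bar> * ?\<phi> (F x))"
    by (rule integral_Omega(2))
  also have "\<dots> = (LINT x:broken_box|lebesgue. \<sigma> * ((\<Sum>i\<in>UNIV. dir_deriv (axis i 1) (h i) x) - \<psi> x * dU x))"
    unfolding set_lebesgue_integral_def using pt
    by (intro Bochner_Integration.integral_cong) (auto simp: indicator_def)
  also have "\<dots> = (LINT x:broken_box|lebesgue. \<sigma> * (\<Sum>i\<in>UNIV. dir_deriv (axis i 1) (h i) x))"
    unfolding set_lebesgue_integral_def
  proof (rule integral_cong_AE)
    show "AE x in lebesgue. indicator broken_box x *\<^sub>R (\<sigma> * ((\<Sum>i\<in>UNIV. dir_deriv (axis i 1) (h i) x) - \<psi> x * dU x))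
        = indicator broken_box x *\<^sub>R (\<sigma> * (\<Sum>i\<in>UNIV. dir_deriv (axis i 1) (h i) x))"
      using d0 by eventually_elim (auto simp: indicator_def dU_def)
  qed (intro measurable continuous_on_mult continuous_on_diff continuous_on_const ch cd)+
  also have "\<dots> = \<sigma> * (LINT x:broken_box|lborel. \<Sum>i\<in>UNIV. dir_deriv (axis i 1) (h i) x)"
    by (simp only: set_integral_mult_right set_integral_lborel_lebesgue(2)[OF inth])
  finally have "(\<integral>y. ?\<phi> y \<partial>lebesgue_on (Omega D)) = 0" by (simp add: sum0)
  then show ?thesis by (simp add: C_form_def L2_inner_def)
qed

end

section \<open>Coercivity of the viscous form\<close>

definition symm :: "real^'n::finite^'n \<Rightarrow> real^'n^'n" where
  "symm A = (1/2) *\<^sub>R (A + transpose A)"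

lemma linear_symm: "linear (symm :: real^'n::finite^'n \<Rightarrow> _)"
  by (auto simp: linear_iff symm_def transpose_def vec_eq_iff algebra_simps)

lemma sym_grad_eq_symm: "sym_grad v x = symm (jacobian v x)"
  by (simp add: sym_grad_def symm_def grad_def transpose_transpose add.commute)

context iga_mesh
begin

definition basis_strain :: "('n \<Rightarrow> nat) \<times> 'n \<Rightarrow> real^'n \<Rightarrow> real^'n^'n" where
  "basis_strain p x = symm (matrix (push_deriv (basis_field p) (basis_field_deriv p) x) ** matrix_inv (J x))"

lemma basis_strain_continuous: "continuous_on reg (basis_strain p)"
proof -
  have "continuous_on reg (\<lambda>x. push_deriv (basis_field p) (basis_field_deriv p) x e)" for e
    by (intro push_deriv_continuous basis_field_C1(2) C1_imp_continuous[OF basis_field_C1(1)])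
  then have "continuous_on reg (\<lambda>x. matrix (push_deriv (basis_field p) (basis_field_deriv p) x))"
    unfolding matrix_def by (intro continuous_on_vec_lambda continuous_on_component)
  then have "continuous_on reg (\<lambda>x. matrix (push_deriv (basis_field p) (basis_field_deriv p) x) ** matrix_inv (J x))"
    by (intro bounded_bilinear.continuous_on[OF bounded_bilinear_matrix_mult] J_inv_continuous)
  then show ?thesis
    unfolding basis_strain_def[abs_def]
    by (rule linear_continuous_on_compose[OF _ linear_symm])
qed

lemma sym_grad_on_cell:
  assumes v: "\<And>z. z \<in> cell_open m \<Longrightarrow> v (F z) = (\<Sum>p\<in>I. c p *\<^sub>R push (basis_field p) z)"
    and m: "m \<in> cells D" and x: "x \<in> cell_open m"
  shows "sym_grad v (F x) = (\<Sum>p\<in>I. c p *\<^sub>R basis_strain p x)"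
proof -
  have xb: "x \<in> box lo up" using x cell_open_subset[OF m] by blast
  have xr: "x \<in> reg" using xb box_reg by blast
  let ?A = "\<lambda>p. matrix (push_deriv (basis_field p) (basis_field_deriv p) x)"
  have d: "((\<lambda>z. \<Sum>p\<in>I. c p *\<^sub>R push (basis_field p) z) has_derivative
      (\<lambda>e. \<Sum>p\<in>I. c p *\<^sub>R push_deriv (basis_field p) (basis_field_deriv p) x e)) (at x)"
    by (intro has_derivative_sum has_derivative_scaleR_right push_derivative[OF xr] basis_field_C1)
  have "jacobian v (F x) = matrix (\<lambda>e. \<Sum>p\<in>I. c p *\<^sub>R push_deriv (basis_field p) (basis_field_deriv p) x e) ** matrix_inv (J x)"
    by (rule jacobian_through_param[OF xb d open_box cell_open_subset[OF m] x v])
  also have "matrix (\<lambda>e. \<Sum>p\<in>I. c p *\<^sub>R push_deriv (basis_field p) (basis_field_deriv p) x e) = (\<Sum>p\<in>I. c p *\<^sub>R ?A p)"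
    by (simp add: matrix_def vec_eq_iff)
  also have "(\<Sum>p\<in>I. c p *\<^sub>R ?A p) ** matrix_inv (J x) = (\<Sum>p\<in>I. c p *\<^sub>R (?A p ** matrix_inv (J x)))"
  proof -
    interpret bounded_bilinear "\<lambda>(A::real^'n^'n) (B::real^'n^'n). A ** B" by (rule bounded_bilinear_matrix_mult)
    show ?thesis by (simp add: sum_left scaleR_left)
  qed
  finally have "sym_grad v (F x) = symm (\<Sum>p\<in>I. c p *\<^sub>R (?A p ** matrix_inv (J x)))"
    by (simp add: sym_grad_eq_symm)
  also have "\<dots> = (\<Sum>p\<in>I. c p *\<^sub>R basis_strain p x)"
    unfolding basis_strain_def linear_sum[OF linear_symm] linear_cmul[OF linear_symm] ..
  finally show ?thesis .
qed

text \<open>Near a point of a boundary face away from the edges of its facets, the domain is contained in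
  a single element.\<close>

lemma face_point_cell:
  assumes x: "x \<in> face i s" and off: "\<And>j. j \<noteq> i \<Longrightarrow> x $ j \<notin> knots j"
  obtains m T where "m \<in> cells D" "x \<in> cell_closed m" "open T" "x \<in> T" "box lo up \<inter> T \<subseteq> cell_open m"
proof -
  have xc: "x \<in> cbox lo up" and xi: "x $ i = face_coord D i s" using x by auto
  obtain m where m: "m \<in> cells D" and xm: "x \<in> cell_closed m" by (rule cell_locate[OF xc])
  have mi: "m j \<in> {1..nknots D j}" "m j + 1 \<in> {1..nknots D j}" for j
    using m by (auto simp: cells_def Suc_le_eq less_imp_le)
  have kn: "cell_lower D m $ j \<in> knots j" "cell_upper D m $ j \<in> knots j" for j
    using mi[of j] by (auto simp: cell_lower_def cell_upper_def)
  \<comment> \<open>bounds of the cell that lie on the boundary of the box are dropped, which makes \<open>x\<close> interior\<close>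
  define T where "T = {z::real^'n. \<forall>j. (cell_lower D m $ j = lo $ j \<or> cell_lower D m $ j < z $ j) \<and>
     (cell_upper D m $ j = up $ j \<or> z $ j < cell_upper D m $ j)}"
  have "open T"
  proof -
    have "T = (\<Inter>j\<in>UNIV. {z. cell_lower D m $ j = lo $ j \<or> cell_lower D m $ j < z $ j} \<inter>
        {z. cell_upper D m $ j = up $ j \<or> z $ j < cell_upper D m $ j})" by (auto simp: T_def)
    moreover have "open {z::real^'n. cell_lower D m $ j = lo $ j \<or> cell_lower D m $ j < z $ j}" for j
      by (cases "cell_lower D m $ j = lo $ j") (auto intro!: open_Collect_less continuous_intros)
    moreover have "open {z::real^'n. cell_upper D m $ j = up $ j \<or> z $ j < cell_upper D m $ j}" for j
      by (cases "cell_upper D m $ j = up $ j") (auto intro!: open_Collect_less continuous_intros)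
    ultimately show ?thesis by (auto intro!: open_INT open_Int)
  qed
  moreover have "x \<in> T"
    unfolding T_def
  proof (intro CollectI allI)
    fix j
    have le: "cell_lower D m $ j \<le> x $ j" "x $ j \<le> cell_upper D m $ j"
      using xm by (auto simp only: mem_box_cart)
    show "(cell_lower D m $ j = lo $ j \<or> cell_lower D m $ j < x $ j) \<and>
     (cell_upper D m $ j = up $ j \<or> x $ j < cell_upper D m $ j)"
    proof (cases "j = i")
      case False
      then have "x $ j \<noteq> cell_lower D m $ j" "x $ j \<noteq> cell_upper D m $ j" using off kn by metis+
      with le show ?thesis by linarith
    next
      case True
      then show ?thesis
        using le xi cell_bounds[OF m, of j] by (cases s) (auto simp: face_coord_def)
    qed
  qed
  moreover have "box lo up \<inter> T \<subseteq> cell_open m"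
  proof
    fix z assume z: "z \<in> box lo up \<inter> T"
    have "cell_lower D m $ j < z $ j \<and> z $ j < cell_upper D m $ j" for j
    proof -
      have "lo $ j < z $ j" "z $ j < up $ j" using z by (auto simp: mem_box_cart)
      moreover have "(cell_lower D m $ j = lo $ j \<or> cell_lower D m $ j < z $ j) \<and>
         (cell_upper D m $ j = up $ j \<or> z $ j < cell_upper D m $ j)" using z by (simp add: T_def)
      ultimately show ?thesis by linarith
    qed
    then show "z \<in> cell_open m" by (simp add: mem_box_cart)
  qed
  ultimately show ?thesis using that m xm by blast
qed

lemma limit_velocity:
  assumes U: "piecewise_C1 U" and vU: "\<And>x. x \<in> box lo up \<Longrightarrow> v (F x) = push U x" and x: "x \<in> cbox lo up"
  shows "limit_from (Omega D) v (F x) = push U x"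
proof (rule limit_from_pullback[OF x open_UNIV UNIV_I])
  have "continuous_on (cbox lo up) (push U)"
    by (rule piecewise_C1_continuous[OF piecewise_C1_push[OF U]])
  then have "(push U \<longlongrightarrow> push U x) (at x within cbox lo up)" using x by (auto simp: continuous_on_def)
  then show "(push U \<longlongrightarrow> push U x) (at x within box lo up \<inter> UNIV)"
    by (rule tendsto_within_subset) (use box_subset_cbox in auto)
qed (use vU in auto)

lemma J_form_nonneg:
  assumes "0 < \<nu>" "0 \<le> \<gamma>"
  shows "0 \<le> J_form D r \<nu> \<gamma> u u"
proof -
  have "0 \<le> stab_coeff D r \<nu> \<gamma> a n" for a n
    using assms adm_facts(6) by (auto simp: stab_coeff_def intro!: mult_nonneg_nonneg divide_nonneg_pos)
  then show ?thesis
    unfolding J_form_def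
    by (intro sum_nonneg) (auto intro!: Bochner_Integration.integral_nonneg mult_nonneg_nonneg)
qed

end

context iga_mesh_23
begin

text \<open>An inverse inequality. On each cell the symmetric gradients range over a finite-dimensional space of
  fields that are continuous on the closed cell, so their maximum is controlled by their mean square.
  In particular a velocity without strain has no boundary traction. The constant depends on the mesh,
  but not on the velocity, the viscosity or the penalty.\<close>

lemma strain_bound:
  obtains M where "0 \<le> M" "\<And>v m. v \<in> velocity_space D k q \<Longrightarrow> m \<in> cells D \<Longrightarrow>
     \<exists>S. continuous_on reg S \<and> (\<forall>x\<in>cell_open m. sym_grad v (F x) = S x) \<and>
         (\<forall>x\<in>cell_closed m. (norm (S x))\<^sup>2 \<le> M * L2_inner (Omega D) (sym_grad v) (sym_grad v))"
proof -
  let ?I = "basis_index k"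
  note fin = finite_basis_index[of k]
  have "\<forall>m\<in>cells D. \<exists>M. 0 \<le> M \<and> (\<forall>c. \<forall>x\<in>cell_closed m. (norm (\<Sum>p\<in>?I. c p *\<^sub>R basis_strain p x))\<^sup>2 \<le>
      M * integral (cell_closed m) (\<lambda>x. (norm (\<Sum>p\<in>?I. c p *\<^sub>R basis_strain p x))\<^sup>2))"
  proof
    fix m assume m: "m \<in> cells D"
    have ne: "cell_open m \<noteq> {}" using cell_bounds(2)[OF m] by (simp add: interval_ne_empty_cart)
    have cts: "continuous_on (cell_closed m) (basis_strain p)" for p
      by (rule continuous_on_subset[OF basis_strain_continuous cell_closed_reg[OF m]])
    show "\<exists>M\<ge>0. \<forall>c. \<forall>x\<in>cell_closed m. (norm (\<Sum>p\<in>?I. c p *\<^sub>R basis_strain p x))\<^sup>2 \<le>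
      M * integral (cell_closed m) (\<lambda>x. (norm (\<Sum>p\<in>?I. c p *\<^sub>R basis_strain p x))\<^sup>2)"
      by (rule sup_norm_le_L2_norm[OF fin cts ne])
  qed
  from bchoice[OF this] obtain M1 where "\<forall>m\<in>cells D. 0 \<le> M1 m \<and> (\<forall>c. \<forall>x\<in>cell_closed m. (norm (\<Sum>p\<in>?I. c p *\<^sub>R basis_strain p x))\<^sup>2 \<le>
      M1 m * integral (cell_closed m) (\<lambda>x. (norm (\<Sum>p\<in>?I. c p *\<^sub>R basis_strain p x))\<^sup>2))" ..
  then have M1: "\<And>m. m \<in> cells D \<Longrightarrow> 0 \<le> M1 m"
    "\<And>m c x. m \<in> cells D \<Longrightarrow> x \<in> cell_closed m \<Longrightarrow> (norm (\<Sum>p\<in>?I. c p *\<^sub>R basis_strain p x))\<^sup>2 \<le>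
      M1 m * integral (cell_closed m) (\<lambda>x. (norm (\<Sum>p\<in>?I. c p *\<^sub>R basis_strain p x))\<^sup>2)"
    by blast+
  obtain c0 where c0: "0 < c0" "\<And>x. x \<in> cbox lo up \<Longrightarrow> c0 \<le> \<bar>dJ x\<bar>" using dJ_lower_bound by blast
  define M where "M = (\<Sum>m\<in>cells D. M1 m) / c0"
  show ?thesis
  proof (rule that[of M])
    show "0 \<le> M" using M1(1) c0(1) by (auto simp: M_def intro!: sum_nonneg divide_nonneg_pos)
    fix v m assume v: "v \<in> velocity_space D k q" and m: "m \<in> cells D"
    obtain U c where "piecewise_C1 U" "\<And>x. x \<in> box lo up \<Longrightarrow> v (F x) = push U x"
      and vc: "\<And>m x. m \<in> cells D \<Longrightarrow> x \<in> cell_open m \<Longrightarrow>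
       v (F x) = (\<Sum>p\<in>?I. c m p *\<^sub>R push (basis_field p) x)"
      using velocity_field[OF v] by blast
    define S where "S m x = (\<Sum>p\<in>?I. c m p *\<^sub>R basis_strain p x)" for m x
    have Sc: "continuous_on reg (S m)" for m
      unfolding S_def by (intro continuous_on_sum continuous_on_scaleR continuous_on_const basis_strain_continuous)
    have Sv: "sym_grad v (F x) = S m x" if "m \<in> cells D" "x \<in> cell_open m" for m x
      unfolding S_def by (rule sym_grad_on_cell[OF vc that]) (rule that(1))
    define \<tau> where "\<tau> x = (norm (sym_grad v (F x)))\<^sup>2" for x
    have "piecewise_continuous (\<lambda>x. sym_grad v (F x))"
      unfolding piecewise_continuous_def
      using Sv continuous_on_subset[OF Sc cell_closed_reg] by blast
    then have \<tau>c: "piecewise_continuous \<tau>"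
      unfolding \<tau>_def[abs_def] by (rule piecewise_continuous_norm_sq)
    let ?Q = "L2_inner (Omega D) (sym_grad v) (sym_grad v)"
    have Q: "(LINT x:broken_box|lborel. \<tau> x) \<le> ?Q / c0"
      unfolding L2_inner_def
      by (rule pullback_integral_le[OF \<tau>c _ _ c0]) (simp_all add: \<tau>_def power2_norm_eq_inner)
    have cellQ: "integral (cell_closed m) (\<lambda>x. (norm (S m x))\<^sup>2) \<le> ?Q / c0" if m: "m \<in> cells D" for m
    proof -
      have e: "indicator (cell_open m) x *\<^sub>R (norm (S m x))\<^sup>2 = indicator (cell_open m) x *\<^sub>R \<tau> x" for x
        using Sv[OF m] by (auto simp: indicator_def \<tau>_def)
      have ti: "set_integrable lborel (cell_open m) \<tau>"
        by (rule set_integrable_subset[OF piecewise_continuous_integrable[OF \<tau>c]])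
          (use cell_subset_broken_box[OF m] in auto)
      then have "set_integrable lborel (cell_open m) (\<lambda>x. (norm (S m x))\<^sup>2)"
        unfolding set_integrable_def e .
      from set_borel_integral_eq_integral(2)[OF this]
      have "integral (cell_closed m) (\<lambda>x. (norm (S m x))\<^sup>2) = (LINT x:cell_open m|lborel. (norm (S m x))\<^sup>2)"
        by (simp add: integral_open_interval)
      also have "\<dots> = (LINT x:cell_open m|lborel. \<tau> x)"
        unfolding set_lebesgue_integral_def e ..
      also have "\<dots> \<le> (LINT x:broken_box|lborel. \<tau> x)"
        unfolding set_lebesgue_integral_def
        by (rule integral_mono)
          (use ti piecewise_continuous_integrable[OF \<tau>c] cell_subset_broken_box[OF m]
            in \<open>auto simp: set_integrable_def indicator_def \<tau>_def\<close>)
      finally show ?thesis using Q by simp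
    qed
    have Qnn: "0 \<le> ?Q" unfolding L2_inner_def by (rule Bochner_Integration.integral_nonneg) simp
    have "(norm (S m x))\<^sup>2 \<le> M * ?Q" if x: "x \<in> cell_closed m" for x
    proof -
      have "(norm (S m x))\<^sup>2 \<le> M1 m * integral (cell_closed m) (\<lambda>x. (norm (S m x))\<^sup>2)"
        unfolding S_def by (rule M1(2)[OF m x])
      also have "\<dots> \<le> M1 m * (?Q / c0)"
        using cellQ[OF m] M1(1)[OF m] by (intro mult_left_mono)
      also have "\<dots> \<le> (\<Sum>m\<in>cells D. M1 m) * (?Q / c0)"
        using m M1(1) c0(1) Qnn by (intro mult_right_mono member_le_sum finite_cells) auto
      finally show ?thesis by (simp add: M_def)
    qed
    then show "\<exists>S. continuous_on reg S \<and> (\<forall>x\<in>cell_open m. sym_grad v (F x) = S x) \<and>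
         (\<forall>x\<in>cell_closed m. (norm (S x))\<^sup>2 \<le> M * ?Q)"
      using Sc Sv[OF m] by (intro exI[of _ "S m"]) auto
  qed
qed

text \<open>By Young's inequality with weight \<open>\<delta>\<close>, each of the two consistency terms is at most half of the
  dissipation plus a multiple of the squared boundary norm of the velocity: the traction is bounded by
  the inverse inequality above, and \<open>\<delta>\<close> is chosen so small that the total area \<open>\<mu>\<close> of the boundary
  does not spoil the factor one half. A Nitsche constant above \<open>C0\<close> absorbs the boundary term.\<close>

lemma A_form_nonneg:
  obtains C0 where "0 < C0" "\<And>v CNit \<nu> \<gamma>. v \<in> velocity_space D k q \<Longrightarrow> C0 \<le> CNit \<Longrightarrow> 0 < \<nu> \<Longrightarrow> 0 \<le> \<gamma> \<Longrightarrow>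
     0 \<le> A_form D q \<nu> CNit \<gamma> v v"
proof -
  obtain M where M: "0 \<le> M" and strain: "\<And>v m. v \<in> velocity_space D k q \<Longrightarrow> m \<in> cells D \<Longrightarrow>
     \<exists>S. continuous_on reg S \<and> (\<forall>x\<in>cell_open m. sym_grad v (F x) = S x) \<and>
         (\<forall>x\<in>cell_closed m. (norm (S x))\<^sup>2 \<le> M * L2_inner (Omega D) (sym_grad v) (sym_grad v))"
    using strain_bound[of k] by blast
  have "bounded_bilinear (\<lambda>(n::real^'n) (A::real^'n^'n). n v* A)"
    unfolding bilinear_conv_bounded_bilinear[symmetric] bilinear_def
    by (auto simp: linear_iff vector_matrix_mult_def vec_eq_iff sum.distrib sum_distrib_left algebra_simps)
  then obtain K where K: "0 \<le> K" "\<And>(n::real^'n) (A::real^'n^'n). norm (n v* A) \<le> norm n * norm A * K"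
    using bounded_bilinear.nonneg_bounded by blast
  let ?h = "meshsize D"
  have h: "0 < ?h" by (rule adm_facts)
  define \<mu> where "\<mu> = (\<Sum>i\<in>UNIV. \<Sum>s\<in>UNIV. \<integral>x. (1::real) \<partial>face_measure D i s)"
  have \<mu>: "0 \<le> \<mu>" unfolding \<mu>_def by (intro sum_nonneg) auto
  \<comment> \<open>adding one keeps the weight finite when the boundary term or the area vanishes\<close>
  define \<delta> where "\<delta> = 1 / (M * \<mu> + 1)"
  have \<delta>: "0 < \<delta>" "\<delta> * M * \<mu> \<le> 1"
  proof -
    have "0 < M * \<mu> + 1" using mult_nonneg_nonneg[OF M \<mu>] by linarith
    then show "0 < \<delta>" "\<delta> * M * \<mu> \<le> 1" by (auto simp: \<delta>_def divide_simps)
  qed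
  define C0 where "C0 = ?h * (K\<^sup>2 / \<delta>) + 1"
  have C0: "0 < C0" using h \<delta>(1) by (simp add: C0_def add_nonneg_pos)
  show ?thesis
  proof (rule that[OF C0])
    fix v CNit \<nu> \<gamma> assume v: "v \<in> velocity_space D k q" and CN: "C0 \<le> CNit" and \<nu>: "(0::real) < \<nu>" and \<gamma>: "(0::real) \<le> \<gamma>"
    obtain U c where U: "piecewise_C1 U" and vU: "\<And>x. x \<in> box lo up \<Longrightarrow> v (F x) = push U x"
      and "\<And>m x. m \<in> cells D \<Longrightarrow> x \<in> cell_open m \<Longrightarrow>
       v (F x) = (\<Sum>p\<in>basis_index k. c m p *\<^sub>R push (basis_field p) x)"
      using velocity_field[OF v] by blast
    let ?W = "push U" and ?Q = "L2_inner (Omega D) (sym_grad v) (sym_grad v)"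
    have Wc: "continuous_on (cbox lo up) ?W" by (rule piecewise_C1_continuous[OF piecewise_C1_push[OF U]])
    have Qnn: "0 \<le> ?Q" unfolding L2_inner_def by (rule Bochner_Integration.integral_nonneg) simp
    let ?Sb = "limit_from (Omega D) (sym_grad v)" and ?vb = "limit_from (Omega D) v"
    have vb: "?vb (F x) = ?W x" if "x \<in> cbox lo up" for x
      by (rule limit_velocity[OF U vU that])
    have Sb: "AE x in face_measure D i s. (norm (?Sb (F x)))\<^sup>2 \<le> M * ?Q" for i s
      using face_AE_off_edges AE_space
    proof eventually_elim
      case (elim x)
      then have x: "x \<in> face i s" by (simp add: space_face_measure)
      then have xc: "x \<in> cbox lo up" by simp
      obtain m T where m: "m \<in> cells D" "x \<in> cell_closed m" and T: "open T" "x \<in> T" "box lo up \<inter> T \<subseteq> cell_open m"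
        using face_point_cell[OF x] elim(1) by blast
      obtain S where S: "continuous_on reg S" "\<And>x. x \<in> cell_open m \<Longrightarrow> sym_grad v (F x) = S x"
        "\<And>x. x \<in> cell_closed m \<Longrightarrow> (norm (S x))\<^sup>2 \<le> M * ?Q"
        using strain[OF v m(1)] by blast
      have "(S \<longlongrightarrow> S x) (at x within reg)" using S(1) xc cbox_reg by (auto simp: continuous_on_def)
      then have "(S \<longlongrightarrow> S x) (at x within box lo up \<inter> T)"
        by (rule tendsto_within_subset) (use box_reg in blast)
      then have "?Sb (F x) = S x"
        by (rule limit_from_pullback[OF xc T(1,2)]) (use S(2) T(3) in blast)
      then show ?case using S(3)[OF m(2)] by simp
    qed
    define N where "N = (\<Sum>i\<in>UNIV. \<Sum>s\<in>UNIV. \<integral>x. (norm (?W x))\<^sup>2 \<partial>face_measure D i s)"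
    have W2: "continuous_on (cbox lo up) (\<lambda>x. (norm (?W x))\<^sup>2)" by (intro continuous_intros Wc)
    have Nnn: "0 \<le> N" unfolding N_def by (intro sum_nonneg) auto
    have NN: "boundary_integral D (\<lambda>x n. ((2 * \<nu> * (CNit / ?h)) *\<^sub>R ?vb x) \<bullet> ?vb x) = 2 * \<nu> * (CNit / ?h) * N"
    proof -
      have eqn: "(\<integral>x. ((2 * \<nu> * (CNit / ?h)) *\<^sub>R ?vb (F x)) \<bullet> ?vb (F x) \<partial>face_measure D i s)
          = 2 * \<nu> * (CNit / ?h) * (\<integral>x. (norm (?W x))\<^sup>2 \<partial>face_measure D i s)" for i s
      proof -
        have "(\<integral>x. ((2 * \<nu> * (CNit / ?h)) *\<^sub>R ?vb (F x)) \<bullet> ?vb (F x) \<partial>face_measure D i s)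
          = (\<integral>x. 2 * \<nu> * (CNit / ?h) * (norm (?W x))\<^sup>2 \<partial>face_measure D i s)"
          by (intro Bochner_Integration.integral_cong refl) (simp add: space_face_measure vb power2_norm_eq_inner)
        then show ?thesis by simp
      qed
      show ?thesis by (simp only: boundary_integral_def N_def eqn sum_distrib_left)
    qed
    define b where "b = boundary_integral D (\<lambda>x n. ((2 * \<nu>) *\<^sub>R (n v* ?Sb x)) \<bullet> ?vb x)"
    have bb: "b \<le> \<nu> * (\<delta> * M * ?Q * \<mu> + K\<^sup>2 / \<delta> * N)"
    proof -
      have one: "(\<integral>x. ((2 * \<nu>) *\<^sub>R (outward_normal D i s x v* ?Sb (F x))) \<bullet> ?vb (F x) \<partial>face_measure D i s)
          \<le> \<nu> * (\<delta> * M * ?Q) * (\<integral>x. (1::real) \<partial>face_measure D i s) + \<nu> * (K\<^sup>2 / \<delta>) * (\<integral>x. (norm (?W x))\<^sup>2 \<partial>face_measure D i s)" for i s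
      proof -
        have i1: "integrable (face_measure D i s) (\<lambda>x. \<nu> * (\<delta> * M * ?Q) * 1)"
          by (rule face_integral(2)) simp
        have i2: "integrable (face_measure D i s) (\<lambda>x. \<nu> * (K\<^sup>2 / \<delta>) * (norm (?W x))\<^sup>2)"
          by (rule face_integral(2)) (intro continuous_on_mult continuous_on_const W2)
        have "(\<integral>x. ((2 * \<nu>) *\<^sub>R (outward_normal D i s x v* ?Sb (F x))) \<bullet> ?vb (F x) \<partial>face_measure D i s)
            \<le> (\<integral>x. \<nu> * (\<delta> * M * ?Q) * 1 + \<nu> * (K\<^sup>2 / \<delta>) * (norm (?W x))\<^sup>2 \<partial>face_measure D i s)"
        proof (rule integral_mono_AE'[OF Bochner_Integration.integrable_add[OF i1 i2]])
          show "AE x in face_measure D i s. ((2 * \<nu>) *\<^sub>R (outward_normal D i s x v* ?Sb (F x))) \<bullet> ?vb (F x)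
              \<le> \<nu> * (\<delta> * M * ?Q) * 1 + \<nu> * (K\<^sup>2 / \<delta>) * (norm (?W x))\<^sup>2"
            using Sb[of i s] AE_space
          proof eventually_elim
            case (elim x)
            then have xc: "x \<in> cbox lo up" by (simp add: space_face_measure)
            let ?n = "outward_normal D i s x" and ?s = "norm (?Sb (F x))" and ?w = "norm (?W x)"
            have n1: "norm ?n = 1"
              using normal_dot_push(1)[of x i] xc cbox_reg by (auto simp: outward_normal_def)
            have "(?n v* ?Sb (F x)) \<bullet> ?W x \<le> norm (?n v* ?Sb (F x)) * ?w" by (rule norm_cauchy_schwarz)
            also have "\<dots> \<le> (?s * K) * ?w"
              using K(2)[of ?n "?Sb (F x)"] n1 by (intro mult_right_mono) auto
            finally have 1: "(?n v* ?Sb (F x)) \<bullet> ?W x \<le> ?s * (K * ?w)" by (simp add: mult_ac)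
            have "0 \<le> (\<delta> * ?s - K * ?w)\<^sup>2 / \<delta>" using \<delta>(1) by simp
            then have 2: "2 * (?s * (K * ?w)) \<le> \<delta> * ?s\<^sup>2 + K\<^sup>2 / \<delta> * ?w\<^sup>2"
              using \<delta>(1) by (simp add: power2_eq_square field_simps)
            have 3: "\<delta> * ?s\<^sup>2 \<le> \<delta> * (M * ?Q)" using elim(1) \<delta>(1) by (intro mult_left_mono) auto
            have "2 * ((?n v* ?Sb (F x)) \<bullet> ?W x) \<le> \<delta> * (M * ?Q) + K\<^sup>2 / \<delta> * ?w\<^sup>2" using 1 2 3 by linarith
            then have "\<nu> * (2 * ((?n v* ?Sb (F x)) \<bullet> ?W x)) \<le> \<nu> * (\<delta> * (M * ?Q) + K\<^sup>2 / \<delta> * ?w\<^sup>2)"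
              using \<nu> by (intro mult_left_mono) auto
            then show ?case by (simp add: vb[OF xc] algebra_simps)
          qed
          show "AE x in face_measure D i s. 0 \<le> \<nu> * (\<delta> * M * ?Q) * 1 + \<nu> * (K\<^sup>2 / \<delta>) * (norm (?W x))\<^sup>2"
            using \<nu> \<delta>(1) M Qnn by (intro AE_I2 add_nonneg_nonneg mult_nonneg_nonneg) auto
        qed
        also have "\<dots> = (\<integral>x. \<nu> * (\<delta> * M * ?Q) * 1 \<partial>face_measure D i s) + (\<integral>x. \<nu> * (K\<^sup>2 / \<delta>) * (norm (?W x))\<^sup>2 \<partial>face_measure D i s)"
          by (rule Bochner_Integration.integral_add[OF i1 i2])
        also have "\<dots> = \<nu> * (\<delta> * M * ?Q) * (\<integral>x. (1::real) \<partial>face_measure D i s) + \<nu> * (K\<^sup>2 / \<delta>) * (\<integral>x. (norm (?W x))\<^sup>2 \<partial>face_measure D i s)"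
          by (simp only: integral_mult_right_zero)
        finally show ?thesis .
      qed
      have "b \<le> (\<Sum>i\<in>UNIV. \<Sum>s\<in>UNIV. \<nu> * (\<delta> * M * ?Q) * (\<integral>x. (1::real) \<partial>face_measure D i s) + \<nu> * (K\<^sup>2 / \<delta>) * (\<integral>x. (norm (?W x))\<^sup>2 \<partial>face_measure D i s))"
        unfolding b_def boundary_integral_def by (intro sum_mono one)
      also have "\<dots> = \<nu> * (\<delta> * M * ?Q) * \<mu> + \<nu> * (K\<^sup>2 / \<delta>) * N"
        by (simp only: sum.distrib sum_distrib_left[symmetric] \<mu>_def N_def)
      finally show ?thesis by (simp add: algebra_simps)
    qed
    have L: "L2_inner (Omega D) (\<lambda>x. (2 * \<nu>) *\<^sub>R sym_grad v x) (sym_grad v) = 2 * \<nu> * ?Q"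
      by (simp add: L2_inner_def)
    have "K\<^sup>2 / \<delta> \<le> CNit / ?h"
    proof -
      have "?h * (K\<^sup>2 / \<delta>) \<le> CNit" using CN by (simp add: C0_def)
      then show ?thesis using h by (simp add: field_simps)
    qed
    then have t1: "\<nu> * (K\<^sup>2 / \<delta> * N) \<le> \<nu> * (CNit / ?h * N)"
      using Nnn \<nu> by (intro mult_left_mono mult_right_mono) auto
    have t2: "\<nu> * (\<delta> * M * \<mu> * ?Q) \<le> \<nu> * (1 * ?Q)"
      using \<delta>(2) Qnn \<nu> by (intro mult_left_mono mult_right_mono) auto
    have t3: "b \<le> \<nu> * (\<delta> * M * \<mu> * ?Q) + \<nu> * (K\<^sup>2 / \<delta> * N)"
      using bb by (simp add: distrib_left mult_ac)
    have "A_form D q \<nu> CNit \<gamma> v v = 2 * \<nu> * ?Q - b - b + 2 * \<nu> * (CNit / ?h) * N + J_form D q \<nu> \<gamma> v v"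
      unfolding A_form_def L NN b_def ..
    moreover have "0 \<le> J_form D q \<nu> \<gamma> v v" by (rule J_form_nonneg[OF \<nu> \<gamma>])
    moreover have "2 * \<nu> * ?Q = 2 * (\<nu> * (1 * ?Q))" "2 * \<nu> * (CNit / ?h) * N = 2 * (\<nu> * (CNit / ?h * N))"
      by (simp_all only: mult.assoc mult_1_left)
    ultimately show "0 \<le> A_form D q \<nu> CNit \<gamma> v v"
      using t1 t2 t3 by linarith
  qed
qed

end

section \<open>The kinetic energy\<close>

context iga_mesh
begin

lemma mesh_element_eq: "F x \<in> element D m \<longleftrightarrow> x \<in> cell_open m" if "x \<in> box lo up" "m \<in> cells D"
proof
  assume "F x \<in> element D m"
  then obtain z where z: "z \<in> cell_open m" "F x = F z" by (auto simp: element_def)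
  have "z \<in> box lo up" using z(1) cell_open_subset[OF that(2)] by blast
  then have "x = z" using z(2) Fi_F_box[OF that(1)] Fi_F_box by metis
  then show "x \<in> cell_open m" using z(1) by simp
qed (auto simp: element_def)

lemma mesh_disjoint:
  assumes "K \<in> mesh D" "K' \<in> mesh D" "K \<noteq> K'"
  shows "K \<inter> K' = {}"
proof (rule ccontr)
  assume "K \<inter> K' \<noteq> {}"
  obtain m m' where m: "m \<in> cells D" "m' \<in> cells D" "K = element D m" "K' = element D m'"
    using assms by (auto simp: mesh_def)
  then obtain y where y: "y \<in> element D m" "y \<in> element D m'" using \<open>K \<inter> K' \<noteq> {}\<close> by blast
  then obtain x where x: "x \<in> cell_open m" "y = F x" by (auto simp: element_def)
  then have "x \<in> cell_open m'" using mesh_element_eq[OF _ m(2)] cell_open_subset[OF m(1)] y(2) by blast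
  then have "m = m'" using cells_disjoint[OF m(1,2)] x by blast
  then show False using m assms(3) by simp
qed

lemma Union_mesh: "\<Union>(mesh D) = F ` broken_box"
  by (auto simp: mesh_def element_def broken_box_eq)

lemma finite_mesh: "finite (mesh D)"
  by (simp add: mesh_def finite_cells)

text \<open>Shape functions of the whole broken space: one push-forward of a monomial field on one element,
  extended by zero. Their span contains all velocities, on the union of the open elements.\<close>

definition cell_basis :: "('n \<Rightarrow> nat) \<times> ('n \<Rightarrow> nat) \<times> 'n \<Rightarrow> real^'n \<Rightarrow> real^'n" where
  "cell_basis i y = indicator (element D (fst i)) y *\<^sub>R push (basis_field (snd i)) (Fi y)"

lemma cell_basis_F:
  assumes "x \<in> cell_open m" "m \<in> cells D" "fst i \<in> cells D"
  shows "cell_basis i (F x) = (if fst i = m then push (basis_field (snd i)) x else 0)"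
proof -
  have xb: "x \<in> box lo up" using assms cell_open_subset by blast
  have "F x \<in> element D (fst i) \<longleftrightarrow> fst i = m"
    using mesh_element_eq[OF xb assms(3)] assms(1) cells_disjoint[OF assms(3,2)] by blast
  then show ?thesis using xb by (cases "fst i = m") (auto simp: cell_basis_def)
qed

lemma cell_basis_piecewise_continuous:
  assumes i: "fst i \<in> cells D"
  shows "piecewise_continuous (\<lambda>x. cell_basis i (F x))"
  unfolding piecewise_continuous_def
proof
  fix m assume m: "m \<in> cells D"
  have "continuous_on reg (push (basis_field (snd i)))"
    by (rule C1_imp_continuous, rule push_derivative[OF _ basis_field_C1(1)])
  then have "continuous_on (cell_closed m) (\<lambda>x. if fst i = m then push (basis_field (snd i)) x else 0)"
    using cell_closed_reg[OF m] by (cases "fst i = m") (auto intro: continuous_on_subset)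
  then show "\<exists>g. continuous_on (cell_closed m) g \<and> (\<forall>x\<in>cell_open m. cell_basis i (F x) = g x)"
    using cell_basis_F[OF _ m i] by blast
qed

lemma velocity_expand:
  assumes v: "v \<in> velocity_space D k q"
  shows "\<exists>c. \<forall>x\<in>broken_box. v (F x) = (\<Sum>i\<in>cells D \<times> basis_index k. c i *\<^sub>R cell_basis i (F x))"
proof -
  obtain U c where "piecewise_C1 U" "\<And>x. x \<in> box lo up \<Longrightarrow> v (F x) = push U x"
    and vc: "\<And>m x. m \<in> cells D \<Longrightarrow> x \<in> cell_open m \<Longrightarrow>
       v (F x) = (\<Sum>p\<in>basis_index k. c m p *\<^sub>R push (basis_field p) x)"
    using velocity_field[OF v] by blast
  have "v (F x) = (\<Sum>i\<in>cells D \<times> basis_index k. c (fst i) (snd i) *\<^sub>R cell_basis i (F x))" if x: "x \<in> broken_box" for x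
  proof -
    obtain m where m: "m \<in> cells D" "x \<in> cell_open m" using x by (auto simp: broken_box_eq)
    have "(\<Sum>i\<in>cells D \<times> basis_index k. c (fst i) (snd i) *\<^sub>R cell_basis i (F x))
       = (\<Sum>m'\<in>cells D. \<Sum>p\<in>basis_index k. c m' p *\<^sub>R cell_basis (m', p) (F x))"
      by (simp add: sum.cartesian_product case_prod_beta)
    also have "\<dots> = (\<Sum>m'\<in>cells D. if m' = m then (\<Sum>p\<in>basis_index k. c m p *\<^sub>R push (basis_field p) x) else 0)"
      by (intro sum.cong refl) (simp add: cell_basis_F[OF m(2,1)])
    also have "\<dots> = v (F x)"
      using m(1) finite_cells by (simp add: sum.delta vc[OF m])
    finally show ?thesis by simp
  qed
  then show ?thesis by (intro exI[of _ "\<lambda>i. c (fst i) (snd i)"]) blast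
qed

text \<open>Finitely many point values determine a discrete velocity, linearly and with fixed shape functions.
  A curve that is differentiable at every point therefore has differentiable coefficients.\<close>

lemma velocity_nodal_basis:
  "\<exists>(M::nat) pt cp (g :: nat \<Rightarrow> real^'n \<Rightarrow> real^'n). (\<forall>l<M. pt l \<in> Omega D) \<and>
    (\<forall>l. piecewise_continuous (\<lambda>x. g l (F x))) \<and>
    (\<forall>v\<in>velocity_space D k q. \<forall>x\<in>broken_box. v (F x) = (\<Sum>l<M. (v (pt l) $ cp l) *\<^sub>R g l (F x)))"
proof -
  let ?I = "cells D \<times> basis_index k"
  have fin: "finite ?I" by (intro finite_cartesian_product finite_cells finite_basis_index)
  let ?L = "\<lambda>(x, j) i. cell_basis i (F x) $ j"
  obtain M :: nat and l d where l: "\<And>k. k < M \<Longrightarrow> l k \<in> broken_box \<times> UNIV" and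
    dual: "\<And>x a. x \<in> broken_box \<times> UNIV \<Longrightarrow> (\<Sum>i\<in>?I. a i * ?L x i) =
        (\<Sum>k<M. (\<Sum>i\<in>?I. a i * ?L (l k) i) * (\<Sum>i\<in>?I. d k i * ?L x i))"
    using finite_dual_functionals[OF fin, where \<Lambda>="broken_box \<times> (UNIV :: 'n set)" and L="?L"] by blast
  define g where "g k y = (\<Sum>i\<in>?I. d k i *\<^sub>R cell_basis i y)" for k y
  show ?thesis
  proof (intro exI[of _ M] exI[of _ "\<lambda>k. F (fst (l k))"] exI[of _ "\<lambda>k. snd (l k)"] exI[of _ g] conjI allI impI ballI)
    show "F (fst (l k)) \<in> Omega D" if "k < M" for k
      using l[OF that] broken_box_subset by (auto simp: Omega_def)
    show "piecewise_continuous (\<lambda>x. g k (F x))" for k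
      unfolding g_def by (intro piecewise_continuous_intros cell_basis_piecewise_continuous) auto
    fix v x assume v: "v \<in> velocity_space D k q" and x: "x \<in> broken_box"
    obtain c where c: "\<And>x. x \<in> broken_box \<Longrightarrow> v (F x) = (\<Sum>i\<in>?I. c i *\<^sub>R cell_basis i (F x))"
      using velocity_expand[OF v] by blast
    have comp: "v (F z) $ j = (\<Sum>i\<in>?I. c i * ?L (z, j) i)" if "z \<in> broken_box" for z j
      using c[OF that] by simp
    have "v (F x) $ j = (\<Sum>k<M. (v (F (fst (l k))) $ snd (l k)) *\<^sub>R g k (F x)) $ j" for j
    proof -
      have "v (F x) $ j = (\<Sum>k<M. (\<Sum>i\<in>?I. c i * ?L (l k) i) * (\<Sum>i\<in>?I. d k i * ?L (x, j) i))"
        unfolding comp[OF x] by (rule dual) (use x in simp)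
      also have "\<dots> = (\<Sum>k<M. (v (F (fst (l k))) $ snd (l k)) * g k (F x) $ j)"
        using l by (intro sum.cong refl) (force simp: comp g_def case_prod_beta)
      finally show ?thesis by simp
    qed
    then show "v (F x) = (\<Sum>k<M. (v (F (fst (l k))) $ snd (l k)) *\<^sub>R g k (F x))" by (simp add: vec_eq_iff)
  qed
qed

end

context iga_mesh_23
begin

lemma integral_Omega_cong:
  fixes \<phi> \<psi> :: "real^'n \<Rightarrow> real"
  assumes "\<And>x. x \<in> broken_box \<Longrightarrow> \<phi> (F x) = \<psi> (F x)"
  shows "integrable (lebesgue_on (Omega D)) \<phi> \<longleftrightarrow> integrable (lebesgue_on (Omega D)) \<psi>"
    and "(\<integral>y. \<phi> y \<partial>lebesgue_on (Omega D)) = (\<integral>y. \<psi> y \<partial>lebesgue_on (Omega D))"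
proof -
  have e: "indicator broken_box x *\<^sub>R (\<bar>dJ x\<bar> * \<phi> (F x)) = (indicator broken_box x *\<^sub>R (\<bar>dJ x\<bar> * \<psi> (F x)) :: real)" for x
    using assms[of x] by (simp add: indicator_def)
  show "integrable (lebesgue_on (Omega D)) \<phi> \<longleftrightarrow> integrable (lebesgue_on (Omega D)) \<psi>"
    unfolding integral_Omega(1) set_integrable_def e ..
  show "(\<integral>y. \<phi> y \<partial>lebesgue_on (Omega D)) = (\<integral>y. \<psi> y \<partial>lebesgue_on (Omega D))"
    unfolding integral_Omega(2) set_lebesgue_integral_def e ..
qed

lemma integral_mesh_sum:
  fixes \<phi> :: "real^'n \<Rightarrow> real"
  assumes \<phi>: "integrable (lebesgue_on (Omega D)) \<phi>"
  shows "(\<Sum>K\<in>mesh D. \<integral>y. \<phi> y \<partial>lebesgue_on K) = (\<integral>y. \<phi> y \<partial>lebesgue_on (Omega D))"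
proof -
  have OmL: "Omega D \<inter> space lebesgue \<in> sets lebesgue" using Omega_open by simp
  have KL: "K \<in> sets lebesgue" "K \<subseteq> Omega D" if "K \<in> mesh D" for K
    using that element_open element_subset by (auto simp: mesh_def)
  have int: "set_integrable lebesgue (Omega D) \<phi>"
    using \<phi> integrable_restrict_space[OF OmL, of \<phi>] by (simp add: set_integrable_def)
  have "(\<integral>y. \<phi> y \<partial>lebesgue_on (Omega D)) = (\<integral>y. indicator (F ` broken_box) y *\<^sub>R \<phi> y \<partial>lebesgue_on (Omega D))"
    by (rule integral_Omega_cong(2)) simp
  also have "\<dots> = (LINT y:Omega D|lebesgue. indicator (F ` broken_box) y *\<^sub>R \<phi> y)"
    unfolding set_lebesgue_integral_def by (rule integral_restrict_space[OF OmL])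
  also have "\<dots> = (LINT y:(\<Union>K\<in>mesh D. K)|lebesgue. \<phi> y)"
  proof -
    have "F ` broken_box \<subseteq> Omega D" using broken_box_subset by (auto simp: Omega_def)
    then have e: "indicator (Omega D) y *\<^sub>R (indicator (F ` broken_box) y *\<^sub>R \<phi> y) = indicator (\<Union>K\<in>mesh D. K) y *\<^sub>R \<phi> y" for y
      using Union_mesh by (auto simp: indicator_def)
    show ?thesis unfolding set_lebesgue_integral_def e ..
  qed
  also have "\<dots> = (\<Sum>K\<in>mesh D. LINT y:K|lebesgue. \<phi> y)"
  proof (rule set_integral_finite_Union[OF finite_mesh])
    show "disjoint_family_on (\<lambda>K. K) (mesh D)" using mesh_disjoint by (auto simp: disjoint_family_on_def)
    show "set_integrable lebesgue K \<phi>" if "K \<in> mesh D" for K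
      by (rule set_integrable_subset[OF int]) (use KL[OF that] in auto)
  qed (use KL in auto)
  also have "\<dots> = (\<Sum>K\<in>mesh D. \<integral>y. \<phi> y \<partial>lebesgue_on K)"
    using KL(1) by (intro sum.cong refl) (simp add: set_lebesgue_integral_def integral_restrict_space)
  finally show ?thesis by simp
qed

text \<open>In the nodal basis the energy is a quadratic polynomial in differentiable coefficients, with a
  symmetric matrix \<open>H\<close> of \<open>L2\<close> products; the velocity and its time derivative have the same shape functions.\<close>

lemma energy_derivative:
  assumes u: "\<And>s. s \<in> {0<..T} \<Longrightarrow> u s \<in> velocity_space D k q"
    and diff: "\<And>s x. s \<in> {0<..T} \<Longrightarrow> x \<in> Omega D \<Longrightarrow> (\<lambda>s. u s x) differentiable (at s within {0<..T})"
    and t: "t \<in> {0<..T}"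
  shows "((\<lambda>s. 1/2 * mesh_L2_norm_sq D (u s)) has_real_derivative
      L2_inner (Omega D) (time_deriv T u t) (u t)) (at t within {0<..T})"
proof -
  let ?A = "at t within {0<..T}"
  \<comment> \<open>also at \<open>t = T\<close> the one-sided time derivative is unique\<close>
  have "t islimpt {0<..<t}" using t by (intro islimpt_greaterThanLessThan2) auto
  then have "t islimpt {0<..T}" by (rule islimpt_subset) (use t in auto)
  then have nb: "?A \<noteq> bot" by (simp add: trivial_limit_within)
  have ud: "((\<lambda>s. u s x) has_vector_derivative time_deriv T u t x) ?A" if "x \<in> Omega D" for x
    using diff[OF t that] unfolding time_deriv_def by (simp add: vector_derivative_works)
  obtain M :: nat and pt cp and g :: "nat \<Rightarrow> real^'n \<Rightarrow> real^'n" where pt: "\<And>l. l < M \<Longrightarrow> pt l \<in> Omega D"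
    and gc: "\<And>l. piecewise_continuous (\<lambda>x. g l (F x))"
    and rep: "\<And>v x. v \<in> velocity_space D k q \<Longrightarrow> x \<in> broken_box \<Longrightarrow> v (F x) = (\<Sum>l<(M::nat). (v (pt l) $ cp l) *\<^sub>R g l (F x))"
    using velocity_nodal_basis[of k] by blast
  define \<alpha> where "\<alpha> l s = u s (pt l) $ cp l" for l s
  define \<beta> where "\<beta> l = time_deriv T u t (pt l) $ cp l" for l
  have \<alpha>: "(\<alpha> l has_real_derivative \<beta> l) ?A" if "l < M" for l
    unfolding \<alpha>_def[abs_def] \<beta>_def has_real_derivative_iff_has_vector_derivative
    by (rule bounded_linear.has_vector_derivative[OF bounded_linear_vec_nth ud[OF pt[OF that]]])
  have urep: "u s (F x) = (\<Sum>l<M. \<alpha> l s *\<^sub>R g l (F x))" if "s \<in> {0<..T}" "x \<in> broken_box" for s x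
    using rep[OF u[OF that(1)] that(2)] by (simp add: \<alpha>_def)
  have trep: "time_deriv T u t (F x) = (\<Sum>l<M. \<beta> l *\<^sub>R g l (F x))" if x: "x \<in> broken_box" for x
  proof -
    have "((\<lambda>s. \<Sum>l<M. \<alpha> l s *\<^sub>R g l (F x)) has_vector_derivative (\<Sum>l<M. \<beta> l *\<^sub>R g l (F x))) ?A"
      using \<alpha> by (intro has_vector_derivative_sum) (auto intro!: derivative_eq_intros)
    then have "((\<lambda>s. u s (F x)) has_vector_derivative (\<Sum>l<M. \<beta> l *\<^sub>R g l (F x))) ?A"
      by (rule has_vector_derivative_transform[OF t, rotated]) (use urep[OF _ x] in auto)
    then show ?thesis unfolding time_deriv_def by (rule vector_derivative_within[OF nb])
  qed
  define H where "H l l' = L2_inner (Omega D) (g l) (g l')" for l l'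
  have Hint: "integrable (lebesgue_on (Omega D)) (\<lambda>y. g l y \<bullet> g l' y)" for l l'
    by (rule integrable_Omega(1)[OF piecewise_continuous_bilinear[OF bounded_bilinear_inner gc[of l] gc[of l']] refl])
  have expand: "integrable (lebesgue_on (Omega D)) (\<lambda>y. a y \<bullet> b y) \<and>
      L2_inner (Omega D) a b = (\<Sum>l<M. \<Sum>l'<M. p l * r l' * H l l')"
    if "\<And>x. x \<in> broken_box \<Longrightarrow> a (F x) = (\<Sum>l<M. p l *\<^sub>R g l (F x))"
      "\<And>x. x \<in> broken_box \<Longrightarrow> b (F x) = (\<Sum>l<M. r l *\<^sub>R g l (F x))" for a b p r
  proof -
    let ?\<psi> = "\<lambda>y. \<Sum>l<M. \<Sum>l'<M. p l * r l' * (g l y \<bullet> g l' y)"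
    have eq: "a (F x) \<bullet> b (F x) = ?\<psi> (F x)" if "x \<in> broken_box" for x
      unfolding \<open>x \<in> broken_box \<Longrightarrow> a (F x) = _\<close>[OF that] \<open>x \<in> broken_box \<Longrightarrow> b (F x) = _\<close>[OF that]
      by (simp add: inner_sum_left inner_sum_right sum_distrib_left mult_ac) (rule sum.swap)
    note cong = integral_Omega_cong[of "\<lambda>y. a y \<bullet> b y" ?\<psi>, OF eq]
    have "integrable (lebesgue_on (Omega D)) ?\<psi>"
      by (intro Bochner_Integration.integrable_sum integrable_mult_right Hint)
    moreover have "(\<integral>y. ?\<psi> y \<partial>lebesgue_on (Omega D)) = (\<Sum>l<M. \<Sum>l'<M. p l * r l' * H l l')"
      unfolding H_def L2_inner_def
      by (subst Bochner_Integration.integral_sum Bochner_Integration.integrable_sum,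
          (intro Bochner_Integration.integrable_sum integrable_mult_right Hint)?)+ simp
    ultimately show ?thesis using cong by (simp add: L2_inner_def)
  qed
  have energy: "mesh_L2_norm_sq D (u s) = (\<Sum>l<M. \<Sum>l'<M. \<alpha> l s * \<alpha> l' s * H l l')" if s: "s \<in> {0<..T}" for s
  proof -
    note e = expand[of "u s" "\<lambda>l. \<alpha> l s" "u s" "\<lambda>l. \<alpha> l s", OF urep[OF s] urep[OF s]]
    have "mesh_L2_norm_sq D (u s) = L2_inner (Omega D) (u s) (u s)"
      unfolding mesh_L2_norm_sq_def L2_inner_def by (rule integral_mesh_sum) (use e in blast)
    then show ?thesis using e by simp
  qed
  have Hsym: "H l l' = H l' l" for l l' by (simp add: H_def L2_inner_def inner_commute)
  have "((\<lambda>s. 1/2 * (\<Sum>l<M. \<Sum>l'<M. \<alpha> l s * \<alpha> l' s * H l l')) has_real_derivative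
      1/2 * (\<Sum>l<M. \<Sum>l'<M. (\<beta> l * \<alpha> l' t + \<beta> l' * \<alpha> l t) * H l l')) ?A"
    by (intro DERIV_cmult DERIV_sum DERIV_cmult_right DERIV_mult \<alpha>) auto
  also have "1/2 * (\<Sum>l<M. \<Sum>l'<M. (\<beta> l * \<alpha> l' t + \<beta> l' * \<alpha> l t) * H l l') = (\<Sum>l<M. \<Sum>l'<M. \<beta> l * \<alpha> l' t * H l l')"
  proof -
    have "(\<Sum>l<M. \<Sum>l'<M. \<beta> l' * \<alpha> l t * H l l') = (\<Sum>l<M. \<Sum>l'<M. \<beta> l * \<alpha> l' t * H l l')"
      by (subst sum.swap) (simp add: Hsym)
    then show ?thesis by (simp add: distrib_right sum.distrib)
  qed
  also have "\<dots> = L2_inner (Omega D) (time_deriv T u t) (u t)"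
    using expand[of "time_deriv T u t" \<beta> "u t" "\<lambda>l. \<alpha> l t", OF trep urep[OF t]] by simp
  finally show ?thesis
    by (rule has_field_derivative_transform_within[OF _ zero_less_one t]) (simp add: energy)
qed

end

section \<open>The energy identity and inequality\<close>

theorem theorem2:
  fixes D :: "('n::finite) iga" and k' \<alpha>' :: nat
  assumes dim: "CARD('n) = 2 \<or> CARD('n) = 3"
    and degree: "1 \<le> k'"
    and mesh: "admissible \<alpha>' D"
  shows "\<exists>C0>0. \<forall>CNit\<ge>C0. \<forall>\<nu>>0. \<forall>\<gamma>\<ge>0. \<forall>T>0. \<forall>f u.
           (\<forall>t\<in>{0<..T}. square_integrable (lebesgue_on (Omega D)) (f t)) \<longrightarrow>
           semidiscrete_solution D k' \<alpha>' \<nu> CNit \<gamma> T f u \<longrightarrow>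
           (\<forall>t\<in>{0<..T}.
              ((\<lambda>s. 1/2 * mesh_L2_norm_sq D (u s)) has_real_derivative
                 - A_stb D \<alpha>' \<nu> CNit \<gamma> (u t) (u t) + L2_inner (Omega D) (f t) (u t))
                (at t within {0<..T}) \<and>
              - A_stb D \<alpha>' \<nu> CNit \<gamma> (u t) (u t) + L2_inner (Omega D) (f t) (u t)
                \<le> L2_inner (Omega D) (f t) (u t))"
proof -
  interpret iga_mesh_23 D \<alpha>' by unfold_locales (use dim mesh in auto)
  obtain C0 where C0: "0 < C0" and coercive: "\<And>v CNit \<nu> \<gamma>. v \<in> velocity_space D k' \<alpha>' \<Longrightarrow> C0 \<le> CNit \<Longrightarrow>
      0 < \<nu> \<Longrightarrow> 0 \<le> \<gamma> \<Longrightarrow> 0 \<le> A_form D \<alpha>' \<nu> CNit \<gamma> v v"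
    using A_form_nonneg[of k'] by blast
  show ?thesis
  proof (intro exI[of _ C0] conjI C0 allI impI ballI)
    fix CNit \<nu> \<gamma> T :: real and f u t
    assume CNit: "C0 \<le> CNit" and \<nu>: "0 < \<nu>" and \<gamma>: "0 \<le> \<gamma>"
      and sol: "semidiscrete_solution D k' \<alpha>' \<nu> CNit \<gamma> T f u" and t: "t \<in> {0<..T}"
    have div_free: "u s \<in> div_free_space D k' \<alpha>'" if "s \<in> {0<..T}" for s
      using sol that unfolding semidiscrete_solution_def by blast
    then have vel: "u s \<in> velocity_space D k' \<alpha>'" if "s \<in> {0<..T}" for s
      using that unfolding div_free_space_def by blast
    have diff: "(\<lambda>s. u s x) differentiable (at s within {0<..T})" if "s \<in> {0<..T}" "x \<in> Omega D" for s x
      using sol that unfolding semidiscrete_solution_def by blast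
    have "L2_inner (Omega D) (time_deriv T u t) (u t) + A_stb D \<alpha>' \<nu> CNit \<gamma> (u t) (u t) = L2_inner (Omega D) (f t) (u t)"
      using sol t div_free[OF t] unfolding semidiscrete_solution_def by blast
    then have eq: "- A_stb D \<alpha>' \<nu> CNit \<gamma> (u t) (u t) + L2_inner (Omega D) (f t) (u t)
        = L2_inner (Omega D) (time_deriv T u t) (u t)" by simp
    show "((\<lambda>s. 1/2 * mesh_L2_norm_sq D (u s)) has_real_derivative
        - A_stb D \<alpha>' \<nu> CNit \<gamma> (u t) (u t) + L2_inner (Omega D) (f t) (u t)) (at t within {0<..T})"
      unfolding eq by (rule energy_derivative[OF vel diff t])
    have "0 \<le> A_stb D \<alpha>' \<nu> CNit \<gamma> (u t) (u t)"
      using coercive[OF vel[OF t] CNit \<nu> \<gamma>] convective_form_zero[OF div_free[OF t]] by (simp add: A_stb_def)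
    then show "- A_stb D \<alpha>' \<nu> CNit \<gamma> (u t) (u t) + L2_inner (Omega D) (f t) (u t)
        \<le> L2_inner (Omega D) (f t) (u t)" by simp
  qed
qed

end
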